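(* Let $n,k$ be positive integers, $\delta_0\in(0,1)$ and $c=10^{-9}\delta_0$. Suppose $\mathcal{A}\subset\binom{[n]}{k}$ with $|\mathcal{A}|=\binom{x}{k}$ for a real number $x\ge k$, and $|\partial(\mathcal{A})|\le(1+\tfrac{c}{x})\binom{x}{k-1}$. Then there is $S\subset[n]$ with $|\mathcal{A}\triangle\binom{S}{k}|\le\delta_0\binom{|S|-1}{k-1}$. Furthermore, for this $S$, if $|\mathcal{A}\cap\binom{S}{k}|=\binom{|S|-1}{k}+E_1$ and $|\mathcal{A}\setminus\binom{S}{k}|=E_2$ where $0\le E_1,E_2\le\binom{|S|-1}{k-1}$, then $|\partial(\mathcal{A})|\ge|\partial(\mathcal{J}^{(k)}_{|S|,E_1,E_2})|$.
   Context: For real $x$ and integer $k\ge0$, $\binom{x}{k}=x(x-1)\cdots(x-k+1)/k!$. $\binom{S}{k}$ is the family of $k$-element subsets of $S$. For a family $\mathcal{C}$ of $k$-sets, its shadow is $\partial\mathcal{C}=\{B: |B|=k-1,\ B\subset A\text{ for some }A\in\mathcal{C}\}$. The colex order on $k$-element sets of positive integers is: $A<B$ iff $\max(A\triangle B)\in B$; $\mathcal{I}^{(k)}_m$ denotes its initial segment of length $m$. For an integer $s$ and integers $E_1,E_2\ge0$, $\mathcal{J}^{(k)}_{s,E_1,E_2}=\mathcal{I}^{(k)}_{\binom{s-1}{k}+E_1}\cup\big(\mathcal{I}^{(k)}_{\binom{s}{k}+E_2}\setminus\mathcal{I}^{(k)}_{\binom{s}{k}}\big)$. *)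

theory Defs
  imports Complex_Main "HOL-Library.Ramsey"
begin

(* The family of k-element subsets of S is nsets S k, from the library. *)

definition shadow :: "nat \<Rightarrow> nat set set \<Rightarrow> nat set set" where
  "shadow k \<C> = {B. finite B \<and> card B = k - 1 \<and> (\<exists>A\<in>\<C>. B \<subset> A)}"

(* The conjunct A \<noteq> B is needed because Max is unspecified on the empty set. *)
definition colex_less :: "nat set \<Rightarrow> nat set \<Rightarrow> bool" where
  "colex_less A B \<longleftrightarrow> A \<noteq> B \<and> Max (sym_diff A B) \<in> B"

(* The first m sets in the colex order on k-sets of positive integers: those with fewer
   than m predecessors.  The set of predecessors is always finite, since A < B in colex
   forces A to be contained in {1..Max B}, so card counts it correctly. *)
definition colex_initial :: "nat \<Rightarrow> nat \<Rightarrow> nat set set" where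
  "colex_initial k m =
     {B \<in> nsets {1..} k. card {A \<in> nsets {1..} k. colex_less A B} < m}"

(* Intended for s \<ge> 1: at s = 0 the subtraction s - 1 truncates. *)
definition J_family :: "nat \<Rightarrow> nat \<Rightarrow> nat \<Rightarrow> nat \<Rightarrow> nat set set" where
  "J_family k s E1 E2 =
     colex_initial k (((s - 1) choose k) + E1) \<union>
     (colex_initial k ((s choose k) + E2) - colex_initial k (s choose k))"

end

(* The second part holds for every S such that binom(S, k) meets A. Vertices outside S can be removed one at a time, and since the
   minimal shadow size is subadditive, the E2 sets outside S contribute at least the shadow of a colex
   segment of E2 sets of size k - 1 to the part of the shadow outside S; Kruskal-Katona handles the rest.

   For the first part, write M for the degree binom(x-1, k-1) of the extremal family. Concavity of the
   Lovasz bound shows that for every S the proportion p of A \ binom(S, k), relative to M, satisfies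
   p (1 - p) <= c whenever p <= 1, so p is close to 0 or at least nearly 1. Hence every degree is either tiny or nearly M at least.
   Let S be the set of vertices of large degree. Deleting the others one by one never crosses the gap,
   so at most 2 c M sets of A leave S. It remains to bound |S| above. Summing the shadows of all links,
   either |S| <= x + 16 c, or some vertex of large degree has a link that is near-extremal with the same
   c; by induction on k its core has about x - 1 elements, and together with that vertex it contains S.
   Once |S| is at most x + 1/500, Kruskal-Katona for A inside S, with the shadow of the last layer
   estimated either by Lovasz's bound or by the same bound for complements, shows that at most
   40 c binom(|S|-1, k-1) sets of binom(S, k) are missing. *)
theory Submission
  imports Defs
begin

section \<open>Shadows and links\<close>

text \<open>The obstacle is the size of the core. Degrees alone give
  \<open>|S| * (1 - 2 * c) \<le> x\<close>, an error proportional to \<open>x\<close>, whereas the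
  final comparison needs a bounded one. The form \<open>c / x\<close> of the slack makes this
  possible: the relative link shadows add up to at most \<open>(1 + c / x) * x\<close>, and unless
  some link of sufficient size is itself near-extremal with constant \<open>c\<close>, the same
  factor can be extracted from every link. It cancels and leaves a bound of order \<open>c\<close>
  for the total degree deficit of the core. In the other case the link has the very same
  \<open>c\<close>, so the induction loses nothing in the constant. The error in the size of the
  core does not accumulate either: a step of the induction yields only \<open>x + 1 / 500\<close>,
  but the comparison with Kruskal--Katona inside \<open>S\<close> improves this to
  \<open>x + 40 * c\<close>, below the \<open>x + 1 / 1000\<close> assumed by induction. Exact
  Kruskal--Katona, through \<open>colex_shadow\<close>, serves the second part and the splitting at
  \<open>S\<close>; the real-parameter form serves the estimates, since \<open>x\<close> need not be
  an integer.\<close>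

definition kfam :: "nat \<Rightarrow> nat set set \<Rightarrow> bool" where
  "kfam k A \<longleftrightarrow> finite A \<and> A \<subseteq> nsets UNIV k"

definition link :: "nat \<Rightarrow> nat set set \<Rightarrow> nat set set" where
  "link v A = (\<lambda>B. B - {v}) ` {B \<in> A. v \<in> B}"

lemma kfamD:
  assumes "kfam k A" "B \<in> A"
  shows "finite B" "card B = k"
  using assms by (auto simp: kfam_def nsets_def)

lemma kfam_finite: "kfam k A \<Longrightarrow> finite A"
  by (simp add: kfam_def)

lemma kfamI: "finite A \<Longrightarrow> (\<And>B. B \<in> A \<Longrightarrow> finite B \<and> card B = k) \<Longrightarrow> kfam k A"
  by (auto simp: kfam_def nsets_def)

lemma kfam_subset: "kfam k A \<Longrightarrow> B \<subseteq> A \<Longrightarrow> kfam k B"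
  by (auto simp: kfam_def intro: finite_subset)

lemma kfam_finite_Union: "kfam k A \<Longrightarrow> finite (\<Union>A)"
  using kfamD kfam_finite by blast

lemma shadowI: "finite B \<Longrightarrow> card B = k - 1 \<Longrightarrow> A \<in> F \<Longrightarrow> B \<subset> A \<Longrightarrow> B \<in> shadow k F"
  unfolding shadow_def by blast

lemma shadow_iff:
  assumes "kfam (Suc k) A"
  shows "B \<in> shadow (Suc k) A \<longleftrightarrow> (\<exists>v. v \<notin> B \<and> insert v B \<in> A)"
proof
  assume "B \<in> shadow (Suc k) A"
  then obtain C where C: "finite B" "card B = k" "C \<in> A" "B \<subset> C"
    by (auto simp: shadow_def)
  have fC: "finite C" "card C = Suc k" using kfamD[OF assms C(3)] by auto
  then have "card (C - B) = 1"
    using C by (simp add: card_Diff_subset)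
  then obtain v where v: "C - B = {v}" using card_1_singletonE by blast
  then have "v \<notin> B" "insert v B = C" using C by auto
  then show "\<exists>v. v \<notin> B \<and> insert v B \<in> A" using C by auto
next
  assume "\<exists>v. v \<notin> B \<and> insert v B \<in> A"
  then obtain v where v: "v \<notin> B" "insert v B \<in> A" by auto
  have "finite (insert v B)" "card (insert v B) = Suc k" using kfamD[OF assms v(2)] by auto
  then show "B \<in> shadow (Suc k) A"
    using v by (auto simp: shadow_def)
qed

lemma shadow_mono: "A \<subseteq> B \<Longrightarrow> shadow k A \<subseteq> shadow k B"
  by (auto simp: shadow_def)

lemma shadow_Un: "shadow k (A \<union> B) = shadow k A \<union> shadow k B"
  by (auto simp: shadow_def)

lemma finite_shadow:
  assumes "kfam k A"
  shows "finite (shadow k A)"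
proof (rule finite_subset)
  show "shadow k A \<subseteq> Pow (\<Union>A)" by (auto simp: shadow_def)
  show "finite (Pow (\<Union>A))" using kfam_finite_Union[OF assms] by simp
qed

lemma kfam_shadow: "kfam (Suc k) A \<Longrightarrow> kfam k (shadow (Suc k) A)"
  by (rule kfamI) (auto simp: finite_shadow, auto simp: shadow_def)

lemma Union_shadow: "\<Union>(shadow k A) \<subseteq> \<Union>A"
  by (auto simp: shadow_def)

lemma shadow_0: "kfam 0 A \<Longrightarrow> shadow 0 A = {}"
proof -
  assume A: "kfam 0 A"
  have "B = {}" if "B \<in> A" for B using kfamD[OF A that] by auto
  then show ?thesis by (auto simp: shadow_def)
qed

lemma shadow_1:
  assumes "kfam (Suc 0) A" "A \<noteq> {}"
  shows "shadow (Suc 0) A = {{}}"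
proof -
  obtain B where "B \<in> A" using assms by auto
  moreover have "B \<noteq> {}" using kfamD[OF assms(1) \<open>B \<in> A\<close>] by auto
  ultimately show ?thesis by (auto simp: shadow_def)
qed

lemma mem_link: "C \<in> link v A \<longleftrightarrow> v \<notin> C \<and> insert v C \<in> A"
proof
  assume "C \<in> link v A"
  then show "v \<notin> C \<and> insert v C \<in> A"
    unfolding link_def by (auto simp: insert_absorb)
next
  assume "v \<notin> C \<and> insert v C \<in> A"
  then show "C \<in> link v A"
    unfolding link_def by (intro image_eqI[of _ _ "insert v C"]) auto
qed

lemma card_link: "card (link v A) = card {B \<in> A. v \<in> B}"
  unfolding link_def by (rule card_image) (auto simp: inj_on_def)

lemma finite_link: "finite A \<Longrightarrow> finite (link v A)"
  by (simp add: link_def)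

lemma kfam_link: "kfam (Suc k) A \<Longrightarrow> kfam k (link v A)"
  by (rule kfamI) (auto simp: link_def kfam_finite dest: kfamD)

lemma card_split: 
  assumes "finite A"
  shows "card A = card {B \<in> A. P B} + card {B \<in> A. \<not> P B}"
proof -
  have "A = {B \<in> A. P B} \<union> {B \<in> A. \<not> P B}" by auto
  then show ?thesis using assms
    by (metis (no_types, lifting) card_Un_disjoint disjoint_iff finite_Un mem_Collect_eq)
qed

lemma shadow_containing:
  assumes "kfam (Suc (Suc k)) A"
  shows "{B \<in> shadow (Suc (Suc k)) A. v \<in> B} = insert v ` shadow (Suc k) (link v A)"
proof (rule set_eqI)
  fix B
  have l: "kfam (Suc k) (link v A)" using assms by (rule kfam_link)
  show "B \<in> {B \<in> shadow (Suc (Suc k)) A. v \<in> B} \<longleftrightarrow> B \<in> insert v ` shadow (Suc k) (link v A)"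
  proof
    assume "B \<in> {B \<in> shadow (Suc (Suc k)) A. v \<in> B}"
    then obtain w where w: "v \<in> B" "w \<notin> B" "insert w B \<in> A"
      using shadow_iff[OF assms] by auto
    have "insert v (insert w (B - {v})) = insert w B" using w by auto
    then have "insert v (insert w (B - {v})) \<in> A" "v \<notin> insert w (B - {v})"
      using w by auto
    then have "insert w (B - {v}) \<in> link v A" by (simp add: mem_link)
    then have "B - {v} \<in> shadow (Suc k) (link v A)"
      using shadow_iff[OF l] w by blast
    then show "B \<in> insert v ` shadow (Suc k) (link v A)"
      using w by (intro image_eqI[of _ _ "B - {v}"]) auto
  next
    assume "B \<in> insert v ` shadow (Suc k) (link v A)"
    then obtain C where C: "B = insert v C" "C \<in> shadow (Suc k) (link v A)" by auto
    then obtain w where w: "w \<notin> C" "insert w C \<in> link v A" using shadow_iff[OF l] by auto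
    then have "w \<noteq> v" "insert v (insert w C) \<in> A" by (auto simp: mem_link)
    then show "B \<in> {B \<in> shadow (Suc (Suc k)) A. v \<in> B}"
      using shadow_iff[OF assms] w C by (auto simp: insert_commute)
  qed
qed

lemma card_shadow_containing:
  assumes "kfam (Suc (Suc k)) A"
  shows "card {B \<in> shadow (Suc (Suc k)) A. v \<in> B} = card (shadow (Suc k) (link v A))"
proof -
  have l: "kfam (Suc k) (link v A)" using assms by (rule kfam_link)
  have "inj_on (insert v) (shadow (Suc k) (link v A))"
  proof (rule inj_onI)
    fix B C assume *: "B \<in> shadow (Suc k) (link v A)" "C \<in> shadow (Suc k) (link v A)" "insert v B = insert v C"
    then have "v \<notin> B" "v \<notin> C" using shadow_iff[OF l] by (auto simp: mem_link)
    then show "B = C" using * by (metis Diff_insert_absorb)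
  qed
  then show ?thesis unfolding shadow_containing[OF assms] by (rule card_image)
qed

lemma link_subset_shadow:
  assumes "kfam (Suc k) A"
  shows "link v A \<subseteq> {B \<in> shadow (Suc k) A. v \<notin> B}"
  using shadow_iff[OF assms] by (auto simp: mem_link)

lemma card_shadow_split:
  assumes "kfam (Suc (Suc k)) A"
  shows "card (shadow (Suc (Suc k)) A) =
    card (shadow (Suc k) (link v A)) + card {B \<in> shadow (Suc (Suc k)) A. v \<notin> B}"
  using card_split[OF finite_shadow[OF assms], of "\<lambda>B. v \<in> B"]
  by (simp add: card_shadow_containing[OF assms])

text \<open>Shadow sets through \<open>v\<close> come from the shadow of the link, and the link
  itself consists of shadow sets avoiding \<open>v\<close>. Equality means that all sets avoiding
  \<open>v\<close> have their shadow in the link, the situation that shifting creates.\<close>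

lemma card_shadow_ge_link:
  assumes "kfam (Suc (Suc k)) A"
  shows "card (shadow (Suc (Suc k)) A) \<ge> card (shadow (Suc k) (link v A)) + card (link v A)"
proof -
  have "card (link v A) \<le> card {B \<in> shadow (Suc (Suc k)) A. v \<notin> B}"
    using link_subset_shadow[OF assms] finite_shadow[OF assms] by (intro card_mono) auto
  then show ?thesis using card_shadow_split[OF assms, of v] by simp
qed

lemma sum_degrees:
  assumes "kfam k A" "finite V" "\<Union>A \<subseteq> V"
  shows "(\<Sum>v\<in>V. card {B \<in> A. v \<in> B}) = k * card A"
proof -
  have "(\<Sum>v\<in>V. card {B \<in> A. v \<in> B}) = (\<Sum>v\<in>V. \<Sum>B\<in>A. if v \<in> B then 1 else 0)"
    using kfam_finite[OF assms(1)] by (simp add: sum.If_cases Int_def)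
  also have "\<dots> = (\<Sum>B\<in>A. \<Sum>v\<in>V. if v \<in> B then 1 else 0)" by (rule sum.swap)
  also have "\<dots> = (\<Sum>B\<in>A. k)"
  proof (rule sum.cong[OF refl])
    fix B assume B: "B \<in> A"
    have "V \<inter> B = B" using B assms by auto
    then show "(\<Sum>v\<in>V. if v \<in> B then 1 else 0) = k"
      using kfamD[OF assms(1) B] assms(2) by (simp add: sum.If_cases Int_def[symmetric])
  qed
  finally show ?thesis by simp
qed

lemma sum_card_link:
  assumes "kfam k A"
  shows "(\<Sum>v\<in>\<Union>A. card (link v A)) = k * card A"
  unfolding card_link by (rule sum_degrees[OF assms kfam_finite_Union[OF assms]]) simp

lemma sum_card_shadow_link:
  assumes "kfam (Suc (Suc k)) A"
  shows "(\<Sum>v\<in>\<Union>A. card (shadow (Suc k) (link v A))) = Suc k * card (shadow (Suc (Suc k)) A)"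
  unfolding card_shadow_containing[OF assms, symmetric]
  by (rule sum_degrees[OF kfam_shadow[OF assms] kfam_finite_Union[OF assms] Union_shadow])

section \<open>Shifting towards a vertex\<close>

lemma shift_properties:
  assumes A: "kfam (Suc k) A" and vj: "v \<noteq> j"
  defines "U \<equiv> {B \<in> A. j \<in> B \<and> v \<notin> B \<and> insert v (B - {j}) \<notin> A}"
  defines "A' \<equiv> (A - U) \<union> (\<lambda>B. insert v (B - {j})) ` U"
  shows "kfam (Suc k) A'" "card A' = card A"
    "card (shadow (Suc k) A') \<le> card (shadow (Suc k) A)"
    "card {B \<in> A'. v \<notin> B} = card {B \<in> A. v \<notin> B} - card U"
proof -
  let ?s = "\<lambda>B. insert v (B - {j})"
  have fA: "finite A" using A kfam_finite by auto
  have U: "U \<subseteq> A" by (auto simp: U_def)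
  have fU: "finite U" using U fA finite_subset by auto
  have inj: "inj_on ?s U"
  proof (rule inj_onI)
    fix B C assume *: "B \<in> U" "C \<in> U" "?s B = ?s C"
    then have "v \<notin> B" "v \<notin> C" "j \<in> B" "j \<in> C" by (auto simp: U_def)
    then have "B = insert j (?s B - {v})" "C = insert j (?s C - {v})" using vj by auto
    then show "B = C" using *(3) by simp
  qed
  show kA': "kfam (Suc k) A'"
  proof (rule kfamI)
    show "finite A'" using fA fU by (simp add: A'_def)
    fix B assume "B \<in> A'"
    then consider "B \<in> A" | C where "C \<in> U" "B = ?s C" by (auto simp: A'_def)
    then show "finite B \<and> card B = Suc k"
    proof cases
      case 1 then show ?thesis using kfamD[OF A] by auto
    next
      case 2
      then have "C \<in> A" "v \<notin> C" "j \<in> C" by (auto simp: U_def)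
      then show ?thesis using 2 kfamD[OF A, of C] by (auto simp: card_insert_if)
    qed
  qed
  have disj: "(A - U) \<inter> ?s ` U = {}" by (auto simp: U_def)
  show "card A' = card A"
    unfolding A'_def using disj fA fU U card_image[OF inj]
    by (subst card_Un_disjoint) (auto simp: card_Diff_subset card_mono)
  have "{B \<in> A'. v \<notin> B} = {B \<in> A. v \<notin> B} - U" by (auto simp: A'_def)
  moreover have "U \<subseteq> {B \<in> A. v \<notin> B}" by (auto simp: U_def)
  ultimately show "card {B \<in> A'. v \<notin> B} = card {B \<in> A. v \<notin> B} - card U"
    using fU by (simp add: card_Diff_subset)
  let ?D = "shadow (Suc k) A" and ?D' = "shadow (Suc k) A'"
  let ?t = "\<lambda>C. insert j (C - {v})"
  \<comment> \<open>A new shadow set contains \<open>v\<close> but not \<open>j\<close>, and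
    exchanging them back gives a shadow set that has been lost. The exchange is injective, so the
    shadow does not grow.\<close>
  have key: "v \<in> C \<and> j \<notin> C \<and> ?t C \<in> ?D - ?D'" if C: "C \<in> ?D' - ?D" for C
  proof -
    obtain z where z: "z \<notin> C" "insert z C \<in> A'" using C shadow_iff[OF kA'] by auto
    have nA: "insert y C \<notin> A" if "y \<notin> C" for y using C that shadow_iff[OF A] by auto
    then obtain B where B: "B \<in> U" "insert z C = ?s B"
      using z by (auto simp: A'_def)
    have B': "B \<in> A" "j \<in> B" "v \<notin> B" using B by (auto simp: U_def)
    have j: "j \<notin> insert z C" and v: "v \<in> insert z C" using B(2) vj by auto
    have BC: "B = insert j (insert z C - {v})" using B B' by auto
    have "z \<noteq> v"
    proof
      assume "z = v"
      then have "B = insert j C" using BC z by auto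
      then show False using nA[of j] B' j by auto
    qed
    then have vC: "v \<in> C" and jC: "j \<notin> C" and zj: "z \<noteq> j" using v j by auto
    have "B = insert z (?t C)" using BC \<open>z \<noteq> v\<close> by auto
    moreover have "z \<notin> ?t C" using z zj by auto
    ultimately have 1: "?t C \<in> ?D" using shadow_iff[OF A] B' by auto
    have 2: "?t C \<notin> ?D'"
    proof
      assume "?t C \<in> ?D'"
      then obtain y where y: "y \<notin> ?t C" "insert y (?t C) \<in> A'" using shadow_iff[OF kA'] by auto
      show False
      proof (cases "y = v")
        case True
        then have eq: "insert y (?t C) = insert j C" using vC by auto
        then have "insert j C \<notin> ?s ` U" using vj by auto
        then have "insert j C \<in> A" using y eq by (auto simp: A'_def)
        then show False using nA jC by auto
      next
        \<comment> \<open>A set with \<open>j\<close> but not \<open>v\<close> that survives the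
          shift was blocked by its own image, which is therefore already in
          \<open>A\<close>.\<close>
        case False
        have "v \<notin> insert y (?t C)" using False vj by auto
        then have "insert y (?t C) \<notin> ?s ` U" by auto
        then have "insert y (?t C) \<in> A - U" using y by (auto simp: A'_def)
        then have "?s (insert y (?t C)) \<in> A" using \<open>v \<notin> insert y (?t C)\<close> by (auto simp: U_def)
        moreover have "?s (insert y (?t C)) = insert y C" using y False vC jC by auto
        moreover have "y \<notin> C" using y False by auto
        ultimately show False using nA by auto
      qed
    qed
    show ?thesis using vC jC 1 2 by auto
  qed
  have fD: "finite ?D" "finite ?D'" using finite_shadow A kA' by auto
  have "inj_on ?t (?D' - ?D)"
  proof (rule inj_onI)
    fix B C assume *: "B \<in> ?D' - ?D" "C \<in> ?D' - ?D" "?t B = ?t C"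
    have "v \<in> B" "j \<notin> B" "v \<in> C" "j \<notin> C" using key[OF *(1)] key[OF *(2)] by auto
    then have "B = insert v (?t B - {j})" "C = insert v (?t C - {j})" using vj by auto
    then show "B = C" using *(3) by simp
  qed
  then have "card (?D' - ?D) \<le> card (?D - ?D')"
    using key fD by (intro card_inj_on_le[of ?t]) auto
  then show "card ?D' \<le> card ?D"
    using fD card_Int_Diff[OF fD(1), of ?D'] card_Int_Diff[OF fD(2), of ?D] by (simp add: Int_commute)
qed

text \<open>Shift with \<open>v\<close> fixed and varying \<open>j\<close> until nothing moves; each
  effective shift lowers the number of sets avoiding \<open>v\<close>. Stability towards a single
  vertex is what \<open>colex_shadow_le_add\<close> consumes.\<close>

lemma exists_shifted:
  assumes "kfam (Suc k) A"
  shows "\<exists>A'. kfam (Suc k) A' \<and> card A' = card A \<and>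
     card (shadow (Suc k) A') \<le> card (shadow (Suc k) A) \<and>
     shadow (Suc k) {B \<in> A'. v \<notin> B} \<subseteq> link v A'"
  using assms
proof (induction "card {B \<in> A. v \<notin> B}" arbitrary: A rule: less_induct)
  case less
  show ?case
  proof (cases "shadow (Suc k) {B \<in> A. v \<notin> B} \<subseteq> link v A")
    case True
    then show ?thesis using less.prems by blast
  next
    case False
    have k0: "kfam (Suc k) {B \<in> A. v \<notin> B}" using kfam_subset[OF less.prems] by auto
    from False obtain C where C: "C \<in> shadow (Suc k) {B \<in> A. v \<notin> B}" "C \<notin> link v A" by auto
    then obtain j where j: "j \<notin> C" "insert j C \<in> A" "v \<notin> insert j C"
      using shadow_iff[OF k0] by auto
    let ?U = "{B \<in> A. j \<in> B \<and> v \<notin> B \<and> insert v (B - {j}) \<notin> A}"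
    have vj: "v \<noteq> j" using j by auto
    note sh = shift_properties[OF less.prems vj]
    have U: "insert j C \<in> ?U" using j C by (auto simp: mem_link)
    have fA: "finite A" using less.prems kfam_finite by auto
    have "card ?U > 0" using U fA by (subst card_gt_0_iff) auto
    moreover have "card {B \<in> A. v \<notin> B} > 0" using U fA by (subst card_gt_0_iff) auto
    ultimately have lt: "card {B \<in> A. v \<notin> B} - card ?U < card {B \<in> A. v \<notin> B}" by simp
    obtain A' where "kfam (Suc k) A'" "card A' = card A"
      "card (shadow (Suc k) A') \<le> card (shadow (Suc k) A)"
      "shadow (Suc k) {B \<in> A'. v \<notin> B} \<subseteq> link v A'"
      using less.hyps[OF _ sh(1)] sh(2,3) lt unfolding sh(4) by fastforce
    then show ?thesis by blast
  qed
qed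

section \<open>Initial segments of the colex order\<close>

text \<open>The Kruskal--Katona function. On the cascade representation of \<open>m\<close> it is
  computed by \<open>colex_shadow_Suc\<close>.\<close>

definition colex_shadow :: "nat \<Rightarrow> nat \<Rightarrow> nat" where
  "colex_shadow k m = card (shadow k (colex_initial k m))"

abbreviation colex_below :: "nat \<Rightarrow> nat set \<Rightarrow> nat set set" where
  "colex_below k B \<equiv> {A \<in> nsets {1..} k. colex_less A B}"

lemma colex_less_iff:
  assumes "finite A" "finite B"
  shows "colex_less A B \<longleftrightarrow> (\<exists>m\<in>B - A. \<forall>x>m. x \<in> A \<longleftrightarrow> x \<in> B)"
proof
  assume *: "colex_less A B"
  let ?m = "Max (sym_diff A B)"
  have fin: "finite (sym_diff A B)" using assms by simp
  have "sym_diff A B \<noteq> {}" using * by (auto simp: colex_less_def)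
  then have "?m \<in> sym_diff A B" using Max_in[OF fin] by simp
  moreover have "?m \<in> B" using * by (simp add: colex_less_def)
  moreover have "x \<in> A \<longleftrightarrow> x \<in> B" if "x > ?m" for x
  proof -
    have "x \<notin> sym_diff A B" using Max_ge[OF fin, of x] that by (meson leD)
    then show ?thesis by blast
  qed
  ultimately show "\<exists>m\<in>B - A. \<forall>x>m. x \<in> A \<longleftrightarrow> x \<in> B" by blast
next
  assume "\<exists>m\<in>B - A. \<forall>x>m. x \<in> A \<longleftrightarrow> x \<in> B"
  then obtain m where m: "m \<in> B - A" "\<forall>x>m. x \<in> A \<longleftrightarrow> x \<in> B" by auto
  have "Max (sym_diff A B) = m"
  proof (rule Max_eqI)
    show "finite (sym_diff A B)" using assms by auto
    show "m \<in> sym_diff A B" using m by auto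
    show "y \<le> m" if "y \<in> sym_diff A B" for y
    proof (rule ccontr)
      assume "\<not> y \<le> m"
      then have "y \<in> A \<longleftrightarrow> y \<in> B" using m(2) by simp
      then show False using that by blast
    qed
  qed
  moreover have "A \<noteq> B" using m(1) by blast
  ultimately show "colex_less A B" using m(1) unfolding colex_less_def by simp
qed

lemma nsets_finite: "A \<in> nsets S k \<Longrightarrow> finite A" by (auto simp: nsets_def)

lemma finite_nsets_atMost: "finite (nsets {1..s::nat} k)"
  by (simp add: finite_imp_finite_nsets)

lemma card_nsets_atMost: "card (nsets {1..s::nat} k) = s choose k"
  by (simp add: card_nsets)

lemma nsets_below:
  assumes "B \<in> nsets {1..} k" "b \<in> B" "s < b"
  shows "nsets {1..s} k \<subseteq> colex_below k B"
proof
  fix A assume A: "A \<in> nsets {1..s} k"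
  have fB: "finite B" using assms nsets_finite by blast
  have fA: "finite A" using A nsets_finite by blast
  have m: "Max B \<in> B" "Max B \<ge> b" using fB assms by (auto intro: Max_in)
  have "x \<in> A \<longleftrightarrow> x \<in> B" if "x > Max B" for x
  proof -
    have "x \<notin> B" using that fB Max_ge leD by blast
    moreover have "A \<subseteq> {1..s}" using A by (simp add: nsets_def)
    then have "x \<notin> A" using that m(2) assms(3) by fastforce
    ultimately show ?thesis by simp
  qed
  moreover have "A \<subseteq> {1..s}" using A by (simp add: nsets_def)
  then have "Max B \<notin> A" using m(2) assms(3) by fastforce
  ultimately have "colex_less A B" using m unfolding colex_less_iff[OF fA fB] by blast
  then show "A \<in> colex_below k B" using A by (auto simp: nsets_def)
qed

lemma colex_below_subset:
  assumes "B \<in> nsets {1..s} k"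
  shows "colex_below k B \<subseteq> nsets {1..s} k - {B}"
proof
  fix A assume A: "A \<in> colex_below k B"
  have fB: "finite B" "B \<subseteq> {1..s}" using assms by (auto simp: nsets_def)
  have fA: "finite A" "A \<subseteq> {1..}" "card A = k" using A by (auto simp: nsets_def)
  obtain m where m: "m \<in> B - A" "\<forall>x>m. x \<in> A \<longleftrightarrow> x \<in> B"
    using A colex_less_iff[OF fA(1) fB(1)] by auto
  have "x \<le> s" if "x \<in> A" for x
  proof (rule ccontr)
    assume "\<not> x \<le> s"
    then have "x > m" "x \<notin> B" using m fB by auto
    then show False using m that by auto
  qed
  then have "A \<in> nsets {1..s} k" using fA by (auto simp: nsets_def)
  moreover have "A \<noteq> B" using m by auto
  ultimately show "A \<in> nsets {1..s} k - {B}" by auto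
qed

lemma nsets_in_atMost:
  assumes "B \<in> nsets {1..} k"
  obtains s :: nat where "B \<in> nsets {1..s} k"
proof
  have "finite B" using assms nsets_finite by blast
  then have "b \<le> Max (insert 0 B)" if "b \<in> B" for b using that by simp
  moreover have "b \<ge> 1" if "b \<in> B" for b using assms that by (auto simp: nsets_def)
  ultimately have "B \<subseteq> {1..Max (insert 0 B)}" by (meson atLeastAtMost_iff subsetI)
  then show "B \<in> nsets {1..Max (insert 0 B)} k"
    using assms by (simp add: nsets_def)
qed

lemma finite_colex_below:
  assumes "B \<in> nsets {1..} k"
  shows "finite (colex_below k B)"
proof -
  obtain s :: nat where "B \<in> nsets {1..s} k" using nsets_in_atMost[OF assms] .
  then have "colex_below k B \<subseteq> nsets {1..s} k - {B}" by (rule colex_below_subset)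
  then show ?thesis using finite_subset finite_Diff[OF finite_nsets_atMost] by blast
qed

lemma card_colex_below_less:
  assumes "B \<in> nsets {1..s} k"
  shows "card (colex_below k B) < s choose k"
proof -
  have "card (colex_below k B) \<le> card (nsets {1..s} k - {B})"
    using colex_below_subset[OF assms] finite_nsets_atMost by (intro card_mono) auto
  also have "\<dots> < card (nsets {1..s} k)"
    using assms finite_nsets_atMost by (intro card_Diff1_less)
  finally show ?thesis by (simp add: card_nsets_atMost)
qed

lemma card_colex_below_ge:
  assumes "B \<in> nsets {1..} k" "b \<in> B" "s < b"
  shows "s choose k \<le> card (colex_below k B)"
  using card_mono[OF finite_colex_below[OF assms(1)] nsets_below[OF assms]]
  by (simp add: card_nsets_atMost)

text \<open>Colex is self-similar: sets with the same largest element are ordered by their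
  remainders, and every set with a smaller largest element precedes them.\<close>

lemma colex_below_insert:
  assumes B: "B \<in> nsets {1..s} k"
  shows "colex_below (Suc k) (insert (Suc s) B) =
    nsets {1..s} (Suc k) \<union> insert (Suc s) ` colex_below k B"
proof (rule set_eqI, rule iffI)
  let ?B = "insert (Suc s) B"
  have fB: "finite B" "B \<subseteq> {1..s}" "card B = k" using B by (auto simp: nsets_def)
  then have "Suc s \<notin> B" by auto
  then have BB: "?B \<in> nsets {1..Suc s} (Suc k)" using fB by (auto simp: nsets_def)
  fix A
  {
    assume A: "A \<in> colex_below (Suc k) ?B"
    then have A1: "A \<in> nsets {1..Suc s} (Suc k)" using colex_below_subset[OF BB] by auto
    then have fA: "finite A" by (auto simp: nsets_def)
    show "A \<in> nsets {1..s} (Suc k) \<union> insert (Suc s) ` colex_below k B"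
    proof (cases "Suc s \<in> A")
      case True
      let ?A = "A - {Suc s}"
      have A': "?A \<in> nsets {1..s} k" using A1 True by (auto simp: nsets_def)
      obtain m where m: "m \<in> ?B - A" "\<forall>x>m. x \<in> A \<longleftrightarrow> x \<in> ?B"
        using A colex_less_iff[OF fA, of ?B] fB by auto
      have "m \<in> B - ?A" "\<forall>x>m. x \<in> ?A \<longleftrightarrow> x \<in> B"
        using m True \<open>Suc s \<notin> B\<close> by auto
      then have "colex_less ?A B" using colex_less_iff[of ?A B] fA fB by blast
      then have "?A \<in> colex_below k B" using A' by (auto simp: nsets_def)
      then show ?thesis using True by (auto simp: insert_absorb intro!: image_eqI[of _ _ ?A])
    next
      case False
      moreover have "A \<subseteq> {1..Suc s}" using A1 by (simp add: nsets_def)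
      ultimately have "A \<subseteq> {1..s}" by (fastforce simp: le_Suc_eq)
      then show ?thesis using A1 by (auto simp: nsets_def)
    qed
  next
    assume "A \<in> nsets {1..s} (Suc k) \<union> insert (Suc s) ` colex_below k B"
    then show "A \<in> colex_below (Suc k) ?B"
    proof
      assume "A \<in> nsets {1..s} (Suc k)"
      moreover have "?B \<in> nsets {1..} (Suc k)" using BB by (auto simp: nsets_def)
      ultimately show ?thesis using nsets_below[of ?B "Suc k" "Suc s" s] by auto
    next
      assume "A \<in> insert (Suc s) ` colex_below k B"
      then obtain C where C: "A = insert (Suc s) C" "C \<in> colex_below k B" by auto
      then have C1: "C \<in> nsets {1..s} k" using colex_below_subset[OF B] by auto
      then have fC: "finite C" "C \<subseteq> {1..s}" "card C = k" by (auto simp: nsets_def)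
      obtain m where m: "m \<in> B - C" "\<forall>x>m. x \<in> C \<longleftrightarrow> x \<in> B"
        using C colex_less_iff[OF fC(1) fB(1)] by auto
      have "m \<in> ?B - A" using m fB C by auto
      moreover have "\<forall>x>m. x \<in> A \<longleftrightarrow> x \<in> ?B" using m C by auto
      ultimately have "colex_less A ?B" using colex_less_iff[of A ?B] fC fB C by blast
      moreover have "Suc s \<notin> C" using fC by auto
      then have "A \<in> nsets {1..} (Suc k)" using fC C by (auto simp: nsets_def)
      ultimately show ?thesis by auto
    qed
  }
qed

lemma card_insert_image:
  assumes "\<And>C. C \<in> I \<Longrightarrow> v \<notin> C"
  shows "card (insert v ` I) = card I"
proof (rule card_image, rule inj_onI)
  fix B C assume "B \<in> I" "C \<in> I" "insert v B = insert v C"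
  then show "B = C" using assms by (metis Diff_insert_absorb)
qed

lemma card_colex_below_insert:
  assumes B: "B \<in> nsets {1..s} k"
  shows "card (colex_below (Suc k) (insert (Suc s) B)) = (s choose Suc k) + card (colex_below k B)"
proof -
  have sub: "colex_below k B \<subseteq> nsets {1..s} k" using colex_below_subset[OF B] by auto
  have ns: "Suc s \<notin> C" if "C \<in> colex_below k B" for C
  proof -
    have "C \<in> nsets {1..s} k" using that sub by blast
    then show ?thesis by (auto simp: nsets_def)
  qed
  have fin: "finite (colex_below k B)" using sub finite_nsets_atMost finite_subset by blast
  have disj: "nsets {1..s} (Suc k) \<inter> insert (Suc s) ` colex_below k B = {}"
    by (auto simp: nsets_def)
  have "card (insert (Suc s) ` colex_below k B) = card (colex_below k B)"
    using ns by (rule card_insert_image)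
  then show ?thesis
    unfolding colex_below_insert[OF B]
    using card_Un_disjoint[OF finite_nsets_atMost finite_imageI[OF fin] disj] card_nsets_atMost
    by presburger
qed

lemma mem_colex_initial:
  "B \<in> colex_initial k m \<longleftrightarrow> B \<in> nsets {1..} k \<and> card (colex_below k B) < m"
  by (simp only: colex_initial_def mem_Collect_eq)

lemma colex_initial_subset:
  assumes "E \<le> s choose k"
  shows "colex_initial k E \<subseteq> nsets {1..s} k"
proof
  fix B assume "B \<in> colex_initial k E"
  then have B: "B \<in> nsets {1..} k" "card (colex_below k B) < E" by (auto simp: colex_initial_def)
  have "b \<le> s" if "b \<in> B" for b
    using card_colex_below_ge[OF B(1) that, of s] B(2) assms by (meson leD le_trans not_le_imp_less)
  moreover have "b \<ge> 1" if "b \<in> B" for b using B(1) that by (auto simp: nsets_def)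
  ultimately have "B \<subseteq> {1..s}" by (meson atLeastAtMost_iff subsetI)
  then show "B \<in> nsets {1..s} k" using B(1) by (simp add: nsets_def)
qed

text \<open>The recursion behind the cascade representation. \<open>E = s choose k\<close> is
  allowed, where the right-hand side is the complete layer on \<open>{1..Suc s}\<close>; the bounds
  on \<open>E1\<close> and \<open>E2\<close> include this boundary case.\<close>

lemma colex_initial_Suc:
  assumes E: "E \<le> s choose k"
  shows "colex_initial (Suc k) ((s choose Suc k) + E) =
    nsets {1..s} (Suc k) \<union> insert (Suc s) ` colex_initial k E"
proof (rule set_eqI, rule iffI)
  fix B
  assume "B \<in> colex_initial (Suc k) ((s choose Suc k) + E)"
  then have B: "B \<in> nsets {1..} (Suc k)" "card (colex_below (Suc k) B) < (s choose Suc k) + E"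
    by (auto simp: colex_initial_def)
  have le: "b \<le> Suc s" if "b \<in> B" for b
  proof (rule ccontr)
    assume "\<not> b \<le> Suc s"
    then have "Suc s choose Suc k \<le> card (colex_below (Suc k) B)"
      using card_colex_below_ge[OF B(1) that, of "Suc s"] by simp
    then show False using B(2) E by simp
  qed
  show "B \<in> nsets {1..s} (Suc k) \<union> insert (Suc s) ` colex_initial k E"
  proof (cases "Suc s \<in> B")
    case True
    let ?B = "B - {Suc s}"
    have "b \<le> s" if "b \<in> ?B" for b using le[of b] that by auto
    moreover have "b \<ge> 1" if "b \<in> ?B" for b using B(1) that by (auto simp: nsets_def)
    ultimately have "?B \<subseteq> {1..s}" by (meson atLeastAtMost_iff subsetI)
    then have B': "?B \<in> nsets {1..s} k" using B(1) True by (simp add: nsets_def)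
    have BB: "insert (Suc s) ?B = B" using True by auto
    have "card (colex_below k ?B) < E"
      using card_colex_below_insert[OF B'] B(2) unfolding BB by simp
    then have "?B \<in> colex_initial k E" using B' by (auto simp: colex_initial_def nsets_def)
    then have "insert (Suc s) ?B \<in> insert (Suc s) ` colex_initial k E" by (rule imageI)
    then show ?thesis unfolding BB by simp
  next
    case False
    have "b \<le> s" if "b \<in> B" for b
    proof -
      have "b \<noteq> Suc s" using that False by auto
      then show ?thesis using le[OF that] by simp
    qed
    moreover have "b \<ge> 1" if "b \<in> B" for b using B(1) that by (auto simp: nsets_def)
    ultimately have "B \<subseteq> {1..s}" by (meson atLeastAtMost_iff subsetI)
    then have "B \<in> nsets {1..s} (Suc k)" using B(1) by (simp add: nsets_def)
    then show ?thesis by simp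
  qed
next
  fix B
  assume "B \<in> nsets {1..s} (Suc k) \<union> insert (Suc s) ` colex_initial k E"
  then show "B \<in> colex_initial (Suc k) ((s choose Suc k) + E)"
  proof
    assume B: "B \<in> nsets {1..s} (Suc k)"
    then have "B \<in> nsets {1..} (Suc k)" by (auto simp: nsets_def)
    moreover have "card (colex_below (Suc k) B) < (s choose Suc k) + E"
      using card_colex_below_less[OF B] by simp
    ultimately show ?thesis by (simp add: colex_initial_def)
  next
    assume "B \<in> insert (Suc s) ` colex_initial k E"
    then obtain C where C: "B = insert (Suc s) C" "C \<in> colex_initial k E" by auto
    then have C': "C \<in> nsets {1..s} k" using colex_initial_subset[OF E] by auto
    then have "Suc s \<notin> C" "C \<in> nsets {1..} k" by (auto simp: nsets_def)
    then have "B \<in> nsets {1..} (Suc k)" using C by (auto simp: nsets_def)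
    moreover have "card (colex_below k C) < E" using C by (auto simp: colex_initial_def)
    ultimately show ?thesis
      using card_colex_below_insert[OF C'] C(1) by (simp add: colex_initial_def)
  qed
qed

lemma choose_decomposition:
  obtains s E where "m = (s choose Suc k) + E" "E < s choose k" "k \<le> s"
proof -
  have "\<exists>s E. m = (s choose Suc k) + E \<and> E < s choose k \<and> k \<le> s"
  proof (induction m)
    case 0
    show ?case by (intro exI[of _ k] exI[of _ 0]) simp
  next
    case (Suc m)
    then obtain s E where s: "m = (s choose Suc k) + E" "E < s choose k" "k \<le> s" by auto
    show ?case
    proof (cases "Suc E < s choose k")
      case True
      then show ?thesis using s by (intro exI[of _ s] exI[of _ "Suc E"]) simp
    next
      case False
      then show ?thesis using s
        by (intro exI[of _ "Suc s"] exI[of _ 0]) auto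
    qed
  qed
  then show ?thesis using that by blast
qed

lemma colex_initial_0 [simp]: "colex_initial k 0 = {}"
  by (simp add: colex_initial_def)

lemma colex_initial_0_left: "colex_initial 0 m = (if m = 0 then {} else {{}})"
proof (cases "m = 0")
  case False
  have n: "B \<in> nsets {1..} 0 \<longleftrightarrow> B = {}" for B :: "nat set" by (auto simp: nsets_def)
  have "colex_below 0 {} = {}"
    unfolding n using colex_less_def[of "{}" "{}"] by blast
  then have "card (colex_below 0 {}) < m" using False by (metis card.empty neq0_conv)
  then have "B \<in> colex_initial 0 m \<longleftrightarrow> B = {}" for B
    unfolding colex_initial_def mem_Collect_eq using n by blast
  then show ?thesis using False by auto
qed simp

text \<open>There is only one set of size 0, hence the restriction on \<open>m\<close> in that case.
  The decomposition respects it: \<open>E < s choose 0\<close> means \<open>E = 0\<close>.\<close>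

lemma card_colex_initial_aux:
  "(k = 0 \<longrightarrow> m \<le> 1) \<Longrightarrow> finite (colex_initial k m) \<and> card (colex_initial k m) = m"
proof (induction k arbitrary: m)
  case 0
  then show ?case by (auto simp: colex_initial_0_left)
next
  case (Suc k)
  obtain s E where s: "m = (s choose Suc k) + E" "E < s choose k" "k \<le> s"
    by (rule choose_decomposition)
  have E: "E \<le> s choose k" using s by simp
  have ih: "finite (colex_initial k E)" "card (colex_initial k E) = E"
  proof -
    have "k = 0 \<longrightarrow> E \<le> 1" using s by auto
    then show "finite (colex_initial k E)" "card (colex_initial k E) = E"
      using Suc.IH[of E] by auto
  qed
  have ns: "Suc s \<notin> C" if "C \<in> colex_initial k E" for C
  proof -
    have "C \<in> nsets {1..s} k" using colex_initial_subset[OF E] that by blast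
    then show ?thesis by (auto simp: nsets_def)
  qed
  have disj: "nsets {1..s} (Suc k) \<inter> insert (Suc s) ` colex_initial k E = {}"
    by (auto simp: nsets_def)
  have "card (insert (Suc s) ` colex_initial k E) = E"
    using card_insert_image[of "colex_initial k E" "Suc s"] ns ih by simp
  then show ?case unfolding s(1) colex_initial_Suc[OF E]
    using card_Un_disjoint[OF finite_nsets_atMost finite_imageI[OF ih(1)] disj] card_nsets_atMost
      ih(1) finite_nsets_atMost by simp
qed

lemma card_colex_initial: "k = 0 \<longrightarrow> m \<le> 1 \<Longrightarrow> card (colex_initial k m) = m"
  by (rule conjunct2[OF card_colex_initial_aux])

lemma kfam_colex_initial: "kfam k (colex_initial k m)"
proof (rule kfamI)
  show "finite (colex_initial k m)"
  proof (cases k)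
    case 0
    then show ?thesis by (simp add: colex_initial_0_left)
  next
    case (Suc k')
    then have "k = 0 \<longrightarrow> m \<le> 1" by simp
    then show ?thesis by (rule conjunct1[OF card_colex_initial_aux])
  qed
next
  fix B assume "B \<in> colex_initial k m"
  then have "B \<in> nsets {1..} k" by (simp only: mem_colex_initial)
  then show "finite B \<and> card B = k" by (simp add: nsets_def)
qed

lemma colex_initial_mono: "m \<le> m' \<Longrightarrow> colex_initial k m \<subseteq> colex_initial k m'"
  unfolding subset_iff mem_colex_initial by (meson less_le_trans)

lemma colex_shadow_mono: "m \<le> m' \<Longrightarrow> colex_shadow k m \<le> colex_shadow k m'"
  unfolding colex_shadow_def
  by (intro card_mono finite_shadow kfam_colex_initial shadow_mono colex_initial_mono)

lemma colex_shadow_0 [simp]: "colex_shadow k 0 = 0"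
  by (simp add: colex_shadow_def shadow_def)

lemma colex_shadow_0_left [simp]: "colex_shadow 0 m = 0"
  unfolding colex_shadow_def shadow_0[OF kfam_colex_initial] by simp

lemma colex_shadow_1:
  assumes "m > 0"
  shows "colex_shadow (Suc 0) m = 1"
proof -
  have "card (colex_initial (Suc 0) m) = m" by (simp add: card_colex_initial)
  then have "colex_initial (Suc 0) m \<noteq> {}" using assms by (metis card.empty less_numeral_extra(3))
  then show ?thesis unfolding colex_shadow_def by (subst shadow_1[OF kfam_colex_initial]) simp_all
qed

text \<open>The added element \<open>Suc t\<close> is kept independent of \<open>s\<close>:
  \<open>t = s\<close> belongs to an initial segment, \<open>t = Suc s\<close> to the second block
  of \<open>J_family\<close>.\<close>

lemma shadow_colex_initial_subset:
  assumes E: "E \<le> s choose k"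
  shows "shadow (Suc k) (nsets {1..s} (Suc k) \<union> insert (Suc t) ` colex_initial k E) \<subseteq>
    nsets {1..s} k \<union> insert (Suc t) ` shadow k (colex_initial k E)" (is "shadow _ ?F \<subseteq> _")
proof
  fix B assume B: "B \<in> shadow (Suc k) ?F"
  let ?I = "colex_initial k E"
  have I: "?I \<subseteq> nsets {1..s} k" by (rule colex_initial_subset[OF E])
  from B obtain A where A: "finite B" "card B = k" "A \<in> ?F" "B \<subset> A" by (auto simp: shadow_def)
  from A(3) show "B \<in> nsets {1..s} k \<union> insert (Suc t) ` shadow k (colex_initial k E)"
  proof
    assume "A \<in> nsets {1..s} (Suc k)"
    then have "B \<in> nsets {1..s} k" using A(1,2,4) by (auto simp: nsets_def)
    then show ?thesis by simp
  next
    assume "A \<in> insert (Suc t) ` ?I"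
    then obtain C where C: "C \<in> ?I" "A = insert (Suc t) C" by auto
    have "C \<in> nsets {1..s} k" using C(1) I by blast
    then have C': "finite C" "card C = k" "C \<subseteq> {1..s}" by (simp_all add: nsets_def)
    show ?thesis
    proof (cases "Suc t \<in> B")
      case True
      then have "B - {Suc t} \<subseteq> C" using A C by auto
      moreover have "card (B - {Suc t}) = k - 1" using A True by simp
      moreover have "B - {Suc t} \<noteq> C" 
      proof
        assume "B - {Suc t} = C"
        then show False using A(4) C(2) True by auto
      qed
      ultimately have "B - {Suc t} \<in> shadow k ?I"
        using C(1) A(1) unfolding shadow_def by blast
      then have "insert (Suc t) (B - {Suc t}) \<in> insert (Suc t) ` shadow k ?I" by (rule imageI)
      then show ?thesis using True by (simp add: insert_absorb)
    next
      case False
      then have "B \<subseteq> C" using A C by auto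
      then have "B = C" using A C' by (simp add: card_subset_eq)
      then show ?thesis using C(1) I by blast
    qed
  qed
qed

lemma shadow_colex_initial:
  assumes E: "E \<le> s choose k" and pos: "0 < (s choose Suc k) + E"
  shows "shadow (Suc k) (colex_initial (Suc k) ((s choose Suc k) + E)) =
    nsets {1..s} k \<union> insert (Suc s) ` shadow k (colex_initial k E)"
proof
  let ?I = "colex_initial k E"
  let ?F = "nsets {1..s} (Suc k) \<union> insert (Suc s) ` ?I"
  have eq: "colex_initial (Suc k) ((s choose Suc k) + E) = ?F" by (rule colex_initial_Suc[OF E])
  show "shadow (Suc k) (colex_initial (Suc k) ((s choose Suc k) + E)) \<subseteq>
    nsets {1..s} k \<union> insert (Suc s) ` shadow k (colex_initial k E)"
    unfolding eq by (rule shadow_colex_initial_subset[OF E])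
  have kF: "kfam (Suc k) ?F" unfolding eq[symmetric] by (rule kfam_colex_initial)
  have I: "?I \<subseteq> nsets {1..s} k" by (rule colex_initial_subset[OF E])
  have "nsets {1..s} k \<subseteq> shadow (Suc k) ?F"
  proof
    fix B assume B: "B \<in> nsets {1..s} k"
    then have B': "B \<subseteq> {1..s}" "finite B" "card B = k" by (simp_all add: nsets_def)
    show "B \<in> shadow (Suc k) ?F"
    proof (cases "B = {1..s}")
      case False
      then obtain w where w: "w \<in> {1..s}" "w \<notin> B" using B' by blast
      then have "insert w B \<in> nsets {1..s} (Suc k)" using B' by (simp add: nsets_def)
      then have "insert w B \<in> ?F" by (rule UnI1)
      then show ?thesis using shadow_iff[OF kF, of B] w(2) by blast
    next
      case True
      \<comment> \<open>The full set \<open>{1..s}\<close> has no extension inside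
        \<open>{1..s}\<close>. As \<open>s choose Suc k\<close> is then 0, \<open>pos\<close> forces
        \<open>E = 1\<close>, and \<open>Suc s\<close> supplies the extension.\<close>
      then have "k = s" using B' by simp
      then have "E = 1" using E pos by simp
      then have "card ?I = 1" using card_colex_initial[of k E] by simp
      then have "?I \<noteq> {}" by (metis card.empty zero_neq_one)
      then obtain C where C: "C \<in> ?I" by (meson ex_in_conv)
      then have "C \<in> nsets {1..s} k" using I by blast
      then have "C \<subseteq> {1..s}" "card C = k" by (simp_all add: nsets_def)
      then have "C = B" using True B' by (simp add: card_subset_eq)
      then have "insert (Suc s) B \<in> ?F" using imageI[OF C, of "insert (Suc s)"] by simp
      moreover have "Suc s \<notin> B" using True by simp
      ultimately show ?thesis using shadow_iff[OF kF, of B] by blast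
    qed
  qed
  moreover have "insert (Suc s) ` shadow k ?I \<subseteq> shadow (Suc k) ?F"
  proof
    fix B assume "B \<in> insert (Suc s) ` shadow k ?I"
    then obtain D where D0: "B = insert (Suc s) D" "D \<in> shadow k ?I" by (rule imageE)
    from D0(2) obtain A where "finite D" "card D = k - 1" "A \<in> ?I" "D \<subset> A"
      unfolding shadow_def mem_Collect_eq by (elim conjE bexE)
    note D = D0(1) this
    have "A \<in> nsets {1..s} k" using D(4) I by blast
    then have A: "A \<subseteq> {1..s}" "finite A" "card A = k" by (simp_all add: nsets_def)
    have "Suc s \<notin> A" using A by auto
    moreover have "A \<noteq> {}" using D(5) by blast
    then have "k > 0" using A(2,3) by (metis card_gt_0_iff)
    moreover have "Suc s \<notin> D" using D \<open>Suc s \<notin> A\<close> by auto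
    ultimately have cB: "card B = k" using D by (simp add: card_insert_if)
    have "B \<subset> insert (Suc s) A"
      unfolding D(1) psubset_eq insert_ident[OF \<open>Suc s \<notin> D\<close> \<open>Suc s \<notin> A\<close>] using D(5) by auto
    moreover have "insert (Suc s) A \<in> ?F" using imageI[OF D(4), of "insert (Suc s)"] by simp
    moreover have "finite B" using D(1,2) by simp
    ultimately show "B \<in> shadow (Suc k) ?F" using cB shadowI[of B "Suc k" "insert (Suc s) A" ?F]
      by simp
  qed
  ultimately show "nsets {1..s} k \<union> insert (Suc s) ` shadow k (colex_initial k E) \<subseteq>
    shadow (Suc k) (colex_initial (Suc k) ((s choose Suc k) + E))" unfolding eq by (rule Un_least)
qed

lemma notin_shadow_colex_initial:
  assumes "E \<le> s choose k" "C \<in> shadow k (colex_initial k E)" "s < t"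
  shows "t \<notin> C"
proof
  assume "t \<in> C"
  then obtain B where "B \<in> colex_initial k E" "t \<in> B" using assms(2) by (auto simp: shadow_def)
  then have "B \<in> nsets {1..s} k" using colex_initial_subset[OF assms(1)] by blast
  then have "t \<in> {1..s}" using \<open>t \<in> B\<close> by (auto simp: nsets_def)
  then show False using assms(3) by simp
qed

lemma colex_shadow_Suc:
  assumes E: "E \<le> s choose k" and pos: "0 < (s choose Suc k) + E"
  shows "colex_shadow (Suc k) ((s choose Suc k) + E) = (s choose k) + colex_shadow k E"
proof -
  have "nsets {1..s} k \<inter> insert (Suc s) ` shadow k (colex_initial k E) = {}" by (auto simp: nsets_def)
  then show ?thesis unfolding colex_shadow_def shadow_colex_initial[OF assms]
    using finite_nsets_atMost finite_shadow[OF kfam_colex_initial]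
      card_insert_image[of "shadow k (colex_initial k E)" "Suc s"]
      notin_shadow_colex_initial[OF E]
    by (simp add: card_Un_disjoint card_nsets_atMost)
qed

lemma colex_shadow_Suc_le:
  assumes E: "E \<le> s choose k"
  shows "colex_shadow (Suc k) ((s choose Suc k) + E) \<le> (s choose k) + colex_shadow k E"
proof (cases "(s choose Suc k) + E = 0")
  case True
  then show ?thesis unfolding True by simp
next
  case False
  then have "0 < (s choose Suc k) + E" by (simp only: neq0_conv)
  from colex_shadow_Suc[OF E this] show ?thesis by simp
qed

text \<open>For a family that is shifted towards a vertex, \<open>a\<close> is the size of the link of that
  vertex and \<open>b\<close> the number of sets avoiding it; the shadow of the latter lies in the link, which
  gives the hypothesis. The bound is then exactly what the induction step of Kruskal--Katona needs.\<close>

lemma colex_shadow_le_add: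
  "colex_shadow k b \<le> a \<Longrightarrow> colex_shadow k (a + b) \<le> a + colex_shadow (k - 1) a"
proof (induction k arbitrary: a b)
  case 0
  then show ?case by simp
next
  case (Suc k)
  note IH = Suc.IH and prem = Suc.prems
  show ?case
  proof (cases "k = 0 \<or> a + b = 0")
    case True
    then show ?thesis
    proof
      assume "k = 0"
      then show ?thesis using prem colex_shadow_1[of b] colex_shadow_1[of "a + b"]
        by (cases "b = 0"; cases "a + b = 0") auto
    qed simp
  next
    case False
    then obtain k' where k': "k = Suc k'" by (cases k) auto
    obtain s E where s: "a + b = (s choose Suc k) + E" "E < s choose k" "k \<le> s"
      by (rule choose_decomposition)
    obtain r where r: "s = Suc r" using s k' by (cases s) auto
    have sk: "s choose k = (r choose k') + (r choose k)" and sk1: "s choose Suc k = (r choose k) + (r choose Suc k)"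
      by (simp_all add: r k')
    have up: "colex_shadow (Suc k) (a + b) \<le> (s choose k) + colex_shadow k E"
      unfolding s(1) using s by (intro colex_shadow_Suc_le) simp
    have "(s choose k) + colex_shadow k E \<le> a + colex_shadow k a"
    proof -
      \<comment> \<open>With \<open>s = Suc r\<close>, Pascal's rule splits the main term into
        \<open>r choose k\<close> for \<open>a\<close> and \<open>r choose Suc k\<close> for
        \<open>b\<close>. The first two cases are those where \<open>a\<close> is too large or too
        small for this split; the latter contradicts the hypothesis.\<close>
      consider "a \<ge> s choose k" | "a < r choose k" | "r choose k \<le> a" "a < s choose k" by linarith
      then show ?thesis
      proof cases
        case 1
        then have "colex_shadow k E \<le> colex_shadow k a" using s by (intro colex_shadow_mono) simp
        then show ?thesis using 1 by simp
      next
        case 2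
        have "(r choose Suc k) + 1 \<le> b" using 2 s sk1 by simp
        then have "colex_shadow (Suc k) ((r choose Suc k) + 1) \<le> a"
          using prem colex_shadow_mono le_trans by blast
        moreover have "colex_shadow (Suc k) ((r choose Suc k) + 1) = (r choose k) + colex_shadow k 1"
          using 2 by (intro colex_shadow_Suc) auto
        ultimately show ?thesis using 2 by simp
      next
        case 3
        define a' where "a' = a - (r choose k)"
        have a: "a = (r choose k) + a'" using 3 by (simp add: a'_def)
        have a'le: "a' < r choose k'" using 3 sk a by simp
        have "a > 0"
        proof (rule ccontr)
          assume "\<not> a > 0"
          then have "b > 0" "colex_shadow (Suc k) b = 0" using False prem by auto
          moreover have "colex_shadow (Suc k) 1 \<le> colex_shadow (Suc k) b"
            using \<open>b > 0\<close> by (intro colex_shadow_mono) simp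
          moreover have "colex_shadow (Suc k) ((k choose Suc k) + 1) = (k choose k) + colex_shadow k 1"
            by (rule colex_shadow_Suc) auto
          moreover have "(k choose Suc k) + 1 = 1" by simp
          ultimately show False by (metis add_is_0 binomial_n_n le_zero_eq one_neq_zero)
        qed
        then have fa: "colex_shadow k a = (r choose k') + colex_shadow k' a'"
          unfolding a k' using a'le a k' by (intro colex_shadow_Suc) auto
        \<comment> \<open>The remainders satisfy \<open>a' + b' = E\<close> and inherit the
          hypothesis one level down, so the induction hypothesis applies. If \<open>a'\<close>
          exceeds \<open>E\<close>, it is applied with second remainder 0.\<close>
        have "colex_shadow k E \<le> a' + colex_shadow k' a'"
        proof (cases "a' \<le> E")
          case True
          define b' where "b' = E - a'"
          have E: "E = a' + b'" using True by (simp add: b'_def)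
          have b: "b = (r choose Suc k) + b'" using s sk1 a E by simp
          have b'le: "b' \<le> r choose k"
          proof (rule ccontr)
            assume *: "\<not> b' \<le> r choose k"
            then have "s choose Suc k \<le> b" using b sk1 by simp
            then have "colex_shadow (Suc k) ((s choose Suc k) + 0) \<le> a"
              using prem colex_shadow_mono[of "(s choose Suc k) + 0" b "Suc k"] by simp
            moreover have "s \<noteq> k" using * E s by auto
            then have "s > k" using s by simp
            then have "colex_shadow (Suc k) ((s choose Suc k) + 0) = (s choose k) + colex_shadow k 0"
              by (intro colex_shadow_Suc) auto
            ultimately show False using 3 by simp
          qed
          have "colex_shadow k b' \<le> a'"
          proof (cases "b = 0")
            case True
            then show ?thesis using b by simp
          next
            case False
            then have "colex_shadow (Suc k) b = (r choose k) + colex_shadow k b'"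
              unfolding b using b'le b by (intro colex_shadow_Suc) auto
            then show ?thesis using prem a by simp
          qed
          then show ?thesis using IH[of b' a'] E k' by simp
        next
          case False
          then have "colex_shadow k E \<le> colex_shadow k (a' + 0)" by (intro colex_shadow_mono) simp
          also have "\<dots> \<le> a' + colex_shadow k' a'" using IH[of 0 a'] k' by simp
          finally show ?thesis .
        qed
        then show ?thesis using fa sk a by simp
      qed
    qed
    then show ?thesis using up by simp
  qed
qed

section \<open>The Kruskal--Katona theorem\<close>

text \<open>Two inductions: on the size of the family for the sets avoiding the chosen vertex, and
  on \<open>k\<close> for its link. Shifting puts the shadow of the former inside the latter, and
  \<open>colex_shadow_le_add\<close> converts this into the bound for the total size.\<close>

theorem kruskal_katona:
  "kfam k A \<Longrightarrow> colex_shadow k (card A) \<le> card (shadow k A)"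
proof (induction k arbitrary: A)
  case 0
  then show ?case by simp
next
  case (Suc k)
  note IH = Suc.IH
  show ?case
  proof (cases k)
    case 0
    show ?thesis
    proof (cases "A = {}")
      case False
      then have "card A > 0" using kfam_finite[OF Suc.prems] by (simp add: card_gt_0_iff)
      then show ?thesis using shadow_1 Suc.prems 0 False colex_shadow_1 by simp
    qed simp
  next
    case (Suc k')
    show ?thesis using Suc.prems
    proof (induction "card A" arbitrary: A rule: less_induct)
      case less
      show ?case
      proof (cases "A = {}")
        case False
        obtain A' where A': "kfam (Suc k) A'" "card A' = card A"
          "card (shadow (Suc k) A') \<le> card (shadow (Suc k) A)"
          "shadow (Suc k) {B \<in> A'. 0 \<notin> B} \<subseteq> link 0 A'"
          using exists_shifted[OF less.prems, of 0] by blast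
        let ?a = "card (link 0 A')" and ?A0 = "{B \<in> A'. 0 \<notin> B}"
        have k0: "kfam (Suc k) ?A0" using kfam_subset[OF A'(1)] by auto
        have kl: "kfam k (link 0 A')" using kfam_link[OF A'(1)] .
        have sum: "card A = ?a + card ?A0"
          using card_split[of A' "\<lambda>B. 0 \<in> B"] kfam_finite[OF A'(1)] A'(2) by (simp add: card_link)
        have sh: "card (shadow (Suc k) ?A0) \<le> ?a"
          using A'(4) kfam_finite[OF kl] by (intro card_mono)
        \<comment> \<open>This makes the family in the inner induction smaller: if no set contained
          0, a nonempty shadow would have to lie in an empty link.\<close>
        have "?a > 0"
        proof (rule ccontr)
          assume "\<not> ?a > 0"
          then have e: "link 0 A' = {}" using kfam_finite[OF kl] by (simp add: card_gt_0_iff)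
          moreover have "card A > 0" using False kfam_finite[OF less.prems] by (simp add: card_gt_0_iff)
          ultimately have "card ?A0 > 0" using sum by simp
          then have "?A0 \<noteq> {}" by (metis card.empty less_irrefl)
          then obtain B where B: "B \<in> ?A0" by (meson ex_in_conv)
          then have "card B = Suc k" using kfamD[OF k0] by auto
          then obtain b where "b \<in> B" by fastforce
          then have "insert b (B - {b}) \<in> ?A0" using B by (simp add: insert_absorb)
          then have "B - {b} \<in> shadow (Suc k) ?A0" using shadow_iff[OF k0, of "B - {b}"] by blast
          then show False using A'(4) e by auto
        qed
        then have "colex_shadow (Suc k) (card ?A0) \<le> ?a"
          using less.hyps[OF _ k0] sum sh by simp
        then have "colex_shadow (Suc k) (card A) \<le> ?a + colex_shadow k ?a"
          unfolding sum using colex_shadow_le_add[of "Suc k" "card ?A0" ?a] by simp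
        also have "\<dots> \<le> ?a + card (shadow k (link 0 A'))" using IH[OF kl] by simp
        also have "\<dots> \<le> card (shadow (Suc k) A')"
          using card_shadow_ge_link[of k' A' 0] A'(1) Suc by simp
        finally show ?thesis using A'(3) by simp
      qed simp
    qed
  qed
qed

section \<open>Subadditivity and splitting at a vertex set\<close>

lemma shadow_image:
  assumes "inj g"
  shows "shadow k ((`) g ` A) \<subseteq> (`) g ` shadow k A"
proof
  fix B assume "B \<in> shadow k ((`) g ` A)"
  then obtain C where C: "finite B" "card B = k - 1" "C \<in> A" "B \<subset> g ` C" by (auto simp: shadow_def)
  let ?D = "g -` B"
  have "g ` ?D = B" using C by auto
  moreover have "finite ?D" using C assms by (simp add: finite_vimageI)
  moreover have "card ?D = k - 1" using \<open>g ` ?D = B\<close> C card_image[of g ?D] assms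
    by (metis inj_on_subset subset_UNIV)
  moreover have "?D \<subset> C"
  proof
    show "?D \<subseteq> C"
    proof
      fix x assume "x \<in> ?D"
      then have "g x \<in> g ` C" using C(4) by auto
      then show "x \<in> C" using inj_image_mem_iff[OF assms] by simp
    qed
    show "?D \<noteq> C" using C(4) \<open>g ` ?D = B\<close> by force
  qed
  ultimately show "B \<in> (`) g ` shadow k A" using C by (auto simp: shadow_def intro!: image_eqI[of _ _ ?D])
qed

text \<open>Kruskal--Katona for the union of two initial segments copied to the even and to the odd
  numbers: the copies are disjoint for \<open>k > 0\<close>, and their shadows are no larger than
  the originals.\<close>

lemma colex_shadow_subadditive:
  "colex_shadow k (a + b) \<le> colex_shadow k a + colex_shadow k b"
proof (cases "k = 0")
  case False
  define g h :: "nat \<Rightarrow> nat" where "g = (\<lambda>x. 2 * x)" and "h = (\<lambda>x. Suc (2 * x))"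
  have gh: "inj g" "inj h" by (auto simp: inj_def g_def h_def)
  let ?A = "(`) g ` colex_initial k a" and ?B = "(`) h ` colex_initial k b"
  have kf: "kfam k ((`) f ` colex_initial k m)" if "inj f" for f m
  proof (rule kfamI)
    show "finite ((`) f ` colex_initial k m)" using kfam_finite[OF kfam_colex_initial] by simp
    fix B assume "B \<in> (`) f ` colex_initial k m"
    then obtain C where "C \<in> colex_initial k m" "B = f ` C" by auto
    then show "finite B \<and> card B = k" using kfamD[OF kfam_colex_initial] that
      by (metis card_image finite_imageI inj_on_subset subset_UNIV)
  qed
  have cf: "card ((`) f ` colex_initial k m) = m" if "inj f" for f m
    using card_image[of "(`) f"] that card_colex_initial[of k m] False
    by (metis inj_image_eq_iff inj_onI)
  have sh: "card (shadow k ((`) f ` colex_initial k m)) \<le> colex_shadow k m" if "inj f" for f m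
  proof -
    have "card (shadow k ((`) f ` colex_initial k m)) \<le> card ((`) f ` shadow k (colex_initial k m))"
      using finite_shadow[OF kfam_colex_initial] by (intro card_mono shadow_image that) auto
    also have "\<dots> \<le> colex_shadow k m" unfolding colex_shadow_def
      using finite_shadow[OF kfam_colex_initial] by (rule card_image_le)
    finally show ?thesis .
  qed
  have disj: "?A \<inter> ?B = {}"
  proof (rule ccontr)
    assume "?A \<inter> ?B \<noteq> {}"
    then obtain C D where CD: "C \<in> colex_initial k a" "g ` C = h ` D" by auto
    have "card C = k" using kfamD[OF kfam_colex_initial CD(1)] by auto
    then obtain c where "c \<in> C" using False by fastforce
    then obtain d where "g c = h d" using CD by (metis imageE imageI)
    then show False unfolding g_def h_def by presburger
  qed
  have fin: "finite ?A" "finite ?B" using kf gh kfam_finite by auto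
  have "kfam k (?A \<union> ?B)" using kf[OF gh(1)] kf[OF gh(2)] by (auto simp: kfam_def)
  then have "colex_shadow k (card (?A \<union> ?B)) \<le> card (shadow k (?A \<union> ?B))" by (rule kruskal_katona)
  also have "\<dots> \<le> card (shadow k ?A) + card (shadow k ?B)" unfolding shadow_Un by (rule card_Un_le)
  also have "\<dots> \<le> colex_shadow k a + colex_shadow k b" using sh gh by (intro add_mono)
  finally show ?thesis
    unfolding card_Un_disjoint[OF fin disj] cf[OF gh(1)] cf[OF gh(2)] .
qed simp

text \<open>The vertices outside \<open>S\<close> are removed one at a time: the shadow sets through such
  a vertex \<open>v\<close> are counted by the shadow of the link of \<open>v\<close>, and subadditivity collects the
  contributions. This makes the bound valid for every \<open>S\<close>, near-extremal or not.\<close>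

lemma card_shadow_outside:
  assumes "finite W" "kfam (Suc k) A" "\<And>B. B \<in> A \<Longrightarrow> B - S \<subseteq> W"
  shows "colex_shadow k (card {B \<in> A. \<not> B \<subseteq> S}) \<le> card {B \<in> shadow (Suc k) A. \<not> B \<subseteq> S}"
  using assms
proof (induction W arbitrary: A rule: finite_induct)
  case empty
  then have "{B \<in> A. \<not> B \<subseteq> S} = {}" by auto
  then show ?case by (simp only: card.empty colex_shadow_0 le0)
next
  case (insert v W)
  show ?case
  proof (cases "v \<in> S \<or> k = 0")
    case True
    then show ?thesis
    proof
      assume "v \<in> S"
      have "B - S \<subseteq> W" if "B \<in> A" for B
        using insert.prems(2)[OF that] \<open>v \<in> S\<close> by auto
      then show ?thesis using insert.IH[OF insert.prems(1)] by simp
    qed simp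
  next
    case False
    then obtain k' where k': "k = Suc k'" by (cases k) auto
    have vS: "v \<notin> S" using False by simp
    let ?A0 = "{B \<in> A. v \<notin> B}"
    have k0: "kfam (Suc k) ?A0" using kfam_subset[OF insert.prems(1)] by auto
    have kl: "kfam k (link v A)" using kfam_link[OF insert.prems(1)] .
    have fA: "finite A" using kfam_finite[OF insert.prems(1)] .
    have "B - S \<subseteq> W" if "B \<in> ?A0" for B
      using insert.prems(2) that by auto
    then have ih: "colex_shadow k (card {B \<in> ?A0. \<not> B \<subseteq> S}) \<le> card {B \<in> shadow (Suc k) ?A0. \<not> B \<subseteq> S}"
      using insert.IH[OF k0] by simp
    have e1: "{B \<in> {B \<in> A. \<not> B \<subseteq> S}. v \<in> B} = {B \<in> A. v \<in> B}"
      and e2: "{B \<in> {B \<in> A. \<not> B \<subseteq> S}. v \<notin> B} = {B \<in> ?A0. \<not> B \<subseteq> S}" using vS by auto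
    have c: "card {B \<in> A. \<not> B \<subseteq> S} = card (link v A) + card {B \<in> ?A0. \<not> B \<subseteq> S}"
      using card_split[of "{B \<in> A. \<not> B \<subseteq> S}" "\<lambda>B. v \<in> B"] fA unfolding e1 e2 card_link by simp
    have fs: "finite (shadow (Suc k) A)" using finite_shadow insert.prems by blast
    have e3: "{B \<in> {B \<in> shadow (Suc k) A. \<not> B \<subseteq> S}. v \<in> B} = {B \<in> shadow (Suc k) A. v \<in> B}" using vS by auto
    have "card {B \<in> shadow (Suc k) ?A0. \<not> B \<subseteq> S} \<le> card {B \<in> {B \<in> shadow (Suc k) A. \<not> B \<subseteq> S}. v \<notin> B}"
    proof (rule card_mono)
      show "finite {B \<in> {B \<in> shadow (Suc k) A. \<not> B \<subseteq> S}. v \<notin> B}" using fs by auto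
      show "{B \<in> shadow (Suc k) ?A0. \<not> B \<subseteq> S} \<subseteq> {B \<in> {B \<in> shadow (Suc k) A. \<not> B \<subseteq> S}. v \<notin> B}"
        by (auto simp: shadow_def)
    qed
    moreover have "finite {B \<in> shadow (Suc k) A. \<not> B \<subseteq> S}" using fs by simp
    note card_split[OF this, of "\<lambda>B. v \<in> B", unfolded e3]
    moreover have "card {B \<in> shadow (Suc k) A. v \<in> B} = card (shadow k (link v A))"
      using card_shadow_containing[of k' A v] insert.prems(1) k' by simp
    ultimately have "card {B \<in> shadow (Suc k) A. \<not> B \<subseteq> S} \<ge>
       card (shadow k (link v A)) + card {B \<in> shadow (Suc k) ?A0. \<not> B \<subseteq> S}" by linarith
    moreover have "colex_shadow k (card (link v A)) \<le> card (shadow k (link v A))"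
      by (rule kruskal_katona[OF kl])
    moreover have "colex_shadow k (card {B \<in> A. \<not> B \<subseteq> S}) \<le>
      colex_shadow k (card (link v A)) + colex_shadow k (card {B \<in> ?A0. \<not> B \<subseteq> S})"
      unfolding c by (rule colex_shadow_subadditive)
    ultimately show ?thesis using ih by simp
  qed
qed

lemma nsets_inter:
  assumes "kfam k A"
  shows "A \<inter> nsets S k = {B \<in> A. B \<subseteq> S}" "A - nsets S k = {B \<in> A. \<not> B \<subseteq> S}"
  using kfamD[OF assms] by (auto simp: nsets_def)

lemma card_shadow_ge_parts:
  assumes "kfam (Suc k) A"
  shows "card (shadow (Suc k) A) \<ge>
    card (shadow (Suc k) (A \<inter> nsets S (Suc k))) + colex_shadow k (card (A - nsets S (Suc k)))"
proof -
  have "card {B \<in> shadow (Suc k) A. B \<subseteq> S} \<ge> card (shadow (Suc k) (A \<inter> nsets S (Suc k)))"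
  proof (rule card_mono)
    show "finite {B \<in> shadow (Suc k) A. B \<subseteq> S}" using finite_shadow[OF assms] by simp
    show "shadow (Suc k) (A \<inter> nsets S (Suc k)) \<subseteq> {B \<in> shadow (Suc k) A. B \<subseteq> S}"
      by (auto simp: shadow_def nsets_def)
  qed
  moreover have "card {B \<in> shadow (Suc k) A. \<not> B \<subseteq> S} \<ge> colex_shadow k (card (A - nsets S (Suc k)))"
    unfolding nsets_inter[OF assms]
    by (rule card_shadow_outside[of "\<Union>A"]) (use assms kfam_finite_Union in auto)
  ultimately show ?thesis
    using card_split[OF finite_shadow[OF assms], of "\<lambda>B. B \<subseteq> S"] by simp
qed

lemma card_shadow_ge_colex:
  assumes A: "kfam (Suc k) A"
    and ne: "A \<inter> nsets S (Suc k) \<noteq> {}"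
    and E1: "card (A \<inter> nsets S (Suc k)) = (r choose Suc k) + E1" "E1 \<le> r choose k"
  shows "card (shadow (Suc k) A) \<ge>
    (r choose k) + colex_shadow k E1 + colex_shadow k (card (A - nsets S (Suc k)))"
proof -
  have k1: "kfam (Suc k) (A \<inter> nsets S (Suc k))" using kfam_subset[OF A] by auto
  have "card (A \<inter> nsets S (Suc k)) > 0"
    using ne kfam_finite[OF k1] by (simp add: card_gt_0_iff)
  then have "colex_shadow (Suc k) (card (A \<inter> nsets S (Suc k))) = (r choose k) + colex_shadow k E1"
    unfolding E1(1) by (rule colex_shadow_Suc[OF E1(2)])
  then have "(r choose k) + colex_shadow k E1 \<le> card (shadow (Suc k) (A \<inter> nsets S (Suc k)))"
    using kruskal_katona[OF k1] by simp
  then show ?thesis using card_shadow_ge_parts[OF A, of S] by simp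
qed

text \<open>Besides the complete layer on \<open>{1..r}\<close>, both blocks consist of cones over
  \<open>k\<close>-sets in \<open>{1..r}\<close>, with apexes \<open>Suc r\<close> and
  \<open>Suc (Suc r)\<close>: since \<open>E2 \<le> r choose k\<close>, the second block never
  contains \<open>Suc r\<close>. Hence they share the base shadow \<open>P\<close>, and adding
  \<open>N\<close> to the second block costs nothing.\<close>

lemma card_shadow_J_family:
  assumes "E1 \<le> r choose k" "E2 \<le> r choose k"
  shows "card (shadow (Suc k) (J_family (Suc k) (Suc r) E1 E2)) \<le>
    (r choose k) + colex_shadow k E1 + colex_shadow k E2"
proof -
  have E2': "E2 \<le> Suc r choose k" using assms(2) binomial_right_mono[of r "Suc r" k] by simp
  define N where "N = nsets {1..r} (Suc k)"
  define N' where "N' = nsets {1..Suc r} (Suc k)"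
  define X where "X = insert (Suc r) ` colex_initial k E1"
  define Y where "Y = insert (Suc (Suc r)) ` colex_initial k E2"
  define P where "P = nsets {1..r} k"
  define S1 where "S1 = insert (Suc r) ` shadow k (colex_initial k E1)"
  define S2 where "S2 = insert (Suc (Suc r)) ` shadow k (colex_initial k E2)"
  have e1: "colex_initial (Suc k) ((r choose Suc k) + E1) = N \<union> X"
    unfolding N_def X_def by (rule colex_initial_Suc[OF assms(1)])
  have e2: "colex_initial (Suc k) ((Suc r choose Suc k) + E2) = N' \<union> Y"
    unfolding N'_def Y_def by (rule colex_initial_Suc[OF E2'])
  have e3: "colex_initial (Suc k) (Suc r choose Suc k) = N'"
    unfolding N'_def using colex_initial_Suc[of 0 "Suc r" k] by simp
  have "J_family (Suc k) (Suc r) E1 E2 = (N \<union> X) \<union> ((N' \<union> Y) - N')"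
    unfolding J_family_def diff_Suc_1 e1 e2 e3 ..
  then have "J_family (Suc k) (Suc r) E1 E2 \<subseteq> (N \<union> X) \<union> (N \<union> Y)" by blast
  then have "shadow (Suc k) (J_family (Suc k) (Suc r) E1 E2) \<subseteq> shadow (Suc k) (N \<union> X) \<union> shadow (Suc k) (N \<union> Y)"
    unfolding shadow_Un[of _ "N \<union> X", symmetric] by (rule shadow_mono)
  moreover have "shadow (Suc k) (N \<union> X) \<subseteq> P \<union> S1" "shadow (Suc k) (N \<union> Y) \<subseteq> P \<union> S2"
    unfolding N_def X_def Y_def P_def S1_def S2_def
    by (rule shadow_colex_initial_subset[OF assms(1)], rule shadow_colex_initial_subset[OF assms(2)])
  ultimately have "shadow (Suc k) (J_family (Suc k) (Suc r) E1 E2) \<subseteq> P \<union> S1 \<union> S2" by blast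
  moreover have fin: "finite P" "finite S1" "finite S2"
    unfolding P_def S1_def S2_def
    by (intro finite_imageI finite_shadow finite_nsets_atMost kfam_colex_initial)+
  ultimately have "card (shadow (Suc k) (J_family (Suc k) (Suc r) E1 E2)) \<le> card (P \<union> S1 \<union> S2)"
    by (intro card_mono) simp_all
  moreover have "card (P \<union> S1 \<union> S2) \<le> card P + card S1 + card S2"
    using card_Un_le[of "P \<union> S1" S2] card_Un_le[of P S1] by linarith
  moreover have "card P = r choose k" unfolding P_def by (rule card_nsets_atMost)
  moreover have "card S1 \<le> colex_shadow k E1" "card S2 \<le> colex_shadow k E2"
    unfolding colex_shadow_def S1_def S2_def
    by (intro card_image_le finite_shadow kfam_colex_initial)+
  ultimately show ?thesis by linarith
qed

section \<open>Binomial coefficients with real upper argument\<close>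

lemma gbinomial_Suc_mult:
  "((x::real) gchoose Suc k) * (real k + 1) = (x gchoose k) * (x - real k)"
  using gbinomial_mult_1'[of x k] by (simp add: algebra_simps)

lemma gbinomial_absorb_mult:
  "((x::real) gchoose Suc k) * (real k + 1) = x * (x - 1 gchoose k)"
  using gbinomial_absorption[of k x] by (simp add: algebra_simps)

lemma gbinomial_real_pos:
  "real k - 1 < x \<Longrightarrow> 0 < (x::real) gchoose k"
proof (induction k)
  case (Suc k)
  then have "0 < (x gchoose k) * (x - real k)" by simp
  then have "0 < (x gchoose Suc k) * (real k + 1)" by (simp only: gbinomial_Suc_mult)
  then show ?case by (simp add: zero_less_mult_iff)
qed simp

lemma gbinomial_real_nonneg:
  assumes "real k - 1 \<le> x"
  shows "0 \<le> (x::real) gchoose k"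
proof (cases k)
  case (Suc j)
  have "0 \<le> (x gchoose j) * (x - real j)"
    using gbinomial_real_pos[of j x] assms Suc by simp
  then have "0 \<le> (x gchoose Suc j) * (real j + 1)" by (simp only: gbinomial_Suc_mult)
  then show ?thesis using Suc by (simp add: zero_le_mult_iff)
qed simp

lemma gbinomial_real_mono:
  "real k - 1 \<le> a \<Longrightarrow> a \<le> b \<Longrightarrow> (a::real) gchoose k \<le> b gchoose k"
proof (induction k)
  case (Suc k)
  have "(a gchoose k) * (a - real k) \<le> (b gchoose k) * (b - real k)"
    using Suc gbinomial_real_nonneg[of k b] by (intro mult_mono) auto
  then have "(a gchoose Suc k) * (real k + 1) \<le> (b gchoose Suc k) * (real k + 1)"
    by (simp only: gbinomial_Suc_mult)
  then show ?case by (simp add: mult_le_cancel_right)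
qed simp

lemma gbinomial_real_strict_mono:
  assumes "real k \<le> a" "a < b"
  shows "(a::real) gchoose Suc k < b gchoose Suc k"
proof -
  have "(a gchoose k) * (a - real k) \<le> (b gchoose k) * (a - real k)"
    using assms by (intro mult_right_mono gbinomial_real_mono) auto
  also have "\<dots> < (b gchoose k) * (b - real k)"
    using assms gbinomial_real_pos[of k b] by (intro mult_strict_left_mono) auto
  finally have "(a gchoose Suc k) * (real k + 1) < (b gchoose Suc k) * (real k + 1)"
    by (simp only: gbinomial_Suc_mult)
  then show ?thesis by (simp add: mult_less_cancel_right)
qed

lemma gbinomial_real_le_imp:
  assumes "real k \<le> b" "(a::real) gchoose Suc k \<le> b gchoose Suc k"
  shows "a \<le> b"
  using gbinomial_real_strict_mono[OF assms(1), of a] assms(2) by linarith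

lemma gbinomial_real_surj:
  assumes "1 \<le> (r::real)"
  obtains t where "real (Suc k) \<le> t" "t gchoose Suc k = r"
proof -
  have 1: "real (Suc k) gchoose Suc k = 1" by (simp only: binomial_gbinomial[symmetric] binomial_n_n of_nat_1)
  \<comment> \<open>At the right end \<open>r + k\<close> of the interval the coefficient is at
    least \<open>r\<close>, because its \<open>k + 1\<close>-fold is \<open>r\<close> times
    \<open>r + k gchoose k\<close>.\<close>
  have "real (Suc k) gchoose k \<le> r + real k gchoose k"
    using assms by (intro gbinomial_real_mono) auto
  moreover have "real (Suc k) gchoose k = real (Suc k choose k)" by (simp only: binomial_gbinomial)
  then have "real (Suc k) gchoose k = real k + 1" by (simp only: binomial_Suc_n of_nat_Suc)
  ultimately have "(real k + 1) * r \<le> (r + real k gchoose k) * (r + real k - real k)"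
    using assms by (simp add: mult_right_mono)
  then have "(real k + 1) * r \<le> (r + real k gchoose Suc k) * (real k + 1)"
    by (simp only: gbinomial_Suc_mult)
  then have 2: "r \<le> r + real k gchoose Suc k" by (simp add: mult.commute)
  have cont: "continuous_on {real (Suc k)..r + real k} (\<lambda>t. t gchoose Suc k)"
    unfolding gbinomial_prod_rev by (intro continuous_intros) auto
  have "\<exists>t. real (Suc k) \<le> t \<and> t \<le> r + real k \<and> t gchoose Suc k = r"
    by (rule IVT') (use 1 2 assms cont in auto)
  then show ?thesis using that by blast
qed

text \<open>The logarithmic derivative of \<open>y gchoose k\<close> with respect to
  \<open>y\<close>.\<close>

definition recip_sum :: "real \<Rightarrow> nat \<Rightarrow> real" where
  "recip_sum y k = (\<Sum>i<k. 1 / (y - real i))"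

lemma recip_sum_Suc: "recip_sum y (Suc k) = recip_sum y k + 1 / (y - real k)"
  by (simp add: recip_sum_def)

lemma recip_sum_nonneg: "real k - 1 < y \<Longrightarrow> 0 \<le> recip_sum y k"
  unfolding recip_sum_def by (intro sum_nonneg) auto

lemma recip_sum_le:
  assumes "real k - 1 < y"
  shows "recip_sum y k \<le> real k / (y - real k + 1)"
proof -
  have "recip_sum y k \<le> (\<Sum>i<k. 1 / (y - real k + 1))"
    unfolding recip_sum_def
  proof (rule sum_mono)
    fix i assume "i \<in> {..<k}"
    then have "real (Suc i) \<le> real k" by (simp only: of_nat_le_iff lessThan_iff Suc_le_eq)
    then have "real i \<le> real k - 1" by simp
    then show "1 / (y - real i) \<le> 1 / (y - real k + 1)"
      using assms by (intro divide_left_mono) auto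
  qed
  then show ?thesis by simp
qed

text \<open>The ratio of the two coefficients is the product of the factors
  \<open>1 - u / (y - i)\<close>, and a product of numbers in [0, 1] is at least 1 minus the sum of
  their deficits.\<close>

lemma gbinomial_diff_ge:
  assumes "0 \<le> u" 
  shows "real k - 1 \<le> y - u \<Longrightarrow> real k - 1 < y \<Longrightarrow>
    (y gchoose k) * (1 - u * recip_sum y k) \<le> (y - u gchoose k)"
proof (induction k)
  case 0
  then show ?case by (simp add: recip_sum_def)
next
  case (Suc k)
  let ?r = "recip_sum y k" and ?v = "u / (y - real k)"
  have yk: "0 < y - real k" using Suc by simp
  have ih: "(y gchoose k) * (1 - u * ?r) \<le> (y - u gchoose k)" using Suc by simp
  have "0 \<le> (u * ?r) * ?v" using recip_sum_nonneg[of k y] yk assms by simp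
  then have "1 - u * ?r - ?v \<le> (1 - u * ?r) * (1 - ?v)" by (simp add: algebra_simps)
  then have "(1 - u * ?r - ?v) * (y - real k) \<le> ((1 - u * ?r) * (1 - ?v)) * (y - real k)"
    using yk by (intro mult_right_mono) auto
  also have "\<dots> = (1 - u * ?r) * (y - u - real k)" using yk by (simp add: field_simps)
  finally have *: "(1 - u * ?r - ?v) * (y - real k) \<le> (1 - u * ?r) * (y - u - real k)" .
  have "((y gchoose k) * (y - real k)) * (1 - u * ?r - ?v) \<le> (y gchoose k) * ((1 - u * ?r) * (y - u - real k))"
    using mult_left_mono[OF *, of "y gchoose k"] gbinomial_real_nonneg[of k y] Suc by (simp add: mult_ac)
  also have "\<dots> \<le> (y - u gchoose k) * (y - u - real k)"
    using mult_right_mono[OF ih, of "y - u - real k"] Suc by (simp add: mult_ac)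
  finally have "((y gchoose Suc k) * (1 - u * ?r - ?v)) * (real k + 1) \<le> (y - u gchoose Suc k) * (real k + 1)"
    unfolding gbinomial_Suc_mult[symmetric] by (simp only: mult_ac)
  then have "(y gchoose Suc k) * (1 - u * ?r - ?v) \<le> (y - u gchoose Suc k)"
    by (rule mult_right_le_imp_le) simp
  moreover have "1 - u * recip_sum y (Suc k) = 1 - u * ?r - ?v"
    by (simp add: recip_sum_Suc distrib_left)
  ultimately show ?case by (simp only:)
qed

lemma gbinomial_add_ge:
  assumes "0 \<le> u" 
  shows "real k - 1 < y \<Longrightarrow> (y gchoose k) * (1 + u * recip_sum y k) \<le> (y + u gchoose k)"
proof (induction k)
  case 0
  then show ?case by (simp add: recip_sum_def)
next
  case (Suc k)
  let ?r = "recip_sum y k" and ?v = "u / (y - real k)"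
  have yk: "0 < y - real k" using Suc by simp
  have ih: "(y gchoose k) * (1 + u * ?r) \<le> (y + u gchoose k)" using Suc by simp
  have "0 \<le> (u * ?r) * ?v" using recip_sum_nonneg[of k y] yk assms by simp
  then have "1 + u * ?r + ?v \<le> (1 + u * ?r) * (1 + ?v)" by (simp add: algebra_simps)
  then have "(1 + u * ?r + ?v) * (y - real k) \<le> ((1 + u * ?r) * (1 + ?v)) * (y - real k)"
    using yk by (intro mult_right_mono) auto
  also have "\<dots> = (1 + u * ?r) * (y + u - real k)" using yk by (simp add: field_simps)
  finally have *: "(1 + u * ?r + ?v) * (y - real k) \<le> (1 + u * ?r) * (y + u - real k)" .
  have "((y gchoose k) * (y - real k)) * (1 + u * ?r + ?v) \<le> (y gchoose k) * ((1 + u * ?r) * (y + u - real k))"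
    using mult_left_mono[OF *, of "y gchoose k"] gbinomial_real_nonneg[of k y] Suc by (simp add: mult_ac)
  also have "\<dots> \<le> (y + u gchoose k) * (y + u - real k)"
    using mult_right_mono[OF ih, of "y + u - real k"] Suc assms by (simp add: mult_ac)
  finally have "((y gchoose Suc k) * (1 + u * ?r + ?v)) * (real k + 1) \<le> (y + u gchoose Suc k) * (real k + 1)"
    unfolding gbinomial_Suc_mult[symmetric] by (simp only: mult_ac)
  then have "(y gchoose Suc k) * (1 + u * ?r + ?v) \<le> (y + u gchoose Suc k)"
    by (rule mult_right_le_imp_le) simp
  moreover have "1 + u * recip_sum y (Suc k) = 1 + u * ?r + ?v"
    by (simp add: recip_sum_Suc distrib_left)
  ultimately show ?case by (simp only:)
qed

text \<open>Exact at \<open>w = 0\<close> and \<open>w = 1\<close>: the ratio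
  \<open>(y gchoose k) / (y - w gchoose k)\<close> lies below its chord on \<open>[0, 1]\<close>.
  Exactness at 1 lets the dichotomy reach all the way to \<open>p = 1\<close>.\<close>

lemma gbinomial_ratio_le:
  assumes "0 \<le> w" "w \<le> 1"
  shows "real k < y \<Longrightarrow>
    (y gchoose k) * (y - real k) \<le> (y - w gchoose k) * (y - real k + real k * w)"
proof (induction k)
  case (Suc k)
  let ?Y = "y - real k"
  have ih: "(y gchoose k) * ?Y \<le> (y - w gchoose k) * (?Y + real k * w)" using Suc by simp
  have "0 \<le> (real k + 1) * (w * (1 - w))" using assms by simp
  then have *: "(?Y + real k * w) * (?Y - 1) \<le> (?Y - w) * (?Y - 1 + (real k + 1) * w)"
    by (simp add: algebra_simps)
  have "((y gchoose k) * ?Y) * (?Y - 1) \<le> ((y - w gchoose k) * (?Y + real k * w)) * (?Y - 1)"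
    using ih Suc by (intro mult_right_mono) auto
  also have "\<dots> = (y - w gchoose k) * ((?Y + real k * w) * (?Y - 1))" by simp
  also have "\<dots> \<le> (y - w gchoose k) * ((?Y - w) * (?Y - 1 + (real k + 1) * w))"
    using * Suc assms gbinomial_real_nonneg[of k "y - w"] by (intro mult_left_mono) auto
  also have "\<dots> = ((y - w gchoose k) * (y - w - real k)) * (?Y - 1 + (real k + 1) * w)"
    by (simp add: algebra_simps)
  finally have "((y gchoose Suc k) * (?Y - 1)) * (real k + 1) \<le>
    ((y - w gchoose Suc k) * (?Y - 1 + (real k + 1) * w)) * (real k + 1)"
    unfolding gbinomial_Suc_mult[symmetric] by (simp only: mult_ac)
  then have "(y gchoose Suc k) * (?Y - 1) \<le> (y - w gchoose Suc k) * (?Y - 1 + (real k + 1) * w)"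
    by (rule mult_right_le_imp_le) simp
  moreover have "y - real (Suc k) = ?Y - 1" "real (Suc k) = real k + 1" by simp_all
  ultimately show ?case by (simp only:)
qed simp

text \<open>The chord of \<open>y - w gchoose k\<close> between \<open>w = 0\<close> and
  \<open>w = 1\<close>, again exact at both ends.\<close>

lemma gbinomial_diff_le:
  assumes "0 \<le> w" "w \<le> 1"
  shows "real k \<le> y \<Longrightarrow> (y - w gchoose k) * y \<le> (y gchoose k) * (y - real k * w)"
proof (induction k)
  case (Suc k)
  have ih: "(y - w gchoose k) * y \<le> (y gchoose k) * (y - real k * w)" using Suc by simp
  have "0 \<le> real k * (w * (1 - w))" using assms by simp
  then have *: "(y - real k * w) * (y - w - real k) \<le> (y - real k) * (y - (real k + 1) * w)"
    by (simp add: algebra_simps)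
  have "((y - w gchoose k) * y) * (y - w - real k) \<le> ((y gchoose k) * (y - real k * w)) * (y - w - real k)"
    using ih Suc assms by (intro mult_right_mono) auto
  also have "\<dots> = (y gchoose k) * ((y - real k * w) * (y - w - real k))" by simp
  also have "\<dots> \<le> (y gchoose k) * ((y - real k) * (y - (real k + 1) * w))"
    using * Suc gbinomial_real_nonneg[of k y] by (intro mult_left_mono) auto
  also have "\<dots> = ((y gchoose k) * (y - real k)) * (y - (real k + 1) * w)" by simp
  finally have "((y - w gchoose k) * (y - w - real k)) * y \<le> ((y gchoose k) * (y - real k)) * (y - (real k + 1) * w)"
    by (simp add: mult_ac)
  then have "((y - w gchoose Suc k) * y) * (real k + 1) \<le> ((y gchoose Suc k) * (y - (real k + 1) * w)) * (real k + 1)"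
    unfolding gbinomial_Suc_mult[symmetric] by (simp only: mult_ac)
  then have "(y - w gchoose Suc k) * y \<le> (y gchoose Suc k) * (y - (real k + 1) * w)"
    by (rule mult_right_le_imp_le) simp
  then show ?case by (simp only: of_nat_Suc add.commute[of 1])
qed simp

text \<open>For a family of parameter \<open>t\<close> compared with parameter \<open>y\<close>,
  \<open>p\<close> is the relative size and \<open>q\<close> the relative Lovasz shadow. Since
  \<open>p / q = (t - j) / (y - j)\<close> and \<open>1 - p\<close> is at most linear in
  \<open>y - t\<close>, the parameters can be eliminated; the last inequality is the result, and the
  dichotomies below rest on it.\<close>

lemma gbinomial_profile:
  fixes y t :: real
  assumes t: "real (Suc j) \<le> t" "t \<le> y"
  defines "p \<equiv> (t gchoose Suc j) / (y gchoose Suc j)" and "q \<equiv> (t gchoose j) / (y gchoose j)"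
  shows "0 < p" "p \<le> q" "q \<le> 1" "p \<le> 1" "q - p = q * ((y - t) / (y - real j))"
    "1 - p \<le> (y - t) * recip_sum y (Suc j)" "1 - p \<le> (real j + 1) * ((y - t) / (y - real j))"
    "q * (1 - p) \<le> (real j + 1) * (q - p)"
proof -
  have pos: "0 < y gchoose Suc j" "0 < y gchoose j" "0 < t gchoose Suc j" "0 < t gchoose j"
    using t by (auto intro!: gbinomial_real_pos)
  have D: "0 < y - real j" using t by simp
  show p0: "0 < p" using pos by (simp add: p_def)
  have q0: "0 < q" using pos by (simp add: q_def)
  show q1: "q \<le> 1" using pos gbinomial_real_mono[of j t y] t by (simp add: q_def)
  show p1: "p \<le> 1" using pos gbinomial_real_mono[of "Suc j" t y] t by (simp add: p_def)
  have "p = ((t gchoose Suc j) * (real j + 1)) / ((y gchoose Suc j) * (real j + 1))"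
    by (simp add: p_def)
  also have "\<dots> = ((t gchoose j) * (t - real j)) / ((y gchoose j) * (y - real j))"
    by (simp only: gbinomial_Suc_mult)
  also have "\<dots> = q * ((t - real j) / (y - real j))" by (simp add: q_def)
  also have "(t - real j) / (y - real j) = 1 - (y - t) / (y - real j)" using D by (simp add: field_simps)
  finally have pq: "p = q * (1 - (y - t) / (y - real j))" .
  then show qp: "q - p = q * ((y - t) / (y - real j))" by (simp add: algebra_simps)
  have "0 \<le> q * ((y - t) / (y - real j))" using q0 D t by simp
  then show "p \<le> q" using qp by linarith
  have "(y gchoose Suc j) * (1 - (y - t) * recip_sum y (Suc j)) \<le> (y - (y - t) gchoose Suc j)"
    using t by (intro gbinomial_diff_ge) auto
  then have "1 - (y - t) * recip_sum y (Suc j) \<le> p"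
    unfolding p_def using pos by (simp add: pos_le_divide_eq mult.commute)
  then show 1: "1 - p \<le> (y - t) * recip_sum y (Suc j)" by simp
  have "recip_sum y (Suc j) \<le> real (Suc j) / (y - real (Suc j) + 1)"
    using t by (intro recip_sum_le) auto
  then have "(y - t) * recip_sum y (Suc j) \<le> (y - t) * (real (Suc j) / (y - real (Suc j) + 1))"
    using t by (intro mult_left_mono) auto
  then show 2: "1 - p \<le> (real j + 1) * ((y - t) / (y - real j))" using 1 by (simp add: algebra_simps)
  show "q * (1 - p) \<le> (real j + 1) * (q - p)"
    unfolding qp using mult_left_mono[OF 2, of q] q0 by (simp add: mult_ac)
qed

section \<open>The bound of Lovasz\<close>

lemma card_link_pos:
  assumes "kfam k A" "v \<in> \<Union>A"
  shows "1 \<le> card (link v A)"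
proof -
  from assms(2) obtain B where B: "B \<in> A" "v \<in> B" by blast
  have "finite {B \<in> A. v \<in> B}" using kfam_finite[OF assms(1)] by simp
  moreover have "{B \<in> A. v \<in> B} \<noteq> {}" using B by blast
  ultimately have "card {B \<in> A. v \<in> B} > 0" by (intro card_gt_0_iff[THEN iffD2] conjI)
  then show ?thesis unfolding card_link by simp
qed

text \<open>Either some degree is at least that of the extremal family, and then the split at this vertex
  suffices, or each link satisfies a linear inequality by induction, and double counting sums these up.\<close>

theorem kruskal_katona_lovasz:
  "kfam (Suc k) A \<Longrightarrow> real (Suc k) \<le> x \<Longrightarrow> real (card A) = x gchoose Suc k \<Longrightarrow>
    x gchoose k \<le> real (card (shadow (Suc k) A))"
proof (induction k arbitrary: A x)
  case 0
  then have "card A > 0" by simp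
  then have "A \<noteq> {}" by force
  then show ?case using shadow_1[OF 0(1)] by simp
next
  case (Suc k)
  note A = Suc.prems(1)
  let ?V = "\<Union>A"
  have link: "kfam (Suc k) (link v A)" for v by (rule kfam_link[OF A])
  show ?case
  proof (cases "\<exists>v\<in>?V. \<exists>t. x - 1 \<le> t \<and> real (Suc k) \<le> t \<and> real (card (link v A)) = t gchoose Suc k")
    case True
    then obtain v t where v: "v \<in> ?V" "x - 1 \<le> t" "real (Suc k) \<le> t"
      "real (card (link v A)) = t gchoose Suc k" by auto
    have "t gchoose k \<le> real (card (shadow (Suc k) (link v A)))"
      by (rule Suc.IH[OF link v(3,4)])
    moreover have "card (shadow (Suc k) (link v A)) + card (link v A) \<le> card (shadow (Suc (Suc k)) A)"
      by (rule card_shadow_ge_link[OF A])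
    moreover have "t + 1 gchoose Suc k = (t gchoose k) + (t gchoose Suc k)"
      by (rule gbinomial_Suc_Suc)
    ultimately have "t + 1 gchoose Suc k \<le> real (card (shadow (Suc (Suc k)) A))"
      using v(4) by linarith
    moreover have "x gchoose Suc k \<le> t + 1 gchoose Suc k"
      using v Suc.prems(2) by (intro gbinomial_real_mono) auto
    ultimately show ?thesis by linarith
  next
    case False
    have *: "real (card (link v A)) * (real k + 1) \<le> real (card (shadow (Suc k) (link v A))) * (x - 1 - real k)"
      if v: "v \<in> ?V" for v
    proof -
      have "1 \<le> real (card (link v A))" using card_link_pos[OF A v] by simp
      then obtain t where t: "real (Suc k) \<le> t" "t gchoose Suc k = real (card (link v A))"
        by (rule gbinomial_real_surj)
      have "t < x - 1" using False v t by (metis not_less)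
      have "t gchoose k \<le> real (card (shadow (Suc k) (link v A)))"
        by (rule Suc.IH[OF link t(1) t(2)[symmetric]])
      then have "(t gchoose k) * (t - real k) \<le> real (card (shadow (Suc k) (link v A))) * (x - 1 - real k)"
        using \<open>t < x - 1\<close> t(1) by (intro mult_mono) auto
      then show ?thesis unfolding t(2)[symmetric] gbinomial_Suc_mult .
    qed
    have "(\<Sum>v\<in>?V. real (card (link v A))) * (real k + 1) \<le>
        (\<Sum>v\<in>?V. real (card (shadow (Suc k) (link v A)))) * (x - 1 - real k)"
      unfolding sum_distrib_right by (intro sum_mono *)
    moreover have "(\<Sum>v\<in>?V. real (card (link v A))) = (real k + 2) * real (card A)"
      unfolding of_nat_sum[symmetric] sum_card_link[OF A] by (simp add: algebra_simps)
    moreover have "(\<Sum>v\<in>?V. real (card (shadow (Suc k) (link v A)))) = (real k + 1) * real (card (shadow (Suc (Suc k)) A))"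
      unfolding of_nat_sum[symmetric] sum_card_shadow_link[OF A] by (simp add: algebra_simps)
    ultimately have "(real k + 1) * ((x gchoose Suc (Suc k)) * (real k + 2)) \<le>
        (real k + 1) * (real (card (shadow (Suc (Suc k)) A)) * (x - 1 - real k))"
      unfolding Suc.prems(3) by (simp only: mult_ac)
    then have "(x gchoose Suc (Suc k)) * (real k + 2) \<le> real (card (shadow (Suc (Suc k)) A)) * (x - 1 - real k)"
      by (rule mult_left_le_imp_le) simp
    moreover have "(x gchoose Suc (Suc k)) * (real k + 2) = (x gchoose Suc k) * (x - 1 - real k)"
      using gbinomial_Suc_mult[of x "Suc k"] by (simp add: algebra_simps)
    ultimately show ?thesis using Suc.prems(2) by (simp add: mult_le_cancel_right)
  qed
qed

lemma kfam_param:
  assumes "kfam (Suc k) A" "A \<noteq> {}"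
  obtains t where "real (Suc k) \<le> t" "real (card A) = t gchoose Suc k"
    "t gchoose k \<le> real (card (shadow (Suc k) A))"
proof -
  have "card A > 0" using assms kfam_finite by (simp only: card_gt_0_iff) blast
  then have "1 \<le> real (card A)" by simp
  then obtain t where t: "real (Suc k) \<le> t" "t gchoose Suc k = real (card A)"
    by (rule gbinomial_real_surj)
  show ?thesis using that[OF t(1) t(2)[symmetric] kruskal_katona_lovasz[OF assms(1) t(1) t(2)[symmetric]]] .
qed

text \<open>In Lovasz's bound the ratio of size to shadow is \<open>(t - k) / (k + 1)\<close>,
  increasing in the parameter, so up to size \<open>y gchoose Suc k\<close> the ratio at
  \<open>y\<close> is an upper bound.\<close>

lemma card_shadow_ge_linear:
  assumes "kfam (Suc k) A" "real k \<le> y" "real (card A) \<le> y gchoose Suc k"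
  shows "real (card A) * (real k + 1) \<le> real (card (shadow (Suc k) A)) * (y - real k)"
proof (cases "A = {}")
  case False
  obtain t where t: "real (Suc k) \<le> t" "real (card A) = t gchoose Suc k"
    "t gchoose k \<le> real (card (shadow (Suc k) A))"
    by (rule kfam_param[OF assms(1) False])
  have ty: "t \<le> y" using gbinomial_real_le_imp[OF assms(2), of t] assms(3) t(2) by simp
  have "real (card A) * (real k + 1) = (t gchoose k) * (t - real k)"
    unfolding t(2) by (rule gbinomial_Suc_mult)
  also have "\<dots> \<le> real (card (shadow (Suc k) A)) * (y - real k)"
    using t ty by (intro mult_mono) auto
  finally show ?thesis .
qed (use assms in simp)

lemma card_shadow_ge_mono:
  assumes "kfam (Suc k) A" "real k \<le> y" "y gchoose Suc k \<le> real (card A)" "A \<noteq> {}"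
  shows "y gchoose k \<le> real (card (shadow (Suc k) A))"
proof -
  obtain t where t: "real (Suc k) \<le> t" "real (card A) = t gchoose Suc k"
    "t gchoose k \<le> real (card (shadow (Suc k) A))"
    by (rule kfam_param[OF assms(1,4)])
  have "y \<le> t" using gbinomial_real_le_imp[of k t y] t assms(3) by simp
  then have "y gchoose k \<le> t gchoose k" using assms(2) by (intro gbinomial_real_mono) auto
  then show ?thesis using t(3) by linarith
qed

lemma colex_shadow_ge_linear:
  assumes "real k \<le> y" "real m \<le> y gchoose Suc k"
  shows "real m * (real k + 1) \<le> real (colex_shadow (Suc k) m) * (y - real k)"
  using card_shadow_ge_linear[OF kfam_colex_initial, of k y m] assms card_colex_initial[of "Suc k" m]
  by (simp add: colex_shadow_def)

lemma colex_shadow_ge_gbinomial: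
  assumes "real (Suc k) \<le> t" "real m = t gchoose Suc k"
  shows "t gchoose k \<le> real (colex_shadow (Suc k) m)"
  using kruskal_katona_lovasz[OF kfam_colex_initial assms(1), of m] assms(2) card_colex_initial[of "Suc k" m]
  by (simp add: colex_shadow_def)

section \<open>Near-extremal families\<close>

text \<open>The uniformity is \<open>k = j + 2\<close>. Below, \<open>M = x - 1 gchoose (k - 1)\<close> is the degree and
  \<open>F = x - 1 gchoose (k - 2)\<close> the size of the shadow of a link in the extremal family.\<close>

definition near_extremal :: "nat \<Rightarrow> real \<Rightarrow> real \<Rightarrow> nat set set \<Rightarrow> bool" where
  "near_extremal j c x A \<longleftrightarrow> kfam (Suc (Suc j)) A \<and> real (Suc (Suc j)) \<le> x \<and>
     real (card A) = x gchoose Suc (Suc j) \<and>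
     real (card (shadow (Suc (Suc j)) A)) \<le> (1 + c / x) * (x gchoose Suc j)"

text \<open>In units of \<open>F\<close> the slack \<open>(c / x) * (x gchoose Suc j)\<close> is
  \<open>c / (j + 1)\<close>. This matches the factor \<open>j + 1\<close> lost in
  \<open>gbinomial_profile\<close>, so that the dichotomy involves \<open>c\<close> alone,
  independently of \<open>j\<close> and \<open>x\<close>.\<close>

lemma near_extremal_facts:
  assumes "near_extremal j c x A"
  defines "M \<equiv> x - 1 gchoose Suc j" and "F \<equiv> x - 1 gchoose j"
  shows "kfam (Suc (Suc j)) A" "real j + 2 \<le> x" "0 < F" "0 < M" "M * (real j + 1) = F * (x - 1 - real j)"
    "x gchoose Suc j = M + F" "(x gchoose Suc j) * (real j + 1) = x * F"
    "real (card A) * (real j + 2) = x * M"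
    "real (card (shadow (Suc (Suc j)) A)) \<le> (M + F) + c * F / (real j + 1)"
    "real (card A) = x gchoose Suc (Suc j)"
proof -
  note N = assms(1)[unfolded near_extremal_def]
  show x: "real j + 2 \<le> x" using N by simp
  show "kfam (Suc (Suc j)) A" "real (card A) = x gchoose Suc (Suc j)" using N by simp_all
  show "0 < F" "0 < M" unfolding F_def M_def using x by (auto intro!: gbinomial_real_pos)
  show "M * (real j + 1) = F * (x - 1 - real j)" unfolding M_def F_def by (rule gbinomial_Suc_mult)
  show MF: "x gchoose Suc j = M + F" unfolding M_def F_def by (rule gbinomial_addition_formula)
  show xF: "(x gchoose Suc j) * (real j + 1) = x * F" unfolding F_def by (rule gbinomial_absorb_mult)
  show "real (card A) * (real j + 2) = x * M" unfolding M_def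
    using gbinomial_absorb_mult[of x "Suc j"] N by (simp add: algebra_simps)
  have "(x gchoose Suc j) / x = F / (real j + 1)"
    using xF x by (simp add: field_simps)
  moreover have "(1 + c / x) * (x gchoose Suc j) = (x gchoose Suc j) + c * ((x gchoose Suc j) / x)"
    by (simp add: distrib_right)
  ultimately have "(1 + c / x) * (x gchoose Suc j) = (M + F) + c * F / (real j + 1)"
    unfolding MF[symmetric] by simp
  then show "real (card (shadow (Suc (Suc j)) A)) \<le> (M + F) + c * F / (real j + 1)"
    using N by simp
qed

text \<open>Splitting off the sets that leave \<open>S\<close> costs \<open>(q - p) F\<close>, where \<open>p M\<close> is their number and
  \<open>q F\<close> their contribution to the shadow, because the Lovasz function is concave between \<open>x - 1\<close> and \<open>x\<close>.\<close>

lemma dichotomy: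
  fixes S :: "nat set"
  assumes N: "near_extremal j c x A" and c: "0 \<le> c"
  defines "M \<equiv> x - 1 gchoose Suc j"
  defines "p \<equiv> real (card (A - nsets S (Suc (Suc j)))) / M"
  assumes p1: "p \<le> 1"
  shows "p * (1 - p) \<le> c"
proof -
  define F where "F = x - 1 gchoose j"
  note facts = near_extremal_facts[OF N, folded M_def F_def]
  let ?A2 = "A - nsets S (Suc (Suc j))" and ?A1 = "A \<inter> nsets S (Suc (Suc j))"
  let ?E = "real (card ?A2)"
  have fin: "finite A" using facts(1) kfam_finite by blast
  have EM: "?E \<le> M" using p1 facts(4) by (simp add: p_def)
  have pM: "p * M = ?E" using facts(4) by (simp add: p_def)
  have p0: "0 \<le> p" using facts(4) by (simp add: p_def)
  have sum: "real (card A) = real (card ?A1) + ?E"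
    using card_Int_Diff[OF fin, of "nsets S (Suc (Suc j))"] by simp
  have k1: "kfam (Suc (Suc j)) ?A1" using kfam_subset[OF facts(1)] by auto
  have Mj: "M * (real j + 1) = F * (x - 1 - real j)" by (rule facts(5))
  show ?thesis
  proof (cases "?E = 0 \<or> ?A1 = {}")
    case True
    then show ?thesis
    proof
      assume "?E = 0"
      then show ?thesis using c by (simp add: p_def)
    next
      \<comment> \<open>No set lies inside \<open>S\<close>, so the size of \<open>A\<close> is at
        most \<open>M\<close>; this is possible only for \<open>x = j + 2\<close>, with
        \<open>p = 1\<close>.\<close>
      assume "?A1 = {}"
      then have "real (card A) = ?E" using sum by simp
      then have "x * M = ?E * (real j + 2)" using facts(8) by simp
      also have "\<dots> \<le> M * (real j + 2)" using EM by (intro mult_right_mono) auto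
      finally have "x * M \<le> (real j + 2) * M" by (simp add: mult.commute)
      then have "x \<le> real j + 2" by (rule mult_right_le_imp_le) (rule facts(4))
      then have "x = real j + 2" using facts(2) by simp
      then have "M * (real j + 2) = ?E * (real j + 2)" using \<open>x * M = ?E * (real j + 2)\<close> by (simp add: mult.commute)
      then have "M = ?E" by simp
      then have "p = 1" using facts(4) by (simp add: p_def)
      then show ?thesis using c by simp
    qed
  next
    case False
    then have "1 \<le> ?E" by simp
    then obtain t where t: "real (Suc j) \<le> t" "t gchoose Suc j = ?E"
      by (rule gbinomial_real_surj)
    define q where "q = (t gchoose j) / F"
    have t1: "t \<le> x - 1"
      using gbinomial_real_le_imp[of j "x - 1" t] facts(2) EM t(2) by (simp add: M_def)
    have qp: "p \<le> q" "q \<le> 1" "q * (1 - p) \<le> (real j + 1) * (q - p)"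
      using gbinomial_profile[OF t(1) t1] unfolding t(2) p_def q_def M_def F_def by simp_all
    have lowE: "q * F \<le> real (colex_shadow (Suc j) (card ?A2))"
      using colex_shadow_ge_gbinomial[OF t(1) t(2)[symmetric]] facts(3) by (simp add: q_def)
    obtain y where y: "real (Suc (Suc j)) \<le> y" "real (card ?A1) = y gchoose Suc (Suc j)"
      "y gchoose Suc j \<le> real (card (shadow (Suc (Suc j)) ?A1))"
      by (rule kfam_param[OF k1]) (use False in auto)
    have A1: "real (card ?A1) = (x gchoose Suc (Suc j)) - ?E" using sum facts(10) by simp
    have yx: "y \<le> x"
      using gbinomial_real_le_imp[of "Suc j" x y] y(2) A1 facts(2) by simp
    have pas: "x gchoose Suc (Suc j) = M + (x - 1 gchoose Suc (Suc j))"
      unfolding M_def using gbinomial_addition_formula[of x "Suc j"] by simp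
    have xy: "x - 1 \<le> y"
    proof (rule gbinomial_real_le_imp[of "Suc j"])
      show "real (Suc j) \<le> y" using y(1) by simp
      show "x - 1 gchoose Suc (Suc j) \<le> y gchoose Suc (Suc j)"
        using y(2) A1 pas EM by simp
    qed
    define w where "w = x - y"
    have w: "0 \<le> w" "w \<le> 1" "x - w = y" using yx xy by (simp_all add: w_def)
    let ?G = "x gchoose Suc j" and ?Q = "y gchoose Suc j" and ?D = "x - 1 - real j"
    have D1: "1 \<le> ?D" using facts(2) by simp
    \<comment> \<open>The aim is \<open>?G - ?Q \<le> p * F\<close> for the loss in the part inside
      \<open>S\<close>; equality holds at \<open>w = 1\<close>, where
      \<open>y = x - 1\<close>.\<close>
    have "?G * (x - real (Suc j)) \<le> ?Q * (x - real (Suc j) + real (Suc j) * w)"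
      using gbinomial_ratio_le[OF w(1,2), of "Suc j" x] facts(2) w(3) by simp
    then have r: "?G * ?D \<le> ?Q * (?D + (real j + 1) * w)" by (simp add: algebra_simps)
    have L1: "(x gchoose Suc (Suc j)) * (real j + 2) = ?G * ?D"
      using gbinomial_Suc_mult[of x "Suc j"] by (simp add: algebra_simps)
    have L2: "(y gchoose Suc (Suc j)) * (real j + 2) = ?Q * (?D - w)"
      using gbinomial_Suc_mult[of y "Suc j"] by (simp add: w_def algebra_simps)
    have "?E = (x gchoose Suc (Suc j)) - (y gchoose Suc (Suc j))" using A1 y(2) by linarith
    then have "?E * (real j + 2) = ?G * ?D - ?Q * (?D - w)"
      by (simp only: left_diff_distrib L1 L2)
    moreover have "(real j + 2) * (?D * (?G - ?Q)) \<le> (real j + 1) * (?G * ?D - ?Q * (?D - w))"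
      using r by (simp add: algebra_simps)
    ultimately have "(real j + 2) * (?D * (?G - ?Q)) \<le> (real j + 2) * ((real j + 1) * ?E)"
      by (simp add: mult_ac)
    then have "?D * (?G - ?Q) \<le> (real j + 1) * ?E"
      by (rule mult_left_le_imp_le) simp
    also have "(real j + 1) * ?E = ?D * (p * F)"
    proof -
      have "(real j + 1) * ?E = p * (M * (real j + 1))" unfolding pM[symmetric] by simp
      also have "\<dots> = ?D * (p * F)" unfolding Mj by simp
      finally show ?thesis .
    qed
    finally have GQ: "?G - ?Q \<le> p * F" using D1 by (simp add: mult_le_cancel_left)
    have "real (card (shadow (Suc (Suc j)) ?A1)) + real (colex_shadow (Suc j) (card ?A2)) \<le>
      real (card (shadow (Suc (Suc j)) A))"
      using card_shadow_ge_parts[OF facts(1), of S] by linarith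
    then have "(q - p) * F \<le> c * F / (real j + 1)"
      using y(3) lowE GQ facts(6,9) by (simp add: algebra_simps)
    then have "((real j + 1) * (q - p)) * F \<le> c * F" by (simp add: field_simps)
    then have "(real j + 1) * (q - p) \<le> c" by (rule mult_right_le_imp_le) (rule facts(3))
    then have "q * (1 - p) \<le> c" using qp by linarith
    moreover have "p * (1 - p) \<le> q * (1 - p)" using qp p1 by (intro mult_right_mono) auto
    ultimately show ?thesis by linarith
  qed
qed

section \<open>Degrees and the core\<close>

definition core :: "nat \<Rightarrow> real \<Rightarrow> nat set set \<Rightarrow> nat set" where
  "core i x A = {v. (x - 1 gchoose i) < 2 * real (card (link v A))}"

lemma core_subset:
  assumes "0 \<le> x - 1 gchoose i"
  shows "core i x A \<subseteq> \<Union>A"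
proof
  fix v assume "v \<in> core i x A"
  then have "link v A \<noteq> {}" using assms unfolding core_def by force
  then obtain C where "C \<in> link v A" by (meson ex_in_conv)
  then show "v \<in> \<Union>A" unfolding mem_link by blast
qed

lemma card_diff_nsets_link:
  assumes "kfam k A"
  shows "card (A - nsets (- {v}) k) = card (link v A)"
proof -
  have "A - nsets (- {v}) k = {B \<in> A. v \<in> B}" unfolding nsets_inter[OF assms] by blast
  then show ?thesis by (simp only: card_link)
qed

text \<open>The sets containing \<open>v\<close> are those that leave \<open>- {v}\<close>, so
  \<open>dichotomy\<close> speaks about degrees. The threshold \<open>M / 2\<close> in
  \<open>core\<close> is the middle of the gap between \<open>2 * c * M\<close> and
  \<open>(1 - 2 * c) * M\<close>; degrees above \<open>M\<close> are possible and fall under the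
  second claim.\<close>

lemma degree_dichotomy:
  fixes v :: nat
  assumes N: "near_extremal j c x A" and c: "0 \<le> c"
  defines "M \<equiv> x - 1 gchoose Suc j" and "a \<equiv> real (card (link v A))"
  shows "2 * a \<le> M \<Longrightarrow> a \<le> 2 * c * M" "M < 2 * a \<Longrightarrow> (1 - 2 * c) * M \<le> a"
proof -
  note facts = near_extremal_facts[OF N, folded M_def]
  define p where "p = a / M"
  have pM: "p * M = a" and p0: "0 \<le> p" using facts(4) by (simp_all add: a_def p_def)
  have dich: "p * (1 - p) \<le> c" if "p \<le> 1"
    using dichotomy[OF N c, of "- {v}"] that
    unfolding card_diff_nsets_link[OF facts(1)] M_def[symmetric] a_def[symmetric] p_def[symmetric] by simp
  {
    assume "2 * a \<le> M"
    then have "p \<le> 1 / 2" using facts(4) by (simp add: p_def field_simps)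
    then have "p * (1 / 2) \<le> p * (1 - p)" using p0 by (intro mult_left_mono) auto
    also have "\<dots> \<le> c" using dich \<open>p \<le> 1 / 2\<close> by linarith
    finally have "p \<le> 2 * c" by linarith
    then show "a \<le> 2 * c * M" using facts(4) by (simp add: p_def pos_divide_le_eq)
  next
    assume "M < 2 * a"
    then have h: "1 / 2 \<le> p" using facts(4) by (simp add: p_def field_simps)
    show "(1 - 2 * c) * M \<le> a"
    proof (cases "p \<le> 1")
      case True
      then have "(1 / 2) * (1 - p) \<le> p * (1 - p)" using h by (intro mult_right_mono) auto
      also have "\<dots> \<le> c" by (rule dich[OF True])
      finally have "1 - p \<le> 2 * c" by simp
      then have "1 - 2 * c \<le> p" by simp
      then show ?thesis using facts(4) by (simp add: p_def pos_le_divide_eq)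
    next
      case False
      then have "M \<le> a" using facts(4) by (simp add: p_def field_simps)
      moreover have "(1 - 2 * c) * M \<le> 1 * M" using c facts(4) by (intro mult_right_mono) auto
      ultimately show ?thesis by simp
    qed
  }
qed

text \<open>Low vertices are added one at a time to the set of forbidden vertices. Each step changes the
  number of sets lost by at most \<open>2 c M\<close>, so it cannot jump over the gap left by the dichotomy.\<close>

lemma card_outside_core:
  assumes N: "near_extremal j c x A" and c: "0 \<le> c" "c \<le> 1 / 8"
  defines "M \<equiv> x - 1 gchoose Suc j"
  shows "real (card (A - nsets (core (Suc j) x A) (Suc (Suc j)))) \<le> 2 * c * M"
proof -
  note facts = near_extremal_facts[OF N, folded M_def]
  let ?V = "\<Union>A" and ?S = "core (Suc j) x A" and ?k = "Suc (Suc j)"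
  have SV: "?S \<subseteq> ?V" using facts(4) by (intro core_subset) (simp add: M_def)
  have fV: "finite ?V" by (rule kfam_finite_Union[OF facts(1)])
  have fA: "finite A" by (rule kfam_finite[OF facts(1)])
  have ind: "real (card (A - nsets (?V - W) ?k)) \<le> 2 * c * M" if "finite W" "W \<inter> ?S = {}" for W
    using that
  proof (induction W rule: finite_induct)
    case empty
    have "A - nsets (?V - {}) ?k = {}" unfolding nsets_inter[OF facts(1)] by blast
    then show ?case using c facts(4) by (simp only: card.empty) simp
  next
    case (insert v W)
    let ?X = "A - nsets (?V - insert v W) ?k"
    have ih: "real (card (A - nsets (?V - W) ?k)) \<le> 2 * c * M" using insert by simp
    have "v \<notin> ?S" using insert.prems by blast
    then have "real (card (link v A)) \<le> 2 * c * M"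
      using degree_dichotomy(1)[OF N c(1), of v, folded M_def] by (simp add: core_def M_def)
    moreover have "?X \<subseteq> (A - nsets (?V - W) ?k) \<union> {B \<in> A. v \<in> B}"
      unfolding nsets_inter[OF facts(1)] by blast
    then have "card ?X \<le> card ((A - nsets (?V - W) ?k) \<union> {B \<in> A. v \<in> B})"
      using fA by (intro card_mono) auto
    then have "card ?X \<le> card (A - nsets (?V - W) ?k) + card (link v A)"
      using card_Un_le[of "A - nsets (?V - W) ?k" "{B \<in> A. v \<in> B}"] unfolding card_link by linarith
    ultimately have X4: "real (card ?X) \<le> 4 * c * M" using ih by linarith
    define p where "p = real (card ?X) / M"
    have p0: "0 \<le> p" using facts(4) by (simp add: p_def)
    have "p \<le> 4 * c" using X4 facts(4) by (simp add: p_def pos_divide_le_eq)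
    then have p1: "p \<le> 1 / 2" using c by linarith
    then have "p * (1 - p) \<le> c"
      using dichotomy[OF N c(1), of "?V - insert v W", folded M_def, folded p_def] by linarith
    moreover have "p * (1 / 2) \<le> p * (1 - p)" using p0 p1 by (intro mult_left_mono) auto
    ultimately have "p * (1 / 2) \<le> c" by (rule order_trans[rotated])
    then have "p \<le> 2 * c" by linarith
    then show ?case using facts(4) by (simp add: p_def pos_divide_le_eq)
  qed
  have "?V - (?V - ?S) = ?S" using SV by blast
  then show ?thesis using ind[of "?V - ?S"] fV by auto
qed

text \<open>A link of parameter \<open>t = x - 1 + \<theta>\<close> and its own shadow force the
  shadow of \<open>A\<close> up to \<open>t + 1 gchoose Suc j\<close>, by Pascal's rule; comparison
  with the slack bounds \<open>\<theta>\<close> times the logarithmic derivative.\<close>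

lemma degree_upper:
  assumes N: "near_extremal j c x A" and c: "0 \<le> c"
    and t: "real (Suc j) \<le> t" "real (card (link v A)) = t gchoose Suc j" "x - 1 \<le> t"
  defines "M \<equiv> x - 1 gchoose Suc j" and "\<theta> \<equiv> t - (x - 1)"
  shows "real (card (link v A)) \<le> (1 + c) * M" "\<theta> * recip_sum (x - 1) (Suc j) \<le> 2 * c / x" "\<theta> \<le> c"
proof -
  define F where "F = x - 1 gchoose j"
  note facts = near_extremal_facts[OF N, folded M_def F_def]
  let ?a = "real (card (link v A))"
  have x2: "real j + 2 \<le> x" by (rule facts(2))
  have th0: "0 \<le> \<theta>" using t(3) by (simp add: \<theta>_def)
  have sh: "t gchoose j \<le> real (card (shadow (Suc j) (link v A)))"
    using kruskal_katona_lovasz[OF kfam_link[OF facts(1)] t(1,2)] .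
  have low: "real (card (shadow (Suc j) (link v A))) + ?a \<le> real (card (shadow (Suc (Suc j)) A))"
    using card_shadow_ge_link[OF facts(1), of v] by linarith
  have "F \<le> t gchoose j" unfolding F_def using t x2 by (intro gbinomial_real_mono) auto
  then have "?a \<le> M + c * F / (real j + 1)" using sh low facts(9) by linarith
  moreover have "c * F / (real j + 1) \<le> c * M"
  proof -
    have "F * 1 \<le> F * (x - 1 - real j)" using facts(3) x2 by (intro mult_left_mono) auto
    then have "F \<le> M * (real j + 1)" using facts(5) by simp
    then have "c * F \<le> c * (M * (real j + 1))" using c by (rule mult_left_mono)
    then show ?thesis by (simp add: pos_divide_le_eq mult_ac)
  qed
  ultimately show "?a \<le> (1 + c) * M" by (simp add: distrib_right)
  let ?G = "x gchoose Suc j" and ?r = "recip_sum x (Suc j)"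
  have G0: "0 < ?G" using x2 by (intro gbinomial_real_pos) auto
  have "t + 1 gchoose Suc j = (t gchoose j) + (t gchoose Suc j)" by (rule gbinomial_Suc_Suc)
  then have "t + 1 gchoose Suc j \<le> (1 + c / x) * ?G"
    using sh low t(2) N by (simp add: near_extremal_def)
  moreover have "?G * (1 + \<theta> * ?r) \<le> x + \<theta> gchoose Suc j"
    using th0 x2 by (intro gbinomial_add_ge) auto
  moreover have "x + \<theta> = t + 1" by (simp add: \<theta>_def)
  ultimately have "?G * (1 + \<theta> * ?r) \<le> ?G * (1 + c / x)" by (simp add: mult.commute)
  then have r: "\<theta> * ?r \<le> c / x" using G0 by (simp add: mult_le_cancel_left)
  have "recip_sum (x - 1) (Suc j) \<le> 2 * ?r"
    unfolding recip_sum_def sum_distrib_left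
  proof (rule sum_mono)
    fix i assume "i \<in> {..<Suc j}"
    then have "real i \<le> real j" by simp
    then have "2 \<le> x - real i" using x2 by linarith
    then show "1 / (x - 1 - real i) \<le> 2 * (1 / (x - real i))" by (simp add: field_simps)
  qed
  then have "\<theta> * recip_sum (x - 1) (Suc j) \<le> \<theta> * (2 * ?r)" using th0 by (rule mult_left_mono)
  then show "\<theta> * recip_sum (x - 1) (Suc j) \<le> 2 * c / x" using r by simp
  have "1 / x \<le> ?r"
  proof -
    have "(\<Sum>i<Suc j. 1 / (x - real i)) = 1 / x + (\<Sum>i<j. 1 / (x - real (Suc i)))"
      by (subst sum.lessThan_Suc_shift) simp
    moreover have "0 \<le> (\<Sum>i<j. 1 / (x - real (Suc i)))" using x2 by (intro sum_nonneg) auto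
    ultimately show ?thesis unfolding recip_sum_def by linarith
  qed
  then have "\<theta> * (1 / x) \<le> \<theta> * ?r" using th0 by (rule mult_left_mono)
  then have "\<theta> / x \<le> c / x" using r by simp
  then show "\<theta> \<le> c" using x2 by (simp add: divide_le_cancel)
qed

text \<open>A vertex whose link is again near-extremal, with the same constant \<open>c\<close>, and whose degree is close
  to \<open>M\<close>: the induction on the uniformity passes to such a link.\<close>

definition good_vertex :: "nat \<Rightarrow> real \<Rightarrow> real \<Rightarrow> nat set set \<Rightarrow> nat \<Rightarrow> real \<Rightarrow> bool" where
  "good_vertex j c x A v t \<longleftrightarrow> real (Suc j) \<le> t \<and> real (card (link v A)) = t gchoose Suc j \<and>
     real (card (shadow (Suc j) (link v A))) \<le> (1 + c / t) * (t gchoose j) \<and>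
     (x - 1 gchoose Suc j) + (x - 1 gchoose j) / 2 \<le>
       real (card (shadow (Suc j) (link v A))) + real (card (link v A))"

text \<open>\<open>\<tau>\<close> is half the amount by which the slope at \<open>p = 1\<close> of the (concave) relation between the relative
  size \<open>p\<close> of a link and its relative shadow falls short of \<open>1\<close>. The last term absorbs
  the vertices with \<open>p > 1\<close>, where concavity works in the wrong direction.\<close>

lemma link_shadow_core:
  assumes N: "near_extremal j c x A" and c: "0 \<le> c" "c \<le> 1 / 100"
    and v: "v \<in> core (Suc j) x A" and bad: "\<And>t. \<not> good_vertex j c x A v t"
  defines "M \<equiv> x - 1 gchoose Suc j" and "F \<equiv> x - 1 gchoose j"
    and "\<tau> \<equiv> 1 / (2 * ((x - 1 - real j) * recip_sum (x - 1) (Suc j)))"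
  defines "p \<equiv> real (card (link v A)) / M"
  shows "(1 + c / x) * (p + \<tau> * (1 - p) - 8 * c * \<tau> / x) \<le> real (card (shadow (Suc j) (link v A))) / F"
proof -
  define D where "D = x - 1 - real j"
  define L where "L = recip_sum (x - 1) (Suc j)"
  note facts = near_extremal_facts[OF N, folded M_def F_def, folded D_def]
  let ?a = "real (card (link v A))" and ?sh = "real (card (shadow (Suc j) (link v A)))"
  have x2: "real j + 2 \<le> x" by (rule facts(2))
  have D1: "1 \<le> D" using x2 by (simp add: D_def)
  have "0 \<le> recip_sum (x - 1) j" using x2 by (intro recip_sum_nonneg) auto
  then have "1 / D \<le> L" by (simp add: recip_sum_Suc L_def D_def)
  moreover have "0 < 1 / D" using D1 by simp
  ultimately have L0: "0 < L" by linarith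
  have "D * (1 / D) \<le> D * L" using \<open>1 / D \<le> L\<close> D1 by (intro mult_left_mono) auto
  then have DL: "1 \<le> D * L" using D1 by simp
  have tau: "0 \<le> \<tau>" "\<tau> \<le> 1 / 2" "\<tau> * L = 1 / (2 * D)"
  proof -
    have \<tau>: "\<tau> = 1 / (2 * (D * L))" by (simp add: \<tau>_def D_def L_def)
    show "0 \<le> \<tau>" unfolding \<tau> using DL by simp
    show "\<tau> \<le> 1 / 2" unfolding \<tau> using DL by (intro divide_left_mono) auto
    show "\<tau> * L = 1 / (2 * D)" unfolding \<tau> using L0 by simp
  qed
  have hv: "M < 2 * ?a" using v by (simp add: core_def M_def)
  have a1: "1 \<le> ?a"
  proof -
    have "0 < ?a" using hv facts(4) by linarith
    then show ?thesis by simp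
  qed
  obtain t where t: "real (Suc j) \<le> t" "t gchoose Suc j = ?a"
    using a1 by (rule gbinomial_real_surj)
  have low: "t gchoose j \<le> ?sh"
    by (rule kruskal_katona_lovasz[OF kfam_link[OF facts(1)] t(1) t(2)[symmetric]])
  have t0: "0 < t" using t(1) by simp
  have C0: "0 < t gchoose j" using t(1) by (intro gbinomial_real_pos) auto
  define q where "q = (t gchoose j) / F"
  have shq: "q \<le> ?sh / F" unfolding q_def using low facts(3) by (intro divide_right_mono) auto
  have cx: "0 \<le> c / x" using c x2 by simp
  show ?thesis
  proof (cases "t \<le> x - 1")
    case True
    note prof = gbinomial_profile[OF t(1) True, folded M_def F_def D_def L_def, unfolded t(2), folded p_def q_def]
    have "(1 - 2 * c) * M \<le> ?a" using degree_dichotomy(2)[OF N c(1), of v, folded M_def] hv by simp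
    then have p2: "1 - 2 * c \<le> p" using facts(4) by (simp add: p_def pos_le_divide_eq)
    define u where "u = (x - 1 - t) / D"
    have u0: "0 \<le> u" using True D1 by (simp add: u_def)
    have qpu: "q - p = q * u" using prof(5) by (simp add: u_def)
    have pu: "1 - p \<le> (real j + 1) * u" using prof(7) by (simp add: u_def)
    have "\<tau> * (1 - p) \<le> \<tau> * ((x - 1 - t) * L)" using prof(6) tau(1) by (intro mult_left_mono) auto
    also have "\<dots> = (x - 1 - t) * (\<tau> * L)" by simp
    also have "\<dots> = u / 2" unfolding tau(3) by (simp add: u_def)
    finally have tp: "\<tau> * (1 - p) \<le> u / 2" .
    have "9 / 10 \<le> q" using p2 prof(2) c by linarith
    then have "(9 / 10) * u \<le> q * u" using u0 by (rule mult_right_mono)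
    \<comment> \<open>The surplus \<open>q - p\<close> is at least \<open>9 / 10\<close> of
      \<open>u\<close>, while the factor 1/2 in \<open>\<tau>\<close> uses up only
      \<open>u / 2\<close>; the rest pays for the factor \<open>1 + c / x\<close> in the second case
      below.\<close>
    then have qlow: "p + \<tau> * (1 - p) + (2 / 5) * u \<le> q" using qpu tp by linarith
    have ct: "0 \<le> 8 * c * \<tau> / x" using c tau x2 by simp
    have "\<not> good_vertex j c x A v t" by (rule bad)
    then consider "(1 + c / t) * (t gchoose j) < ?sh" | "?sh + ?a < M + F / 2"
      unfolding good_vertex_def using t by (auto simp: M_def F_def)
    then show ?thesis
    proof cases
      case 1
      have "c / x \<le> c / t" using True c t0 x2 by (intro divide_left_mono) auto
      then have "(1 + c / x) * (t gchoose j) \<le> (1 + c / t) * (t gchoose j)" using C0 by (intro mult_right_mono) auto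
      then have "(1 + c / x) * (t gchoose j) \<le> ?sh" using 1 by linarith
      then have "(1 + c / x) * q \<le> ?sh / F" unfolding q_def using facts(3) by (simp add: divide_right_mono)
      moreover have "(1 + c / x) * (p + \<tau> * (1 - p) - 8 * c * \<tau> / x) \<le> (1 + c / x) * q"
        using qlow u0 ct cx by (intro mult_left_mono) auto
      ultimately show ?thesis by linarith
    next
      case 2
      \<comment> \<open>A link this small has \<open>1 - p > (j + 1) / (2 * x)\<close>, hence
        \<open>u > 1 / (2 * x)\<close>, and the reserve \<open>(2 / 5) * u\<close> exceeds
        \<open>c / x\<close>.\<close>
      have aM: "?a = p * M" using facts(4) by (simp add: p_def)
      have "p * F \<le> q * F" using prof(2) facts(3) by (intro mult_right_mono) auto
      also have "\<dots> = t gchoose j" using facts(3) by (simp add: q_def)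
      finally have "p * F + p * M < M + F / 2" using 2 low aM by linarith
      then have "F / 2 < (1 - p) * (M + F)" by (simp add: algebra_simps)
      then have "(F / 2) * (real j + 1) < ((1 - p) * (M + F)) * (real j + 1)"
        by (rule mult_strict_right_mono) simp
      also have "\<dots> = (1 - p) * (x * F)" unfolding facts(7)[symmetric] facts(6) by simp
      finally have "((real j + 1) / 2) * F < ((1 - p) * x) * F" by (simp add: mult_ac)
      then have "(real j + 1) / 2 < (1 - p) * x" by (rule mult_right_less_imp_less) (use facts(3) in simp)
      also have "\<dots> \<le> ((real j + 1) * u) * x" using pu x2 by (intro mult_right_mono) auto
      finally have "(real j + 1) * (1 / 2) < (real j + 1) * (u * x)" by (simp add: mult_ac)
      then have "1 / 2 < u * x" by (rule mult_left_less_imp_less) simp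
      then have "1 / (2 * x) < u" using x2 by (simp add: field_simps)
      then have q2: "p + \<tau> * (1 - p) + 1 / (5 * x) \<le> q" using qlow by simp
      have "\<tau> * (1 - p) \<le> 1 * (1 - p)" using tau prof(4) by (intro mult_right_mono) auto
      then have le1: "p + \<tau> * (1 - p) \<le> 1" by simp
      have "(c / x) * (p + \<tau> * (1 - p)) \<le> (c / x) * 1" using le1 cx by (rule mult_left_mono)
      moreover have "c / x \<le> 1 / (5 * x)" using c x2 by (simp add: field_simps)
      ultimately have "(1 + c / x) * (p + \<tau> * (1 - p)) \<le> q" using q2 by (simp add: distrib_right)
      moreover have "(1 + c / x) * (p + \<tau> * (1 - p) - 8 * c * \<tau> / x) \<le> (1 + c / x) * (p + \<tau> * (1 - p))"
        using ct cx by (intro mult_left_mono) auto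
      ultimately show ?thesis using shq by linarith
    qed
  next
    case False
    then have tx: "x - 1 \<le> t" by simp
    note up = degree_upper[OF N c(1) t(1) t(2)[symmetric] tx, folded M_def L_def]
    define \<theta> where "\<theta> = t - (x - 1)"
    have th: "0 \<le> \<theta>" "\<theta> * L \<le> 2 * c / x" "\<theta> \<le> c" using up tx by (simp_all add: \<theta>_def)
    have FC: "F \<le> t gchoose j" unfolding F_def using tx x2 by (intro gbinomial_real_mono) auto
    have "M \<le> t gchoose Suc j" unfolding M_def using tx x2 by (intro gbinomial_real_mono) auto
    then have Ma: "M \<le> ?a" using t(2) by simp
    then have p1: "1 \<le> p" using facts(4) by (simp add: p_def)
    have p2: "p \<le> 2"
    proof -
      have "p \<le> 1 + c" using up(1) facts(4) by (simp add: p_def pos_divide_le_eq)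
      then show ?thesis using c by simp
    qed
    have "\<not> good_vertex j c x A v t" by (rule bad)
    moreover have "M + F / 2 \<le> ?sh + ?a" using low FC Ma facts(3) by linarith
    ultimately have 1: "(1 + c / t) * (t gchoose j) < ?sh"
      unfolding good_vertex_def using t by (auto simp: M_def F_def)
    have "t \<le> x" using th c by (simp add: \<theta>_def)
    then have "c / x \<le> c / t" using c t0 x2 by (intro divide_left_mono) auto
    then have "(1 + c / x) * (t gchoose j) \<le> (1 + c / t) * (t gchoose j)" using C0 by (intro mult_right_mono) auto
    then have "(1 + c / x) * (t gchoose j) \<le> ?sh" using 1 by linarith
    then have q1: "(1 + c / x) * q \<le> ?sh / F" unfolding q_def using facts(3) by (simp add: divide_right_mono)
    have q0: "0 \<le> q" using C0 facts(3) by (simp add: q_def)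
    have "(p * D) * F = p * (M * (real j + 1))" unfolding facts(5) by simp
    also have "\<dots> = ?a * (real j + 1)" using facts(4) by (simp add: p_def)
    also have "\<dots> = (t gchoose j) * (t - real j)" unfolding t(2)[symmetric] by (rule gbinomial_Suc_mult)
    also have "\<dots> = (q * (D + \<theta>)) * F" using facts(3) by (simp add: q_def \<theta>_def D_def)
    finally have pq: "p * D = q * (D + \<theta>)" using facts(3) by simp
    then have "q * D \<le> p * D" using q0 th(1) by (simp add: distrib_left)
    then have "q \<le> p" using D1 by (simp add: mult_le_cancel_right)
    have "p = q + q * (\<theta> / D)" using pq D1 by (simp add: field_simps)
    \<comment> \<open>The constant 8 is \<open>q \<le> 2\<close>, times 2 from
      \<open>\<theta> / D = 2 * \<theta> * \<tau> * L\<close>, times 2 from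
      \<open>degree_upper\<close>.\<close>
    moreover have "q * (\<theta> / D) \<le> 8 * c * \<tau> / x"
    proof -
      have "q * (\<theta> / D) \<le> 2 * (\<theta> / D)"
        using \<open>q \<le> p\<close> p2 th(1) D1 by (intro mult_right_mono) auto
      also have "\<dots> = 4 * (\<theta> * (\<tau> * L))" unfolding tau(3) by simp
      also have "\<dots> = 4 * (\<tau> * (\<theta> * L))" by simp
      also have "\<dots> \<le> 4 * (\<tau> * (2 * c / x))" using th(2) tau(1) by (intro mult_left_mono) auto
      finally show ?thesis by (simp add: mult_ac)
    qed
    ultimately have "p - 8 * c * \<tau> / x \<le> q" by linarith
    moreover have "\<tau> * (1 - p) \<le> 0" using tau(1) p1 by (simp add: mult_nonneg_nonpos)
    ultimately have "(1 + c / x) * (p + \<tau> * (1 - p) - 8 * c * \<tau> / x) \<le> (1 + c / x) * q"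
      using cx by (intro mult_left_mono) auto
    then show ?thesis using q1 by linarith
  qed
qed

text \<open>A low vertex has \<open>p \<le> 2 * c\<close>, so by \<open>gbinomial_profile\<close>
  the surplus \<open>q - p\<close> of its relative shadow is at least \<open>p * c / x\<close>. The
  factor \<open>1 + c / x\<close> is thus available whether or not the link is
  near-extremal.\<close>

lemma link_shadow_noncore:
  assumes N: "near_extremal j c x A" and c: "0 \<le> c" "c \<le> 1 / 100"
    and v: "v \<in> \<Union>A" "v \<notin> core (Suc j) x A"
  defines "M \<equiv> x - 1 gchoose Suc j" and "F \<equiv> x - 1 gchoose j"
  defines "p \<equiv> real (card (link v A)) / M"
  shows "(1 + c / x) * p \<le> real (card (shadow (Suc j) (link v A))) / F"
proof -
  note facts = near_extremal_facts[OF N, folded M_def F_def]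
  let ?a = "real (card (link v A))" and ?sh = "real (card (shadow (Suc j) (link v A)))"
  have x2: "real j + 2 \<le> x" by (rule facts(2))
  have a1: "1 \<le> ?a" using card_link_pos[OF facts(1) v(1)] by simp
  obtain t where t: "real (Suc j) \<le> t" "t gchoose Suc j = ?a"
    using a1 by (rule gbinomial_real_surj)
  have low: "t gchoose j \<le> ?sh"
    by (rule kruskal_katona_lovasz[OF kfam_link[OF facts(1)] t(1) t(2)[symmetric]])
  define q where "q = (t gchoose j) / F"
  have shq: "q \<le> ?sh / F" unfolding q_def using low facts(3) by (intro divide_right_mono) auto
  have hv: "2 * ?a \<le> M" using v(2) by (simp add: core_def M_def)
  then have "?a \<le> 2 * c * M" using degree_dichotomy(1)[OF N c(1), of v, folded M_def] by simp
  then have p2: "p \<le> 2 * c" using facts(4) by (simp add: p_def pos_divide_le_eq)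
  have "?a \<le> M" using hv a1 by linarith
  then have "t gchoose Suc j \<le> x - 1 gchoose Suc j" unfolding t(2) M_def .
  then have tx: "t \<le> x - 1" by (rule gbinomial_real_le_imp[rotated]) (use x2 in simp)
  note prof = gbinomial_profile[OF t(1) tx, folded M_def F_def, unfolded t(2), folded p_def q_def]
  have "c \<le> 1 - p" using p2 c by linarith
  moreover have "0 \<le> q" using prof(1,2) by linarith
  ultimately have "p * c \<le> q * (1 - p)" using prof(2) c by (intro mult_mono) auto
  then have "p * c \<le> (real j + 1) * (q - p)" using prof(8) by linarith
  also have "\<dots> \<le> x * (q - p)" using prof(2) x2 by (intro mult_right_mono) auto
  finally have "p * c \<le> (q - p) * x" by (simp only: mult.commute[of x])
  moreover have "0 < x" using x2 by simp
  ultimately have "p * c / x \<le> q - p" by (simp only: pos_divide_le_eq)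
  moreover have "(1 + c / x) * p = p + p * c / x" by (simp add: distrib_right)
  ultimately have "(1 + c / x) * p \<le> q" by linarith
  then show ?thesis using shq by linarith
qed

text \<open>The relative degrees \<open>p\<close> sum to \<open>x\<close> and the relative link
  shadows to at most \<open>(1 + c / x) * x\<close>. After cancelling \<open>1 + c / x\<close>, the
  terms with \<open>\<tau>\<close> bound the sum of \<open>1 - p\<close> over the core by
  \<open>8 * c / x\<close> times the size of the core.\<close>

lemma card_core_no_good_vertex:
  assumes N: "near_extremal j c x A" and c: "0 \<le> c" "c \<le> 1 / 100"
    and bad: "\<And>v t. v \<in> core (Suc j) x A \<Longrightarrow> \<not> good_vertex j c x A v t"
  shows "real (card (core (Suc j) x A)) \<le> x + 16 * c"
proof -
  define M F where "M = x - 1 gchoose Suc j" and "F = x - 1 gchoose j"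
  note facts = near_extremal_facts[OF N, folded M_def F_def]
  let ?V = "\<Union>A" and ?S = "core (Suc j) x A"
  let ?D = "x - 1 - real j" and ?\<Lambda> = "recip_sum (x - 1) (Suc j)"
  define \<tau> where "\<tau> = 1 / (2 * (?D * ?\<Lambda>))"
  define p where "p v = real (card (link v A)) / M" for v
  define sh where "sh v = real (card (shadow (Suc j) (link v A))) / F" for v
  have x2: "real j + 2 \<le> x" by (rule facts(2))
  have D1: "1 \<le> ?D" using x2 by simp
  have "0 \<le> recip_sum (x - 1) j" using x2 by (intro recip_sum_nonneg) auto
  then have "0 < ?\<Lambda>" using D1 by (simp add: recip_sum_Suc add_nonneg_pos)
  then have tau0: "0 < \<tau>" using D1 by (simp add: \<tau>_def)
  have SV: "?S \<subseteq> ?V" using facts(4) by (intro core_subset) (simp add: M_def)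
  have fV: "finite ?V" by (rule kfam_finite_Union[OF facts(1)])
  have fS: "finite ?S" using SV fV by (rule finite_subset)
  have e0: "0 < 1 + c / x" using c x2 by (simp add: add_pos_nonneg)
  have "(\<Sum>v\<in>?V. sh v) = (real j + 1) * real (card (shadow (Suc (Suc j)) A)) / F"
    unfolding sh_def sum_divide_distrib[symmetric] of_nat_sum[symmetric] sum_card_shadow_link[OF facts(1)]
    by (simp add: algebra_simps)
  also have "\<dots> \<le> (real j + 1) * ((1 + c / x) * (x gchoose Suc j)) / F"
    using N facts(3) by (intro divide_right_mono mult_left_mono) (auto simp: near_extremal_def)
  also have "\<dots> = (1 + c / x) * (((x gchoose Suc j) * (real j + 1)) / F)" by (simp add: mult_ac)
  also have "\<dots> = (1 + c / x) * x" unfolding facts(7) using facts(3) by simp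
  finally have shsum: "(\<Sum>v\<in>?V. sh v) \<le> (1 + c / x) * x" .
  have "(\<Sum>v\<in>?V. p v) = (real j + 2) * real (card A) / M"
    unfolding p_def sum_divide_distrib[symmetric] of_nat_sum[symmetric] sum_card_link[OF facts(1)]
    by (simp add: algebra_simps)
  also have "\<dots> = x" using facts(8,4) by (simp add: mult.commute)
  finally have psum: "(\<Sum>v\<in>?V. p v) = x" .
  have p0: "0 \<le> p v" for v using facts(4) by (simp add: p_def)
  define \<delta> where "\<delta> v = (if v \<in> ?S then \<tau> * (1 - p v) - 8 * c * \<tau> / x else 0)" for v
  have "(1 + c / x) * (p v + \<delta> v) \<le> sh v" if "v \<in> ?V" for v
  proof (cases "v \<in> ?S")
    case True
    then show ?thesis
      using link_shadow_core[OF N c True bad[OF True], folded M_def F_def, folded p_def sh_def \<tau>_def]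
      by (simp add: \<delta>_def algebra_simps)
  next
    case False
    then show ?thesis
      using link_shadow_noncore[OF N c that False, folded M_def F_def, folded p_def sh_def]
      by (simp add: \<delta>_def)
  qed
  then have "(\<Sum>v\<in>?V. (1 + c / x) * (p v + \<delta> v)) \<le> (\<Sum>v\<in>?V. sh v)" by (intro sum_mono)
  then have "(1 + c / x) * (x + (\<Sum>v\<in>?V. \<delta> v)) \<le> (1 + c / x) * x"
    using shsum unfolding sum_distrib_left[symmetric] sum.distrib psum by linarith
  then have "x + (\<Sum>v\<in>?V. \<delta> v) \<le> x" using e0 by (simp add: mult_le_cancel_left)
  moreover have "(\<Sum>v\<in>?V. \<delta> v) = (\<Sum>v\<in>?S. \<tau> * (1 - p v) - 8 * c * \<tau> / x)"
    unfolding \<delta>_def using sum.inter_restrict[OF fV, of "\<lambda>v. \<tau> * (1 - p v) - 8 * c * \<tau> / x" ?S] SV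
    by (simp add: Int_absorb1)
  moreover have "(\<Sum>v\<in>?S. \<tau> * (1 - p v) - 8 * c * \<tau> / x) =
      \<tau> * (real (card ?S) - (\<Sum>v\<in>?S. p v) - real (card ?S) * (8 * c / x))"
  proof -
    have "(\<Sum>v\<in>?S. \<tau> * (1 - p v) - 8 * c * \<tau> / x) = \<tau> * (\<Sum>v\<in>?S. 1 - p v) - real (card ?S) * (8 * c * \<tau> / x)"
      by (simp only: sum_subtractf[of "\<lambda>v. \<tau> * (1 - p v)"] sum_constant sum_distrib_left)
    also have "(\<Sum>v\<in>?S. 1 - p v) = real (card ?S) - (\<Sum>v\<in>?S. p v)"
      by (simp only: sum_subtractf sum_constant mult_1_right)
    finally show ?thesis by (simp add: right_diff_distrib)
  qed
  ultimately have "\<tau> * (real (card ?S) - (\<Sum>v\<in>?S. p v) - real (card ?S) * (8 * c / x)) \<le> 0" by simp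
  then have "real (card ?S) - (\<Sum>v\<in>?S. p v) - real (card ?S) * (8 * c / x) \<le> 0"
    using tau0 by (simp add: mult_le_0_iff)
  moreover have "(\<Sum>v\<in>?S. p v) \<le> (\<Sum>v\<in>?V. p v)"
    by (rule sum_mono2[OF fV SV p0])
  then have "(\<Sum>v\<in>?S. p v) \<le> x" by (simp only: psum)
  ultimately have s: "real (card ?S) - real (card ?S) * (8 * c / x) \<le> x" by linarith
  \<comment> \<open>A crude bound \<open>2 * x\<close> for the size of the core, inserted once more,
    turns the relative error into \<open>16 * c\<close>.\<close>
  have "8 * c / x \<le> 1 / 2" using c x2 by (simp add: field_simps)
  then have "real (card ?S) * (8 * c / x) \<le> real (card ?S) * (1 / 2)" by (intro mult_left_mono) auto
  then have "real (card ?S) \<le> 2 * x" using s by linarith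
  then have "real (card ?S) * (8 * c / x) \<le> (2 * x) * (8 * c / x)" using c x2 by (intro mult_right_mono) auto
  also have "\<dots> = 16 * c" using x2 by simp
  finally show ?thesis using s by linarith
qed

section \<open>The core of a link\<close>

lemma card_shadow_ge_prop:
  assumes B: "kfam (Suc j) B" and x: "real j + 2 \<le> x" and l: "0 \<le> l" "l \<le> 1"
    and card: "l * (x - 1 gchoose Suc j) \<le> real (card B)"
  shows "l * (x - 1 gchoose j) \<le> real (card (shadow (Suc j) B))"
proof (cases "B = {}")
  case True
  have "0 < x - 1 gchoose Suc j" using x by (intro gbinomial_real_pos) auto
  then have "l = 0" using card l True by (simp add: mult_le_0_iff)
  then show ?thesis by simp
next
  case False
  define M F D where "M = x - 1 gchoose Suc j" and "F = x - 1 gchoose j" and "D = x - 1 - real j"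
  have F0: "0 < F" unfolding F_def using x by (intro gbinomial_real_pos) auto
  have D1: "1 \<le> D" using x by (simp add: D_def)
  have MF: "M * (real j + 1) = F * D" unfolding M_def F_def D_def by (rule gbinomial_Suc_mult)
  show ?thesis
  proof (cases "real (card B) \<le> M")
    case True
    have "real (card B) * (real j + 1) \<le> real (card (shadow (Suc j) B)) * D"
      using card_shadow_ge_linear[OF B, of "x - 1"] True x by (simp add: M_def D_def)
    moreover have "(l * M) * (real j + 1) \<le> real (card B) * (real j + 1)"
      using card by (intro mult_right_mono) (auto simp: M_def)
    moreover have "(l * M) * (real j + 1) = (l * F) * D" using MF by simp
    ultimately have "(l * F) * D \<le> real (card (shadow (Suc j) B)) * D" by linarith
    then show ?thesis unfolding F_def[symmetric] by (rule mult_right_le_imp_le) (use D1 in simp)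
  next
    case nle: False
    have "F \<le> real (card (shadow (Suc j) B))"
      unfolding F_def by (rule card_shadow_ge_mono[OF B _ _ False]) (use nle x in \<open>auto simp: M_def\<close>)
    moreover have "l * F \<le> 1 * F" using l F0 by (intro mult_right_mono) auto
    ultimately show ?thesis unfolding F_def[symmetric] by simp
  qed
qed

text \<open>If a core vertex \<open>w\<close> were not in the core of the link of \<open>v\<close>, almost all of the shadow of the link
  of \<open>w\<close> would give new shadow sets that avoid \<open>v\<close> and do not extend by \<open>v\<close>.\<close>

lemma core_subset_link_core:
  assumes N: "near_extremal j c x A" and c: "0 \<le> c" "c \<le> 1 / 100"
    and good: "good_vertex j c x A v t"
  shows "core (Suc j) x A \<subseteq> insert v (core j t (link v A))"
proof (rule subsetI, rule ccontr)
  fix w assume w: "w \<in> core (Suc j) x A" and "w \<notin> insert v (core j t (link v A))"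
  then have wv: "w \<noteq> v" and wl: "w \<notin> core j t (link v A)" by simp_all
  define M F where "M = x - 1 gchoose Suc j" and "F = x - 1 gchoose j"
  note facts = near_extremal_facts[OF N, folded M_def F_def]
  note G = good[unfolded good_vertex_def, folded M_def F_def]
  let ?a = "real (card (link v A))" and ?sh = "real (card (shadow (Suc j) (link v A)))"
  let ?b = "real (card (link w (link v A)))"
  have x2: "real j + 2 \<le> x" by (rule facts(2))
  have t: "real (Suc j) \<le> t" "?a = t gchoose Suc j" using G by simp_all
  have kl: "kfam (Suc j) (link v A)" by (rule kfam_link[OF facts(1)])
  have aM: "?a \<le> 2 * M" and tx: "t \<le> x"
  proof -
    consider "t \<le> x - 1" | "x - 1 \<le> t" by linarith
    then have "?a \<le> (1 + c) * M \<and> t \<le> x - 1 + c"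
    proof cases
      case 1
      then have "?a \<le> M" unfolding t(2) M_def using t by (intro gbinomial_real_mono) auto
      moreover have "1 * M \<le> (1 + c) * M" using c facts(4) by (intro mult_right_mono) auto
      ultimately show ?thesis using 1 c by simp
    next
      case 2
      then show ?thesis using degree_upper(1,3)[OF N c(1) t 2, folded M_def] by simp
    qed
    moreover have "(1 + c) * M \<le> 2 * M" using c facts(4) by (intro mult_right_mono) auto
    ultimately show "?a \<le> 2 * M" "t \<le> x" using c by simp_all
  qed
  have "?b \<le> 2 * c * (t - 1 gchoose j)"
  proof (cases j)
    case 0
    then have "2 * ?b \<le> 1" using wl by (simp add: core_def)
    then have "?b = 0" by simp
    then show ?thesis using 0 c by simp
  next
    case (Suc i)
    have "near_extremal i c t (link v A)"
      using kl G unfolding near_extremal_def Suc by simp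
    from degree_dichotomy(1)[OF this c(1), of w] show ?thesis
      using wl unfolding core_def Suc by simp
  qed
  moreover have "t - 1 gchoose j \<le> F" unfolding F_def using t tx by (intro gbinomial_real_mono) auto
  then have "2 * c * (t - 1 gchoose j) \<le> 2 * c * F" using c by (intro mult_left_mono) auto
  moreover have "t - 1 gchoose j \<le> 2 * M"
  proof -
    have "(t - 1 gchoose j) * t = ?a * (real j + 1)"
      unfolding t(2) gbinomial_absorb_mult by simp
    also have "\<dots> \<le> ?a * t" using t(1) by (intro mult_left_mono) auto
    finally have "t - 1 gchoose j \<le> ?a" by (rule mult_right_le_imp_le) (use t in simp)
    then show ?thesis using aM by simp
  qed
  then have "2 * c * (t - 1 gchoose j) \<le> 2 * c * (2 * M)" using c by (intro mult_left_mono) auto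
  ultimately have bF: "?b \<le> 2 * c * F" and bM: "?b \<le> 4 * c * M" by linarith+
  define B0 where "B0 = {C \<in> link w A. v \<notin> C}"
  have kw: "kfam (Suc j) (link w A)" by (rule kfam_link[OF facts(1)])
  have k0: "kfam (Suc j) B0" unfolding B0_def by (rule kfam_subset[OF kw]) blast
  have sym: "link v (link w A) = link w (link v A)"
    using wv by (intro set_eqI) (auto simp: mem_link insert_commute)
  have "card (link w A) = card {C \<in> link w A. v \<in> C} + card B0"
    unfolding B0_def by (rule card_split[OF kfam_finite[OF kw]])
  then have cw: "real (card (link w A)) = ?b + real (card B0)"
    unfolding card_link[symmetric] sym by simp
  have "(1 - 2 * c) * M \<le> real (card (link w A))"
    using degree_dichotomy(2)[OF N c(1), of w, folded M_def] w by (simp add: core_def M_def)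
  then have B0: "(1 - 6 * c) * M \<le> real (card B0)" using cw bM by (simp add: algebra_simps)
  have sB0: "(1 - 6 * c) * F \<le> real (card (shadow (Suc j) B0))"
    using card_shadow_ge_prop[OF k0 x2, of "1 - 6 * c"] B0 c by (simp add: M_def F_def)
  \<comment> \<open>Sets \<open>insert w D\<close> with \<open>D\<close> in \<open>?Q\<close> avoid
    \<open>v\<close> and are not in the link of \<open>v\<close>, so they are shadow sets beyond
    those counted by \<open>card_shadow_ge_link\<close> at \<open>v\<close>.\<close>
  let ?Q = "{D \<in> shadow (Suc j) B0. insert w D \<notin> link v A}"
  have wD: "w \<notin> D" "\<exists>z. z \<notin> D \<and> insert z D \<in> B0" if "D \<in> shadow (Suc j) B0" for D
  proof -
    from that shadow_iff[OF k0] obtain z where z: "z \<notin> D" "insert z D \<in> B0" by blast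
    then show "\<exists>z. z \<notin> D \<and> insert z D \<in> B0" by blast
    have "insert z D \<in> link w A" using z(2) unfolding B0_def by blast
    then show "w \<notin> D" by (simp add: mem_link)
  qed
  have fs0: "finite (shadow (Suc j) B0)" by (rule finite_shadow[OF k0])
  have "{D \<in> shadow (Suc j) B0. insert w D \<in> link v A} \<subseteq> link w (link v A)"
    using wD(1) by (auto simp: mem_link[of _ w])
  then have "card {D \<in> shadow (Suc j) B0. insert w D \<in> link v A} \<le> card (link w (link v A))"
    by (rule card_mono[rotated]) (intro finite_link kfam_finite[OF kl])
  then have cQ: "real (card (shadow (Suc j) B0)) \<le> ?b + real (card ?Q)"
    using card_split[OF fs0, of "\<lambda>D. insert w D \<in> link v A"] by linarith
  have cQ2: "card (insert w ` ?Q) = card ?Q" using wD(1) by (intro card_insert_image) blast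
  have subQ: "insert w ` ?Q \<subseteq> {B \<in> shadow (Suc (Suc j)) A. v \<notin> B}"
  proof
    fix B assume "B \<in> insert w ` ?Q"
    then obtain D where D: "B = insert w D" "D \<in> shadow (Suc j) B0" by blast
    obtain z where z: "z \<notin> D" "insert z D \<in> B0" using wD(2)[OF D(2)] by blast
    then have "insert z D \<in> link w A" "v \<notin> insert z D" unfolding B0_def by blast+
    then have "w \<notin> insert z D" "insert w (insert z D) \<in> A" by (simp_all add: mem_link)
    then have "z \<notin> B" "insert z B \<in> A" using z(1) D(1) by (auto simp: insert_commute)
    then have "B \<in> shadow (Suc (Suc j)) A" using shadow_iff[OF facts(1)] by blast
    moreover have "v \<notin> B" using D(1) wv \<open>v \<notin> insert z D\<close> by blast
    ultimately show "B \<in> {B \<in> shadow (Suc (Suc j)) A. v \<notin> B}" by blast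
  qed
  have fA: "finite (shadow (Suc (Suc j)) A)" by (rule finite_shadow[OF facts(1)])
  have disj: "link v A \<inter> insert w ` ?Q = {}" by blast
  have "card (link v A \<union> insert w ` ?Q) \<le> card {B \<in> shadow (Suc (Suc j)) A. v \<notin> B}"
    using link_subset_shadow[OF facts(1), of v] subQ fA by (intro card_mono) auto
  moreover have "card (link v A \<union> insert w ` ?Q) = card (link v A) + card ?Q"
    using card_Un_disjoint[OF kfam_finite[OF kl] _ disj] fs0 cQ2 by simp
  ultimately have "real (card ?Q) + ?a + ?sh \<le> real (card (shadow (Suc (Suc j)) A))"
    using card_shadow_split[OF facts(1), of v] by linarith
  moreover have "M + F / 2 \<le> ?sh + ?a" using G by blast
  moreover have "(1 - 6 * c) * F = F - 6 * (c * F)" "2 * c * F = 2 * (c * F)"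
    by (simp_all add: left_diff_distrib)
  \<comment> \<open>\<open>6 * c\<close> combines the degree deficit \<open>2 * c\<close> of
    \<open>w\<close> with \<open>4 * c\<close> for the sets through both vertices; another
    \<open>2 * c\<close> is lost in passing to \<open>?Q\<close>. What remains, almost
    \<open>F\<close>, exceeds the room of about \<open>F / 2\<close> left by
    \<open>good_vertex\<close>.\<close>
  ultimately have "M + F / 2 + F - 8 * (c * F) \<le> M + F + c * F / (real j + 1)"
    using cQ sB0 bF facts(9) by linarith
  moreover have "c * F / (real j + 1) \<le> c * F / 1"
    using c facts(3) by (intro divide_left_mono) auto
  ultimately have "F / 2 \<le> 9 * (c * F)" by simp
  moreover have "c * F \<le> (1 / 100) * F" using c facts(3) by (intro mult_right_mono) auto
  ultimately show False using facts(3) by linarith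
qed

section \<open>Lovasz's bound for complements\<close>

lemma gbinomial_pow_le:
  assumes "0 \<le> u" "u \<le> K" "0 < K"
  shows "K \<le> y - real n + 1 \<Longrightarrow> (y gchoose n) * (1 - u / K) ^ n \<le> (y - u gchoose n)"
proof (induction n)
  case (Suc n)
  have ih: "(y gchoose n) * (1 - u / K) ^ n \<le> (y - u gchoose n)" using Suc by simp
  have K: "K \<le> y - real n" using Suc by simp
  have uK: "0 \<le> 1 - u / K" using assms by simp
  have "u * K \<le> u * (y - real n)" using K assms by (intro mult_left_mono) auto
  then have *: "(1 - u / K) * (y - real n) \<le> y - u - real n"
    using assms by (simp add: field_simps)
  have "((y gchoose n) * (y - real n)) * (1 - u / K) ^ Suc n
      = ((y gchoose n) * (1 - u / K) ^ n) * ((1 - u / K) * (y - real n))" by simp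
  also have "\<dots> \<le> (y - u gchoose n) * (y - u - real n)"
    using ih * uK K assms gbinomial_real_nonneg[of n y] gbinomial_real_nonneg[of n "y - u"]
    by (intro mult_mono) auto
  finally have "((y gchoose Suc n) * (1 - u / K) ^ Suc n) * (real n + 1) \<le> (y - u gchoose Suc n) * (real n + 1)"
    unfolding gbinomial_Suc_mult[symmetric] by (simp only: mult_ac)
  then show ?case by (rule mult_right_le_imp_le) simp
qed simp

text \<open>The sets all of whose extensions are missing are counted by applying Lovasz's bound to the
  complements. This beats the direct bound when \<open>r - j\<close> is small compared with \<open>j\<close>.\<close>

lemma colex_shadow_complement:
  assumes r: "j + 2 \<le> r" and E: "E < r choose Suc j"
  defines "p \<equiv> real E / real (r choose Suc j)"
    and "q \<equiv> real (colex_shadow (Suc j) E) / real (r choose j)"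
  obtains a where "0 \<le> a" "a \<le> 1" "(1 - a) ^ (r - j - 1) \<le> 1 - p"
    "(1 - p) * a * (real j + 2) \<le> (real j + 1) * (q - p)"
proof -
  define R where "R = r - j - 1"
  obtain R' where R': "R = Suc R'" using r by (cases R) (auto simp: R_def)
  have rR: "r = R + Suc j" "r - Suc j = R" "r - j = Suc R" using r by (auto simp: R_def)
  define N where "N = r choose Suc j"
  define Fs where "Fs = r choose j"
  define m where "m = N - E"
  have m0: "1 \<le> m" "m + E = N" using E by (auto simp: m_def N_def)
  have N0: "0 < real N" and F0: "0 < real Fs" using r by (simp_all add: N_def Fs_def)
  have NF: "real N * (real j + 1) = real Fs * (real R + 1)"
  proof -
    have "real N = real r gchoose Suc j" "real Fs = real r gchoose j"
      by (simp_all only: N_def Fs_def binomial_gbinomial)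
    moreover have "real r - real j = real R + 1" using rR(1) by simp
    ultimately show ?thesis using gbinomial_Suc_mult[of "real r" j] by (simp only:)
  qed
  have NR: "N = r choose R" using binomial_symmetric[of "Suc j" r] rR by (simp add: N_def)
  let ?V = "{1..r}" and ?I = "colex_initial (Suc j) E"
  have I: "?I \<subseteq> nsets ?V (Suc j)" by (rule colex_initial_subset) (use E in simp)
  have kI: "kfam (Suc j) ?I" by (rule kfam_colex_initial)
  have cI: "card ?I = E" by (rule card_colex_initial) simp
  have fN: "finite (nsets ?V k)" for k by (rule finite_nsets_atMost)
  let ?P = "nsets ?V j - shadow (Suc j) ?I" and ?Mi = "nsets ?V (Suc j) - ?I"
  let ?c = "\<lambda>B. ?V - B"
  have cM: "card ?Mi = m"
    using card_Diff_subset[OF kfam_finite[OF kI] I] cI by (simp add: m_def N_def card_nsets_atMost)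
  have injc: "inj_on ?c (Pow ?V)" by (rule inj_onI) blast
  have nP: "nsets ?V k \<subseteq> Pow ?V" for k by (auto simp: nsets_def)
  have cX: "card (?c ` ?P) = card ?P"
    by (rule card_image) (rule inj_on_subset[OF injc], use nP[of j] in blast)
  have kX: "kfam (Suc R) (?c ` ?P)"
  proof (rule kfamI)
    show "finite (?c ` ?P)" using fN by simp
    fix B assume "B \<in> ?c ` ?P"
    then obtain C where C: "B = ?V - C" "C \<in> nsets ?V j" by blast
    then have "C \<subseteq> ?V" "finite C" "card C = j" by (simp_all add: nsets_def)
    then show "finite B \<and> card B = Suc R" using C(1) rR by (simp add: card_Diff_subset)
  qed
  \<comment> \<open>If \<open>B\<close> is not in the shadow, no \<open>insert w B\<close> is in the
    segment; in complements, deleting \<open>w\<close> leads to the complement of a missing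
    set.\<close>
  have subX: "shadow (Suc R) (?c ` ?P) \<subseteq> ?c ` ?Mi"
  proof
    fix D assume "D \<in> shadow (Suc R) (?c ` ?P)"
    then obtain w where w: "w \<notin> D" "insert w D \<in> ?c ` ?P" using shadow_iff[OF kX] by blast
    then obtain B where B: "insert w D = ?V - B" "B \<in> nsets ?V j" "B \<notin> shadow (Suc j) ?I" by blast
    then have B': "B \<subseteq> ?V" "finite B" "card B = j" by (simp_all add: nsets_def)
    have wV: "w \<in> ?V" "w \<notin> B" using B(1) by blast+
    have "insert w B \<in> nsets ?V (Suc j)" using B' wV by (simp add: nsets_def)
    moreover have "insert w B \<notin> ?I" using B(3) wV shadow_iff[OF kI] by blast
    moreover have "D = ?V - insert w B" using B(1) w(1) by blast
    ultimately show "D \<in> ?c ` ?Mi" by blast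
  qed
  have "card (shadow (Suc R) (?c ` ?P)) \<le> card (?c ` ?Mi)"
    using subX fN by (intro card_mono) auto
  also have "\<dots> \<le> card ?Mi" using fN by (intro card_image_le) auto
  finally have shX: "card (shadow (Suc R) (?c ` ?P)) \<le> m" unfolding cM .
  have "Fs \<le> card ?P + colex_shadow (Suc j) E"
  proof -
    have "nsets ?V j \<subseteq> ?P \<union> shadow (Suc j) ?I" by blast
    then have "card (nsets ?V j) \<le> card (?P \<union> shadow (Suc j) ?I)"
      using fN finite_shadow[OF kI] by (intro card_mono) auto
    also have "\<dots> \<le> card ?P + card (shadow (Suc j) ?I)" by (rule card_Un_le)
    finally show ?thesis by (simp add: card_nsets_atMost Fs_def colex_shadow_def)
  qed
  then have FP: "real Fs - real (colex_shadow (Suc j) E) \<le> real (card ?P)" by linarith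
  have "1 \<le> real m" using m0 by simp
  then obtain z where z: "real (Suc R') \<le> z" "z gchoose Suc R' = real m"
    by (rule gbinomial_real_surj)
  have zR: "real R \<le> z" "z gchoose R = real m" using z R' by simp_all
  have "real (card ?P) * (real R + 1) \<le> real m * (z - real R)"
  proof (cases "?P = {}")
    case True
    show ?thesis unfolding True card.empty using zR by simp
  next
    case False
    then have "?c ` ?P \<noteq> {}" by simp
    then obtain t where t: "real (Suc R) \<le> t" "real (card (?c ` ?P)) = t gchoose Suc R"
      "t gchoose R \<le> real (card (shadow (Suc R) (?c ` ?P)))"
      by (rule kfam_param[OF kX])
    have "t gchoose Suc R' \<le> z gchoose Suc R'" using t(3) shX z(2) R' by simp
    then have "t \<le> z" by (rule gbinomial_real_le_imp[rotated]) (use z in simp)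
    then have "t gchoose Suc R \<le> z gchoose Suc R" using t by (intro gbinomial_real_mono) auto
    then have "real (card ?P) \<le> z gchoose Suc R" using t(2) cX by simp
    then have "real (card ?P) * (real R + 1) \<le> (z gchoose Suc R) * (real R + 1)"
      by (intro mult_right_mono) auto
    also have "\<dots> = real m * (z - real R)" unfolding gbinomial_Suc_mult zR(2) ..
    finally show ?thesis .
  qed
  have "z gchoose Suc R' \<le> real r gchoose Suc R'"
    using z(2) m0 NR R' by (simp flip: binomial_gbinomial)
  then have zr: "z \<le> real r" by (rule gbinomial_real_le_imp[rotated]) (use rR R' in simp)
  define y where "y = real r - z"
  \<comment> \<open>\<open>j + 2 = r - R + 1\<close> is the smallest factor in the numerator of
    \<open>r gchoose R\<close>; \<open>gbinomial_pow_le\<close> compares all factors with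
    it.\<close>
  define a where "a = y / (real j + 2)"
  have y: "0 \<le> y" "y \<le> real j + 1" using zr zR rR(1) by (simp_all add: y_def)
  have "0 \<le> a" "a \<le> 1" using y by (simp_all add: a_def)
  have p1: "1 - p = real m / real N" using m0 N0 by (simp add: p_def N_def[symmetric] field_simps)
  have "(real r gchoose R) * (1 - y / (real j + 2)) ^ R \<le> (real r - y gchoose R)"
    using y rR(1) by (intro gbinomial_pow_le) auto
  then have "real N * (1 - a) ^ R \<le> real m"
    using zR(2) by (simp add: y_def a_def NR binomial_gbinomial)
  then have c1: "(1 - a) ^ R \<le> 1 - p" unfolding p1 using N0 by (simp add: pos_le_divide_eq mult.commute)
  have "(real Fs - real (colex_shadow (Suc j) E)) * (real R + 1) \<le> real (card ?P) * (real R + 1)"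
    using FP by (intro mult_right_mono) auto
  also have "\<dots> \<le> real m * (z - real R)" by fact
  also have "z - real R = real j + 1 - y" using rR(1) by (simp add: y_def)
  finally have fin: "(real Fs - real (colex_shadow (Suc j) E)) * (real R + 1) \<le> real m * (real j + 1 - y)" .
  have "((1 - q) * real Fs) * (real R + 1) \<le> ((1 - p) * real N) * (real j + 1 - y)"
  proof -
    have "(1 - q) * real Fs = real Fs - real (colex_shadow (Suc j) E)"
      using F0 by (simp add: q_def Fs_def[symmetric] left_diff_distrib)
    moreover have "(1 - p) * real N = real m" using N0 unfolding p1 by simp
    ultimately show ?thesis using fin by simp
  qed
  moreover have "((1 - q) * real Fs) * (real R + 1) = ((1 - q) * (real j + 1)) * real N"
    using NF by (simp add: mult_ac)
  ultimately have "((1 - q) * (real j + 1)) * real N \<le> ((1 - p) * (real j + 1 - y)) * real N"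
    by (simp only: mult_ac)
  then have "(1 - q) * (real j + 1) \<le> (1 - p) * (real j + 1 - y)"
    by (rule mult_right_le_imp_le) (rule N0)
  then have py: "(1 - p) * y \<le> (real j + 1) * (q - p)" by (simp add: algebra_simps)
  have "a * (real j + 2) = y" by (simp add: a_def)
  then have "(1 - p) * a * (real j + 2) = (1 - p) * y" by (simp only: mult.assoc)
  with py have "(1 - p) * a * (real j + 2) \<le> (real j + 1) * (q - p)" by (simp only:)
  with \<open>0 \<le> a\<close> \<open>a \<le> 1\<close> c1 show ?thesis using that unfolding R_def by blast
qed

section \<open>Fine structure and the size of the core\<close>

text \<open>A factor above 1 is needed: in \<open>fine_numeric\<close> the term
  \<open>(1 - p) * (D * a)\<close> has to beat \<open>w \<le> 1 - p\<close> with something to spare.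
  Bernoulli's inequality alone gives \<open>p \<le> R * a\<close>; applied to about half the
  exponent and squared it gives more, since \<open>(7 / 40)^2 > 3 / 100\<close>.\<close>

lemma one_minus_power_bounds:
  fixes a p :: real
  assumes a: "0 \<le> a" "a \<le> 1" and R: "1 \<le> R" and pow: "(1 - a) ^ R \<le> 1 - p"
  shows "p \<le> real R * a" "97 / 100 \<le> p \<Longrightarrow> 11 / 10 \<le> (real R + 1) * a"
proof -
  have "1 + real R * (- a) \<le> (1 + (- a)) ^ R" by (rule Bernoulli_inequality) (use a in simp)
  then show 1: "p \<le> real R * a" using pow by simp
  assume p: "97 / 100 \<le> p"
  show "11 / 10 \<le> (real R + 1) * a"
  proof (cases "R = 1")
    case True
    then show ?thesis using 1 p by simp
  next
    case False
    then have R2: "2 \<le> R" using R by simp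
    show ?thesis
    proof (rule ccontr)
      assume "\<not> ?thesis"
      then have lt: "(real R + 1) * a < 11 / 10" by simp
      then have Ra: "real R * a \<le> 11 / 10" using a by (simp add: distrib_right)
      define l where "l = (R + 1) div 2"
      have l: "R \<le> 2 * l" "2 * l \<le> R + 1" unfolding l_def by linarith+
      have "2 * real l \<le> real R + 1" using l(2) by linarith
      also have "\<dots> \<le> (3 / 2) * real R" using R2 by simp
      finally have "4 * real l \<le> 3 * real R" by simp
      then have "(4 * real l) * a \<le> (3 * real R) * a" using a(1) by (rule mult_right_mono)
      then have la: "real l * a \<le> 33 / 40" using Ra by simp
      have "1 + real l * (- a) \<le> (1 + (- a)) ^ l" by (rule Bernoulli_inequality) (use a in simp)
      then have "7 / 40 \<le> (1 - a) ^ l" using la by simp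
      then have "(7 / 40) ^ 2 \<le> ((1 - a) ^ l) ^ 2" by (intro power_mono) auto
      also have "\<dots> = (1 - a) ^ (2 * l)" by (simp add: power_mult[symmetric] mult.commute)
      also have "\<dots> \<le> (1 - a) ^ R" using a l(1) by (intro power_decreasing) auto
      finally show False using pow p by (simp add: power2_eq_square)
    qed
  qed
qed

text \<open>In units of \<open>N = r choose (j + 1)\<close> and \<open>r choose j\<close>: \<open>p\<close> is the part of the last layer of
  the core that is present and \<open>q\<close> its shadow, \<open>e\<close> the number of sets outside the core, \<open>h\<close> the excess of
  the Lovasz bound over \<open>N\<close>; moreover \<open>J = j + 1\<close>, \<open>D = r - j\<close> and \<open>w = r + 1 - x\<close>. For \<open>4 J \<le> D\<close>
  the direct bound on \<open>q\<close> decides, otherwise the one by complements.\<close>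

lemma fine_numeric:
  fixes p q h e w c J D a :: real
  assumes J: "1 \<le> J" and D: "2 \<le> D" and c: "0 < c" "c \<le> 1 / 1000000"
    and w: "0 \<le> w" "w \<le> 1 / 500" and p: "0 \<le> p" "p \<le> 1" and e: "0 \<le> e" "e \<le> 2 * c"
    and h1: "h \<le> 1 - w" and h2: "p + e \<le> h"
    and hP: "(J + 1) * (p + e) = (1 - w) + h * J * (1 - w / D)"
    and q: "q + e \<le> h + c / J" and i: "p * (1 - p) \<le> J * (q - p)"
    and ratio: "D * (1 - w) \<le> h * D + h * J * w"
    and a: "0 \<le> a" "p \<le> (D - 1) * a" "97 / 100 \<le> p \<Longrightarrow> 11 / 10 \<le> D * a"
    and ii: "(1 - p) * a * (J + 1) \<le> J * (q - p)"
    and ex: "D < 4 * J \<Longrightarrow> p \<le> 21 / 10000 * e + 102 / 100 * (c * D / J) \<Longrightarrow> False"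
  shows "1 - p \<le> 40 * c"
proof -
  \<comment> \<open>\<open>X\<close> is the error of replacing \<open>h\<close> by
    \<open>p + e\<close>: the identity \<open>hP\<close> gives
    \<open>h - X \<le> p + e \<le> h\<close>, so the surplus \<open>q - p\<close> is at most
    \<open>X + c / J\<close>.\<close>
  define X where "X = h * w / D"
  have h0: "0 \<le> h" using h2 p e by linarith
  have h1': "h \<le> 1" using h1 w by linarith
  have X0: "0 \<le> X" using h0 w D by (simp add: X_def)
  have XD: "X * D = h * w" using D by (simp add: X_def)
  have hw: "h * w \<le> w" using mult_right_mono[OF h1' w(1)] by simp
  have "(J + 1) * (p + e) = (1 - w) + h * J - J * X" unfolding hP by (simp add: X_def algebra_simps)
  then have "(J + 1) * (p + e) \<ge> (J + 1) * (h - X)" using h1 X0 by (simp add: algebra_simps)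
  then have d2: "h - X \<le> p + e" using J by (simp add: mult_le_cancel_left)
  then have qp: "q - p \<le> X + c / J" using q by linarith
  have wp: "w \<le> 1 - p" using h1 h2 e by linarith
  show ?thesis
  proof (cases "4 * J \<le> D")
    case True
    have "h * J * w \<le> h * (D / 4) * w" using True h0 w by (intro mult_right_mono mult_left_mono) auto
    then have "D * (1 - w) \<le> D * (h + (h * w) / 4)" using ratio by (simp add: algebra_simps)
    then have "1 - w \<le> h + (h * w) / 4" using D by (simp add: mult_le_cancel_left)
    then have "99 / 100 + w \<le> h" using hw w by linarith
    moreover have "X * 1 \<le> X * D" using X0 D by (intro mult_left_mono) auto
    then have "X \<le> w" using XD hw by simp
    ultimately have p98: "98 / 100 \<le> p" using d2 e c by linarith
    have "J * X \<le> (D / 4) * X" using True X0 by (intro mult_right_mono) auto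
    then have "J * X \<le> w / 4" using XD hw by (simp add: mult.commute)
    moreover have "J * (q - p) \<le> J * (X + c / J)" using qp J by (intro mult_left_mono) auto
    moreover have "J * (X + c / J) = J * X + c" using J by (simp add: distrib_left)
    ultimately have "p * (1 - p) \<le> w / 4 + c" using i by linarith
    moreover have "98 / 100 * (1 - p) \<le> p * (1 - p)" using p98 p by (intro mult_right_mono) auto
    ultimately have "98 / 100 * (1 - p) \<le> w / 4 + c" by (rule order_trans[rotated])
    moreover have "98 / 100 * (1 - p) = 98 / 100 - 98 / 100 * p" by (simp only: right_diff_distrib mult_1_right)
    ultimately show ?thesis using wp c by linarith
  next
    case False
    then have DJ: "D < 4 * J" by simp
    have DJ4: "c * D / J \<le> 4 * c" using DJ J c by (simp add: pos_divide_le_eq)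
    have "J * ((1 - p) * a) \<le> (J + 1) * ((1 - p) * a)" using p a by (intro mult_right_mono) auto
    also have "\<dots> \<le> J * (q - p)" using ii by (simp add: mult_ac)
    finally have "(1 - p) * a \<le> q - p" using J by (simp add: mult_le_cancel_left)
    then have "(1 - p) * a \<le> X + c / J" using qp by linarith
    then have "((1 - p) * a) * D \<le> (X + c / J) * D" using D by (intro mult_right_mono) auto
    moreover have "(X + c / J) * D = h * w + c * D / J" by (simp add: distrib_right XD)
    moreover have "((1 - p) * a) * D = (1 - p) * (D * a)" by (simp only: mult_ac)
    ultimately have main: "(1 - p) * (D * a) \<le> h * w + c * D / J" by (simp only:)
    show ?thesis
    proof (cases "97 / 100 \<le> p")
      case True
      \<comment> \<open>As \<open>w \<le> 1 - p\<close>, subtracting it leaves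
        \<open>(1 - p) / 10 \<le> 4 * c\<close>: this is the origin of
        \<open>40 * c\<close>.\<close>
      have "(1 - p) * (11 / 10) \<le> (1 - p) * (D * a)" using a(3)[OF True] p by (intro mult_left_mono) auto
      then have "(1 - p) * (11 / 10) \<le> w + 4 * c" using main hw DJ4 by linarith
      moreover have "(1 - p) * (11 / 10) = 11 / 10 - p * (11 / 10)" by (simp only: left_diff_distrib mult_1_left)
      ultimately show ?thesis using wp by linarith
    next
      \<comment> \<open>Here \<open>p\<close> is forced to be tiny, because \<open>h * w\<close>
        contains \<open>p\<close> with a coefficient far below \<open>1 - p\<close>. A first
        estimate \<open>p \<le> 200 * c\<close> makes \<open>1 - p\<close> nearly 1, and the sharper
        second one is what the counting argument in \<open>ex\<close> excludes.\<close>
      case False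
      have "p \<le> D * a" using a by (simp add: left_diff_distrib)
      then have "(1 - p) * p \<le> (1 - p) * (D * a)" using p by (intro mult_left_mono) auto
      then have m2: "(1 - p) * p \<le> h * w + c * D / J" using main by linarith
      have "2 * X \<le> X * D" using X0 D by (simp add: mult.commute[of X] mult_right_mono)
      moreover have "h * w \<le> h * (1 / 500)" using w h0 by (intro mult_left_mono) auto
      ultimately have "2 * X \<le> h / 500" using XD by simp
      then have "h \<le> 1002 / 1000 * p + 1002 / 1000 * e" using d2 p e by linarith
      then have hw2: "h * w \<le> 201 / 100000 * p + 201 / 100000 * e"
        using \<open>h * w \<le> h * (1 / 500)\<close> p e by linarith
      have "3 / 100 * p \<le> (1 - p) * p" using False p by (intro mult_right_mono) auto
      then have "3 / 100 * p \<le> 201 / 100000 * p + 201 / 100000 * e + 4 * c" using m2 hw2 DJ4 by linarith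
      then have "p \<le> 200 * c" using e c by linarith
      then have "999 / 1000 * p \<le> (1 - p) * p" using c p by (intro mult_right_mono) auto
      moreover define z where "z = c * D / J"
      ultimately have "999 / 1000 * p \<le> 201 / 100000 * p + 201 / 100000 * e + z"
        using m2[folded z_def] hw2 by linarith
      moreover have "0 \<le> z" using c D J by (simp add: z_def)
      ultimately have "p \<le> 21 / 10000 * e + 102 / 100 * z" using e p by linarith
      then have "p \<le> 21 / 10000 * e + 102 / 100 * (c * D / J)" by (simp only: z_def)
      then show ?thesis using ex[OF DJ] by simp
    qed
  qed
qed

text \<open>Translates a core of size \<open>r + 1\<close> slightly above \<open>x\<close> into the
  variables of \<open>fine_numeric\<close>. The second claim sharpens the assumed
  \<open>x + 1 / 500\<close>, which closes the induction in \<open>card_core_le\<close>.\<close>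

lemma fine_structure:
  assumes N: "near_extremal j c x A" and c: "0 < c" "c \<le> 1 / 1000000"
    and S: "finite S" "card S = Suc r" and xr: "x < real (Suc r)" "real (Suc r) \<le> x + 1 / 500"
    and E2: "real (card (A - nsets S (Suc (Suc j)))) \<le> 2 * c * (x - 1 gchoose Suc j)"
  shows "real (card (nsets S (Suc (Suc j)) - A)) \<le> 40 * c * real (r choose Suc j)"
    "real (Suc r) - x \<le> 40 * c"
proof -
  define M F where "M = x - 1 gchoose Suc j" and "F = x - 1 gchoose j"
  note facts = near_extremal_facts[OF N, folded M_def F_def]
  let ?k = "Suc (Suc j)"
  let ?A1 = "A \<inter> nsets S ?k" and ?A2 = "A - nsets S ?k"
  have x2: "real j + 2 \<le> x" by (rule facts(2))
  have rj: "j + 2 \<le> r" using x2 xr(1) by simp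
  define J D w where "J = real j + 1" and "D = real r - real j" and "w = real (Suc r) - x"
  have J1: "1 \<le> J" and D2: "2 \<le> D" using rj by (simp_all add: J_def D_def)
  have w: "0 \<le> w" "w \<le> 1 / 500" using xr by (simp_all add: w_def)
  have xw: "x = real r + 1 - w" by (simp add: w_def)
  define Nn Fn Cr where "Nn = real (r choose Suc j)" and "Fn = real (r choose j)" and "Cr = real (r choose ?k)"
  have gN: "Nn = real r gchoose Suc j" and gF: "Fn = real r gchoose j" and gC: "Cr = real r gchoose ?k"
    by (simp_all only: Nn_def Fn_def Cr_def binomial_gbinomial)
  have pos: "0 < Nn" "0 < Fn" "0 < Cr" using rj by (simp_all add: Nn_def Fn_def Cr_def)
  have NJ: "Nn * J = Fn * D" unfolding gN gF J_def D_def by (rule gbinomial_Suc_mult)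
  have CJ: "Cr * (J + 1) = Nn * (D - 1)"
    using gbinomial_Suc_mult[of "real r" "Suc j"] unfolding gN gC J_def D_def by (simp add: algebra_simps)
  have MN: "M \<le> Nn" unfolding M_def gN using x2 xr by (intro gbinomial_real_mono) auto
  have FN: "F \<le> Fn" unfolding F_def gF using x2 xr by (intro gbinomial_real_mono) auto
  define L where "L = real (card A)"
  have Lx: "L = x gchoose ?k" unfolding L_def by (rule facts(10))
  have LM: "L * (J + 1) = x * M" using facts(8) by (simp add: L_def J_def add.commute)
  have MleL: "M \<le> L"
  proof -
    have "M * (J + 1) \<le> M * x" using x2 facts(4) by (intro mult_left_mono) (auto simp: J_def)
    then have "M * (J + 1) \<le> L * (J + 1)" using LM by (simp add: mult.commute)
    then show ?thesis by (rule mult_right_le_imp_le) (use J1 in simp)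
  qed
  have L0: "0 < L" using MleL facts(4) by linarith
  \<comment> \<open>\<open>A\<close> exceeds the complete layer on \<open>r\<close> vertices by a
    definite proportion, since \<open>x - r = 1 - w \<ge> 499 / 500\<close>. This serves twice: it
    makes the subtraction in \<open>E1\<close> exact, and it rules out a tiny
    \<open>p\<close>.\<close>
  have Llow: "Cr * (1 + (499 / 500) * ((J + 1) / real r)) \<le> L"
  proof -
    have "(real r gchoose ?k) * (1 + (1 - w) * recip_sum (real r) ?k) \<le> (real r + (1 - w) gchoose ?k)"
      using rj w by (intro gbinomial_add_ge) auto
    moreover have "real r + (1 - w) = x" by (simp add: xw)
    ultimately have 1: "Cr * (1 + (1 - w) * recip_sum (real r) ?k) \<le> L" by (simp only: gC Lx)
    have "(\<Sum>i<?k. 1 / real r) \<le> recip_sum (real r) ?k"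
      unfolding recip_sum_def
    proof (rule sum_mono)
      fix i assume "i \<in> {..<?k}"
      then have "real i < real r" using rj by simp
      then show "1 / real r \<le> 1 / (real r - real i)" by (intro divide_left_mono) auto
    qed
    then have "(J + 1) / real r \<le> recip_sum (real r) ?k" by (simp add: J_def add.commute)
    then have "(499 / 500) * ((J + 1) / real r) \<le> (1 - w) * recip_sum (real r) ?k"
      using w J1 by (intro mult_mono) auto
    then have "Cr * (1 + (499 / 500) * ((J + 1) / real r)) \<le> Cr * (1 + (1 - w) * recip_sum (real r) ?k)"
      using pos by (intro mult_left_mono) auto
    then show ?thesis using 1 by linarith
  qed
  define e2 where "e2 = real (card ?A2)"
  have e2: "0 \<le> e2" "e2 \<le> 2 * c * M" using E2 by (simp_all add: e2_def M_def)
  have fA: "finite A" by (rule kfam_finite[OF facts(1)])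
  have A12: "real (card ?A1) + e2 = L"
    using card_Int_Diff[OF fA, of "nsets S ?k"] by (simp add: L_def e2_def)
  have fS: "finite (nsets S ?k)" using S(1) by (rule finite_imp_finite_nsets)
  have cS: "card (nsets S ?k) = (r choose ?k) + (r choose Suc j)"
    using S by (simp add: card_nsets)
  have "Cr \<le> real (card ?A1)"
  proof -
    define \<rho> where "\<rho> = (J + 1) / x"
    have \<rho>: "0 \<le> \<rho>" "\<rho> \<le> 1" using x2 by (simp_all add: \<rho>_def J_def)
    have "M = L * \<rho>" using LM x2 by (simp add: \<rho>_def field_simps)
    then have "e2 \<le> 2 * c * (L * \<rho>)" using e2 by simp
    then have A1: "L * (1 - 2 * c * \<rho>) \<le> real (card ?A1)" using A12 by (simp add: algebra_simps)
    have "real r \<le> x" using w by (simp add: xw)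
    then have "\<rho> \<le> (J + 1) / real r" unfolding \<rho>_def using J1 rj x2 by (intro divide_left_mono) auto
    then have "Cr * (1 + (499 / 500) * \<rho>) \<le> Cr * (1 + (499 / 500) * ((J + 1) / real r))"
      using pos by (intro mult_left_mono add_left_mono) auto
    then have L1: "Cr * (1 + (499 / 500) * \<rho>) \<le> L" using Llow by linarith
    have c\<rho>: "c * \<rho> \<le> 1 / 1000000" using mult_mono[of c "1 / 1000000" \<rho> 1] c \<rho> by simp
    have "(c * \<rho>) * \<rho> \<le> (1 / 1000000) * \<rho>" using c\<rho> \<rho>(1) by (rule mult_right_mono)
    moreover have "c * \<rho> \<le> (1 / 1000000) * \<rho>" using c \<rho>(1) by (intro mult_right_mono) auto
    moreover have "(1 + b * \<rho>) * (1 - 2 * c * \<rho>) = 1 + b * \<rho> - 2 * (c * \<rho>) - b * (2 * ((c * \<rho>) * \<rho>))" for b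
      by (simp add: algebra_simps)
    note this[of "499 / 500"]
    ultimately have "1 \<le> (1 + (499 / 500) * \<rho>) * (1 - 2 * c * \<rho>)" using \<rho>(1) by linarith
    then have "Cr * 1 \<le> Cr * ((1 + (499 / 500) * \<rho>) * (1 - 2 * c * \<rho>))"
      using pos by (intro mult_left_mono) auto
    also have "\<dots> = (Cr * (1 + (499 / 500) * \<rho>)) * (1 - 2 * c * \<rho>)" by simp
    also have "\<dots> \<le> L * (1 - 2 * c * \<rho>)" using L1 c\<rho> by (intro mult_right_mono) auto
    finally show ?thesis using A1 by simp
  qed
  then have Cle: "r choose ?k \<le> card ?A1" by (simp add: Cr_def)
  define E1 where "E1 = card ?A1 - (r choose ?k)"
  have E1: "card ?A1 = (r choose ?k) + E1" using Cle by (simp add: E1_def)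
  have "card ?A1 \<le> card (nsets S ?k)" using fS by (intro card_mono) auto
  then have E1N: "E1 \<le> r choose Suc j" using E1 cS by simp
  define p where "p = real E1 / Nn"
  define e where "e = e2 / Nn"
  define q where "q = real (colex_shadow (Suc j) E1) / Fn"
  define h where "h = ((x gchoose Suc j) - Nn) / Fn"
  have pN: "p * Nn = real E1" and eN: "e * Nn = e2" and qF: "q * Fn = real (colex_shadow (Suc j) E1)"
    and hF: "(x gchoose Suc j) = Nn + h * Fn"
    using pos by (simp_all add: p_def e_def q_def h_def)
  have p01: "0 \<le> p" "p \<le> 1" using pos E1N by (simp_all add: p_def Nn_def)
  have "e2 \<le> 2 * c * Nn"
  proof -
    have "2 * c * M \<le> 2 * c * Nn" using MN c by (intro mult_left_mono) auto
    then show ?thesis using e2 by linarith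
  qed
  then have e01: "0 \<le> e" "e \<le> 2 * c" using pos e2 by (simp_all add: e_def pos_divide_le_eq)
  have "0 < r choose ?k" using rj by simp
  then have "0 < card ?A1" using Cle by linarith
  then have ne: "?A1 \<noteq> {}" by (metis card.empty less_irrefl)
  have low: "Nn + q * Fn + e * Fn \<le> real (card (shadow ?k A))"
  proof -
    have "e2 * J \<le> real (colex_shadow (Suc j) (card ?A2)) * D"
      unfolding e2_def J_def D_def
    proof (rule colex_shadow_ge_linear)
      show "real j \<le> real r" using rj by simp
      have "2 * c * M \<le> 1 * M" using c facts(4) by (intro mult_right_mono) auto
      then show "real (card ?A2) \<le> real r gchoose Suc j" using e2 MN by (simp add: e2_def gN)
    qed
    moreover have "e2 * J = (e * Fn) * D" unfolding eN[symmetric] using NJ by (simp add: mult_ac)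
    ultimately have "(e * Fn) * D \<le> real (colex_shadow (Suc j) (card ?A2)) * D" by simp
    then have "e * Fn \<le> real (colex_shadow (Suc j) (card ?A2))"
      by (rule mult_right_le_imp_le) (use D2 in simp)
    then show ?thesis
      using card_shadow_ge_colex[OF facts(1) ne E1 E1N] qF Nn_def by linarith
  qed
  have cF: "c * F / J \<le> (c / J) * Fn"
    using FN c J1 by (simp add: divide_right_mono mult_left_mono)
  have qe: "q + e \<le> h + c / J"
  proof -
    have "M + F = Nn + h * Fn" using facts(6) hF by simp
    then have "Nn + q * Fn + e * Fn \<le> Nn + h * Fn + (c / J) * Fn"
      using low facts(9) cF unfolding J_def by linarith
    then have "(q + e) * Fn \<le> (h + c / J) * Fn" by (simp add: distrib_right)
    then show ?thesis by (rule mult_right_le_imp_le) (rule pos(2))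
  qed
  have Gs: "real (Suc r) gchoose Suc j = Nn + Fn"
    unfolding gN gF using gbinomial_addition_formula[of "real (Suc r)" j] by simp
  have sx: "real (Suc r) - w = x" by (simp add: w_def)
  \<comment> \<open>The chord estimates between the parameters \<open>r\<close> and
    \<open>r + 1\<close>: from above here, from below in \<open>ratio\<close>.\<close>
  have h1: "h \<le> 1 - w"
  proof -
    have "(real (Suc r) - w gchoose Suc j) * real (Suc r) \<le>
        (real (Suc r) gchoose Suc j) * (real (Suc r) - real (Suc j) * w)"
      using w rj by (intro gbinomial_diff_le) auto
    then have "(Nn + h * Fn) * real (Suc r) \<le> (Nn + Fn) * (real (Suc r) - real (Suc j) * w)"
      by (simp only: sx hF Gs)
    moreover have "real (Suc r) = D + J" "real (Suc j) = J" by (simp_all add: D_def J_def)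
    ultimately have "(Nn + h * Fn) * (D + J) \<le> (Nn + Fn) * ((D + J) - J * w)" by (simp only:)
    moreover define T where "T = D + J"
    ultimately have "(Nn + h * Fn) * T \<le> (Nn + Fn) * T - (Nn + Fn) * J * w"
      by (simp only: right_diff_distrib mult.assoc)
    moreover have "(Nn + Fn) * J = Fn * T" using NJ by (simp add: T_def algebra_simps)
    ultimately have "(Nn + h * Fn) * T \<le> (Nn + Fn) * T - Fn * T * w" by (simp only:)
    then have "(h * Fn) * T \<le> ((1 - w) * Fn) * T" by (simp add: algebra_simps)
    then have "h * Fn \<le> (1 - w) * Fn" by (rule mult_right_le_imp_le) (use D2 J1 T_def in simp)
    then show ?thesis by (rule mult_right_le_imp_le) (rule pos(2))
  qed
  have ratio: "D * (1 - w) \<le> h * D + h * J * w"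
  proof -
    have "(real (Suc r) gchoose Suc j) * (real (Suc r) - real (Suc j)) \<le>
      (real (Suc r) - w gchoose Suc j) * (real (Suc r) - real (Suc j) + real (Suc j) * w)"
      using w rj by (intro gbinomial_ratio_le) auto
    moreover have "real (Suc r) - real (Suc j) = D" "real (Suc j) = J" by (simp_all add: D_def J_def)
    ultimately have "(Nn + Fn) * D \<le> (Nn + h * Fn) * (D + J * w)" by (simp only: sx Gs hF)
    then have "Fn * D \<le> Nn * J * w + h * Fn * (D + J * w)" by (simp add: algebra_simps)
    then have "(D * (1 - w)) * Fn \<le> (h * D + h * J * w) * Fn" unfolding NJ by (simp add: algebra_simps)
    then show ?thesis by (rule mult_right_le_imp_le) (rule pos(2))
  qed
  \<comment> \<open>The size of \<open>A\<close> counted twice: as \<open>x gchoose ?k\<close>, and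
    as the complete layer on \<open>r\<close> vertices plus \<open>E1\<close> plus the sets outside
    \<open>S\<close>.\<close>
  have hP: "(J + 1) * (p + e) = (1 - w) + h * J * (1 - w / D)"
  proof -
    have "L * (J + 1) = (Nn + h * Fn) * (D - w)"
      using gbinomial_Suc_mult[of x "Suc j"] unfolding Lx hF J_def D_def w_def by (simp add: algebra_simps)
    moreover have "L = Cr + p * Nn + e * Nn" using A12 E1 pN eN by (simp add: Cr_def)
    ultimately have "Cr * (J + 1) + (p + e) * Nn * (J + 1) = Nn * (D - w) + h * Fn * (D - w)"
      by (simp add: algebra_simps)
    then have "Nn * (D - 1) + (p + e) * Nn * (J + 1) = Nn * (D - w) + h * Fn * (D - w)"
      by (simp only: CJ)
    then have "(p + e) * Nn * (J + 1) = Nn * (1 - w) + h * Fn * (D - w)" by (simp add: algebra_simps)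
    moreover have "h * Fn * (D - w) = h * (Fn * D) * (1 - w / D)" using D2 by (simp add: field_simps)
    ultimately have "(p + e) * Nn * (J + 1) = Nn * (1 - w) + h * (Fn * D) * (1 - w / D)" by simp
    then have "((J + 1) * (p + e)) * Nn = ((1 - w) + h * J * (1 - w / D)) * Nn"
      unfolding NJ[symmetric] by (simp add: algebra_simps)
    then show ?thesis using pos by simp
  qed
  have h2: "p + e \<le> h"
  proof -
    have "(h + h * J * w / D) * D = h * D + h * J * w" using D2 by (simp add: distrib_right)
    then have "(1 - w) * D \<le> (h + h * J * w / D) * D" using ratio by (simp only: mult.commute[of _ D])
    then have "1 - w \<le> h + h * J * w / D" by (rule mult_right_le_imp_le) (use D2 in simp)
    then have "(J + 1) * (p + e) \<le> (J + 1) * h" unfolding hP by (simp add: algebra_simps)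
    then show ?thesis by (rule mult_left_le_imp_le) (use J1 in simp)
  qed
  have "1 - p \<le> 40 * c"
  proof (cases "E1 = r choose Suc j")
    case True
    then have "p = 1" using pos by (simp add: p_def Nn_def)
    then show ?thesis using c by simp
  next
    case False
    then have "E1 < r choose Suc j" using E1N by simp
    from colex_shadow_complement[OF rj this, folded Nn_def Fn_def, folded p_def q_def]
    obtain a where a: "0 \<le> a" "a \<le> 1" "(1 - a) ^ (r - j - 1) \<le> 1 - p"
      "(1 - p) * a * (real j + 2) \<le> (real j + 1) * (q - p)" by blast
    have R: "1 \<le> r - j - 1" "real (r - j - 1) = D - 1" using rj by (simp_all add: D_def of_nat_diff)
    note pw = one_minus_power_bounds[OF a(1,2) R(1) a(3), unfolded R(2)]
    have i: "p * (1 - p) \<le> J * (q - p)"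
    proof (cases "E1 = 0")
      case True
      then show ?thesis using pos J1 by (simp add: p_def q_def)
    next
      case False
      then have "1 \<le> real E1" by simp
      then obtain t where t: "real (Suc j) \<le> t" "t gchoose Suc j = real E1"
        by (rule gbinomial_real_surj)
      have "t gchoose Suc j \<le> real r gchoose Suc j" using t(2) E1N gN by (simp add: Nn_def)
      then have tr: "t \<le> real r" by (rule gbinomial_real_le_imp[rotated]) (use rj in simp)
      note prof = gbinomial_profile[OF t(1) tr, folded gN gF, unfolded t(2), folded p_def]
      let ?q = "(t gchoose j) / Fn"
      have "?q \<le> q" unfolding q_def using colex_shadow_ge_gbinomial[OF t(1) t(2)[symmetric]] pos
        by (intro divide_right_mono) auto
      have "p * (1 - p) \<le> ?q * (1 - p)" using prof(2) p01 by (intro mult_right_mono) auto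
      also have "\<dots> \<le> (real j + 1) * (?q - p)" by (rule prof(8))
      also have "\<dots> \<le> J * (q - p)" unfolding J_def using \<open>?q \<le> q\<close> by (intro mult_left_mono) auto
      finally show ?thesis .
    qed
    \<comment> \<open>A tiny \<open>p\<close> would leave \<open>A\<close> with hardly more than
      \<open>Cr\<close> sets. But \<open>D < 4 * J\<close> means \<open>r \<le> 5 * (J + 1)\<close>,
      and then \<open>Llow\<close> gives at least \<open>11 / 10 * Cr\<close>.\<close>
    have ex: False if DJ: "D < 4 * J" and pl: "p \<le> 21 / 10000 * e + 102 / 100 * (c * D / J)"
    proof -
      have "p * Nn \<le> (21 / 10000 * e + 102 / 100 * (c * D / J)) * Nn" using pl pos by (intro mult_right_mono) auto
      then have E1b: "real E1 \<le> 21 / 10000 * e2 + 102 / 100 * (c * (D * Nn / J))"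
        unfolding pN eN[symmetric] by (simp add: algebra_simps)
      have "D * Nn \<le> (2 * (D - 1)) * Nn" using D2 pos by (intro mult_right_mono) auto
      also have "\<dots> = 2 * (Cr * (J + 1))" unfolding CJ by simp
      also have "\<dots> \<le> 2 * (Cr * (2 * J))" using pos J1 by (intro mult_left_mono) auto
      finally have "D * Nn / J \<le> 4 * Cr" using J1 by (simp add: pos_divide_le_eq)
      then have "c * (D * Nn / J) \<le> c * (4 * Cr)" using c by (intro mult_left_mono) auto
      also have "c * (4 * Cr) \<le> (1 / 1000000) * (4 * Cr)" using c pos by (intro mult_right_mono) auto
      finally have Z: "c * (D * Nn / J) \<le> Cr / 250000" by simp
      define Z where "Z = c * (D * Nn / J)"
      have E1c: "real E1 \<le> e2 + Cr / 1000"
        using E1b[folded Z_def] Z[folded Z_def] e2 pos by linarith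
      have "2 * c * M \<le> 2 * c * L" using MleL c by (intro mult_left_mono) auto
      also have "\<dots> \<le> (2 / 1000000) * L" using L0 c by (intro mult_right_mono) auto
      finally have "e2 \<le> L / 1000" using e2 L0 by linarith
      moreover have "L = Cr + real E1 + e2" using A12 E1 by (simp add: Cr_def)
      ultimately have up: "L * (998 / 1000) \<le> Cr * (1001 / 1000)" using E1c by linarith
      have "real r \<le> 5 * (J + 1)" using DJ unfolding D_def J_def by simp
      then have "1 / 5 \<le> (J + 1) / real r" using rj by (simp add: pos_le_divide_eq)
      then have "Cr * (1 + (499 / 500) * (1 / 5)) \<le> Cr * (1 + (499 / 500) * ((J + 1) / real r))"
        using pos by (intro mult_left_mono add_left_mono) auto
      moreover have "Cr * (11 / 10) \<le> Cr * (1 + (499 / 500) * (1 / 5))"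
        using pos by (intro mult_left_mono) auto
      ultimately have "Cr * (11 / 10) \<le> L" using Llow by linarith
      then show False using up pos by linarith
    qed
    show ?thesis
    proof (rule fine_numeric[OF J1 D2 c w p01 e01 h1 h2 hP qe i ratio a(1)])
      show "p \<le> (D - 1) * a" by (rule pw(1))
      show "11 / 10 \<le> D * a" if "97 / 100 \<le> p" using pw(2)[OF that] by simp
      show "(1 - p) * a * (J + 1) \<le> J * (q - p)" using a(4) by (simp add: J_def add.commute)
    qed (use ex in blast)
  qed
  then have "(1 - p) * Nn \<le> 40 * c * Nn" using pos by (intro mult_right_mono) auto
  moreover have "real (card (nsets S ?k - A)) = (1 - p) * Nn"
  proof -
    have "card (nsets S ?k) = card ?A1 + card (nsets S ?k - A)"
      using card_Int_Diff[OF fS, of A] by (simp add: Int_commute)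
    then have "real (card (nsets S ?k - A)) = Nn - real E1" using cS E1 by (simp add: Nn_def)
    then show ?thesis unfolding pN[symmetric] by (simp add: algebra_simps)
  qed
  ultimately show "real (card (nsets S ?k - A)) \<le> 40 * c * real (r choose Suc j)" by (simp add: Nn_def)
  show "real (Suc r) - x \<le> 40 * c"
    using \<open>1 - p \<le> 40 * c\<close> h1 h2 e01 by (simp add: w_def)
qed

section \<open>Induction on the uniformity and conclusion\<close>

lemma card_core_singletons:
  assumes "kfam (Suc 0) A"
  shows "card (core 0 x A) \<le> card A"
proof -
  let ?V = "\<Union>A"
  have "card (core 0 x A) \<le> card ?V"
    using kfam_finite_Union[OF assms] by (intro card_mono core_subset) auto
  also have "\<dots> = (\<Sum>v\<in>?V. 1)" by simp
  also have "\<dots> \<le> (\<Sum>v\<in>?V. card (link v A))"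
    by (rule sum_mono) (rule card_link_pos[OF assms])
  also have "\<dots> = card A" using sum_card_link[OF assms] by simp
  finally show ?thesis .
qed

text \<open>For a good vertex the induction hypothesis gives \<open>t + 1 / 1000\<close>, the vertex
  itself adds 1, and \<open>t \<le> x - 1 + c\<close>; the sum stays within the
  \<open>x + 1 / 500\<close> that \<open>fine_structure\<close> accepts.\<close>

lemma card_core_le:
  assumes c: "0 < c" "c \<le> 1 / 1000000"
  shows "near_extremal j c x A \<Longrightarrow> real (card (core (Suc j) x A)) \<le> x + 1 / 1000"
proof (induction j arbitrary: x A rule: less_induct)
  case (less j x A)
  note N = less.prems
  note facts = near_extremal_facts[OF N]
  let ?S = "core (Suc j) x A"
  have c': "0 \<le> c" "c \<le> 1 / 100" "c \<le> 1 / 8" using c by linarith+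
  have fS: "finite ?S"
    by (rule finite_subset[OF core_subset kfam_finite_Union[OF facts(1)]]) (use facts(4) in simp)
  have s: "real (card ?S) \<le> x + 1 / 500"
  proof (cases "\<exists>v t. good_vertex j c x A v t")
    case True
    then obtain v t where g: "good_vertex j c x A v t" by blast
    note G = g[unfolded good_vertex_def]
    have k: "kfam (Suc j) (link v A)" by (rule kfam_link[OF facts(1)])
    have t: "real (Suc j) \<le> t" "real (card (link v A)) = t gchoose Suc j" using G by simp_all
    have T: "real (card (core j t (link v A))) \<le> t + 1 / 1000"
    proof (cases j)
      case 0
      then show ?thesis using card_core_singletons[of "link v A" t] k t by simp
    next
      case (Suc i)
      have "near_extremal i c t (link v A)" using k G unfolding near_extremal_def Suc by simp
      then show ?thesis using less.IH[of i t "link v A"] Suc by simp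
    qed
    have "0 \<le> t - 1 gchoose j" using t by (intro gbinomial_real_nonneg) auto
    then have fin: "finite (core j t (link v A))"
      using finite_subset[OF core_subset kfam_finite_Union[OF k]] by blast
    have "card ?S \<le> card (insert v (core j t (link v A)))"
      using core_subset_link_core[OF N c'(1,2) g] fin by (intro card_mono) auto
    also have "\<dots> \<le> Suc (card (core j t (link v A)))" by (rule card_insert_le_m1) auto
    finally have "real (card ?S) \<le> t + 1 + 1 / 1000" using T by simp
    moreover have "t \<le> x - 1 + c"
    proof (cases "t \<le> x - 1")
      case False
      then show ?thesis using degree_upper(3)[OF N c'(1) t] by simp
    qed (use c in simp)
    ultimately show ?thesis using c by linarith
  next
    case False
    then have "real (card ?S) \<le> x + 16 * c"
      by (intro card_core_no_good_vertex[OF N c'(1,2)]) blast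
    then show ?thesis using c by linarith
  qed
  show ?case
  proof (cases "real (card ?S) \<le> x")
    case False
    have "card ?S \<noteq> 0" using False facts(2) by auto
    then obtain r where r: "card ?S = Suc r" by (cases "card ?S") auto
    have "real (Suc r) - x \<le> 40 * c"
      by (rule fine_structure(2)[OF N c fS r _ _ card_outside_core[OF N c'(1,3)]])
        (use False s r in auto)
    then show ?thesis using c r by simp
  qed simp
qed

theorem stability:
  assumes c: "0 < c" "c \<le> 1 / 1000000" and N: "near_extremal j c x A"
  defines "S \<equiv> core (Suc j) x A"
  shows "real (card (sym_diff A (nsets S (Suc (Suc j))))) \<le> 50 * c * real ((card S - 1) choose Suc j)"
    "A \<inter> nsets S (Suc (Suc j)) \<noteq> {}"
proof -
  define M where "M = x - 1 gchoose Suc j"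
  note facts = near_extremal_facts[OF N, folded M_def]
  let ?k = "Suc (Suc j)"
  let ?A1 = "A \<inter> nsets S ?k" and ?A2 = "A - nsets S ?k"
  have c': "0 \<le> c" "c \<le> 1 / 8" using c by linarith+
  have fS: "finite S" unfolding S_def
    by (rule finite_subset[OF core_subset kfam_finite_Union[OF facts(1)]]) (use facts(4) M_def in simp)
  have fN: "finite (nsets S ?k)" by (rule finite_imp_finite_nsets[OF fS])
  have fA: "finite A" by (rule kfam_finite[OF facts(1)])
  have E2: "real (card ?A2) \<le> 2 * c * M" unfolding S_def M_def by (rule card_outside_core[OF N c'])
  have A12: "real (card ?A1) + real (card ?A2) = real (card A)"
    using card_Int_Diff[OF fA, of "nsets S ?k"] by simp
  have x2: "real j + 2 \<le> x" by (rule facts(2))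
  have "M * (real j + 2) \<le> M * x" using x2 facts(4) by (intro mult_left_mono) auto
  then have "M * (real j + 2) \<le> real (card A) * (real j + 2)" using facts(8) by (simp add: mult.commute)
  then have MleL: "M \<le> real (card A)" by (rule mult_right_le_imp_le) simp
  have cM: "2 * c * M \<le> (1 / 2) * M" using c facts(4) by (intro mult_right_mono) auto
  then have "0 < real (card ?A1)" using A12 E2 MleL facts(4) by linarith
  then show ne: "?A1 \<noteq> {}" by (metis card.empty less_irrefl of_nat_0)
  have sd: "card (sym_diff A (nsets S ?k)) = card ?A2 + card (nsets S ?k - A)"
    using fA fN by (intro card_Un_disjoint) auto
  have sle: "real (card S) \<le> x + 1 / 1000" unfolding S_def by (rule card_core_le[OF c N])
  have cn: "card (nsets S ?k) = card S choose ?k" by (rule card_nsets)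
  have NA: "real (card (nsets S ?k - A)) + real (card ?A1) = real (card S choose ?k)"
    using card_Int_Diff[OF fN, of A] cn by (simp add: Int_commute)
  have "card S choose ?k > 0"
    using ne fN cn by (metis Int_empty_right card_0_eq neq0_conv)
  then have sk: "?k \<le> card S" by simp
  then obtain r where r: "card S = Suc r" by (cases "card S") auto
  define Nn where "Nn = real (r choose Suc j)"
  have gN: "Nn = real r gchoose Suc j" by (simp only: Nn_def binomial_gbinomial)
  have Nabs: "real (card S choose ?k) * (real j + 2) = real (card S) * Nn"
  proof -
    have "real (card S) - 1 = real r" "real (Suc j) + 1 = real j + 2" using r by simp_all
    then show ?thesis
      using gbinomial_absorb_mult[of "real (card S)" "Suc j"] gN by (simp only: binomial_gbinomial)
  qed
  have "real (card (sym_diff A (nsets S ?k))) \<le> 50 * c * Nn"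
  proof (cases "real (card S) \<le> x")
    case True
    \<comment> \<open>A core of size at most \<open>x\<close> spans no more sets than
      \<open>A\<close> has, so the missing sets are no more numerous than those outside. The rest of
      the case provides \<open>M \<le> 2 * Nn\<close>.\<close>
    have "real (card S choose ?k) \<le> x gchoose ?k"
      unfolding binomial_gbinomial using True sk by (intro gbinomial_real_mono) auto
    then have miss: "real (card (nsets S ?k - A)) \<le> real (card ?A2)" using NA A12 facts(10) by linarith
    have "x * M - (2 * c * M) * (real j + 2) = (real (card A) - 2 * c * M) * (real j + 2)"
      using facts(8) by (simp add: algebra_simps)
    also have "\<dots> \<le> real (card S choose ?k) * (real j + 2)"
      using NA A12 E2 by (intro mult_right_mono) auto
    also have "\<dots> \<le> x * Nn" unfolding Nabs using True by (intro mult_right_mono) (auto simp: Nn_def)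
    finally have 1: "x * M - (2 * c * M) * (real j + 2) \<le> x * Nn" .
    have "(2 * c * M) * (real j + 2) \<le> ((1 / 2) * M) * x"
      using cM x2 c facts(4) by (intro mult_mono) auto
    moreover have "((1 / 2) * M) * x = x * M / 2" "x * (M / 2) = x * M / 2" by simp_all
    ultimately have "x * (M / 2) \<le> x * Nn" using 1 by linarith
    then have "M / 2 \<le> Nn" by (rule mult_left_le_imp_le) (use x2 in simp)
    then have "4 * c * M \<le> 4 * c * (2 * Nn)" using c by (intro mult_left_mono) auto
    moreover have "0 \<le> c * Nn" using c by (simp add: Nn_def)
    ultimately show ?thesis using sd miss E2 by (simp add: algebra_simps)
  next
    case False
    have miss: "real (card (nsets S ?k - A)) \<le> 40 * c * Nn" unfolding Nn_def
      by (rule fine_structure(1)[OF N c fS r _ _ E2[unfolded M_def]]) (use False sle r in auto)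
    have "M \<le> Nn" unfolding M_def gN using False sle r x2 by (intro gbinomial_real_mono) auto
    then have "2 * c * M \<le> 2 * c * Nn" using c by (intro mult_left_mono) auto
    moreover have "0 \<le> c * Nn" using c by (simp add: Nn_def)
    ultimately show ?thesis using sd miss E2 by (simp add: algebra_simps)
  qed
  then show "real (card (sym_diff A (nsets S ?k))) \<le> 50 * c * real ((card S - 1) choose Suc j)"
    by (simp add: r Nn_def)
qed

lemma stability_singletons:
  assumes "A \<subseteq> nsets V (Suc 0)"
  shows "A = nsets (\<Union>A) (Suc 0)"
proof
  show "A \<subseteq> nsets (\<Union>A) (Suc 0)" using assms by (auto simp: nsets_def)
  show "nsets (\<Union>A) (Suc 0) \<subseteq> A"
  proof
    fix B assume "B \<in> nsets (\<Union>A) (Suc 0)"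
    then have "card B = Suc 0" "B \<subseteq> \<Union>A" by (simp_all add: nsets_def)
    then obtain b where b: "B = {b}" "b \<in> \<Union>A" by (metis card_1_singletonE One_nat_def insert_subset)
    then obtain C where C: "C \<in> A" "b \<in> C" by blast
    then have "card C = Suc 0" using assms by (auto simp: nsets_def)
    then have "C = {b}" using C(2) by (metis card_1_singletonE One_nat_def singletonD)
    then show "B \<in> A" using C b by simp
  qed
qed

text \<open>The nonempty intersection gives \<open>Suc k \<le> card S\<close>, so the truncated
  \<open>card S - 1\<close> is genuine, and the part inside \<open>S\<close> is nonempty, as
  \<open>colex_shadow_Suc\<close> requires.\<close>

lemma card_shadow_ge_J_family:
  assumes A: "kfam (Suc k) A" and S: "finite S" and ne: "A \<inter> nsets S (Suc k) \<noteq> {}"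
    and E1: "card (A \<inter> nsets S (Suc k)) = ((card S - 1) choose Suc k) + E1" "E1 \<le> (card S - 1) choose k"
    and E2: "card (A - nsets S (Suc k)) = E2" "E2 \<le> (card S - 1) choose k"
  shows "card (shadow (Suc k) (J_family (Suc k) (card S) E1 E2)) \<le> card (shadow (Suc k) A)"
proof -
  obtain B where "B \<in> nsets S (Suc k)" using ne by blast
  then have "B \<subseteq> S" "card B = Suc k" by (simp_all add: nsets_def)
  then have "Suc k \<le> card S" using card_mono[OF S] by metis
  then obtain r where r: "card S = Suc r" by (cases "card S") auto
  have "card (shadow (Suc k) (J_family (Suc k) (Suc r) E1 E2)) \<le>
      (r choose k) + colex_shadow k E1 + colex_shadow k E2"
    by (rule card_shadow_J_family) (use E1 E2 r in simp_all)
  also have "\<dots> \<le> card (shadow (Suc k) A)"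
    using card_shadow_ge_colex[OF A ne, of r E1] E1 E2 r by simp
  finally show ?thesis using r by simp
qed

theorem theorem1p2:
  fixes n k :: nat and \<delta>\<^sub>0 c x :: real and \<A> :: "nat set set"
  assumes "n \<ge> 1" and "k \<ge> 1"
    and "0 < \<delta>\<^sub>0" and "\<delta>\<^sub>0 < 1"
    and "c = \<delta>\<^sub>0 / 10 ^ 9"
    and "\<A> \<subseteq> nsets {1..n} k"
    and "x \<ge> real k"
    and "real (card \<A>) = x gchoose k"
    and "real (card (shadow k \<A>)) \<le> (1 + c / x) * (x gchoose (k - 1))"
  shows "\<exists>S \<subseteq> {1..n}.
    real (card (sym_diff \<A> (nsets S k))) \<le> \<delta>\<^sub>0 * real ((card S - 1) choose (k - 1)) \<and>
    (\<forall>E1 E2 :: nat.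
       card (\<A> \<inter> nsets S k) = ((card S - 1) choose k) + E1 \<longrightarrow>
       card (\<A> - nsets S k) = E2 \<longrightarrow>
       E1 \<le> (card S - 1) choose (k - 1) \<longrightarrow>
       E2 \<le> (card S - 1) choose (k - 1) \<longrightarrow>
       card (shadow k \<A>) \<ge> card (shadow k (J_family k (card S) E1 E2)))"
proof -
  obtain i where k: "k = Suc i" using assms(2) by (cases k) auto
  have "finite \<A>" by (rule finite_subset[OF assms(6) finite_nsets_atMost])
  then have A: "kfam k \<A>" using assms(6) by (auto simp: kfam_def nsets_def)
  have V: "\<Union>\<A> \<subseteq> {1..n}" using assms(6) by (auto simp: nsets_def)
  have pos: "0 < x gchoose k" using assms(7) by (intro gbinomial_real_pos) auto
  have c: "0 < c" "c \<le> 1 / 1000000" using assms(3,4) by (simp_all add: assms(5))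
  have "\<exists>S \<subseteq> {1..n}. real (card (sym_diff \<A> (nsets S k))) \<le> \<delta>\<^sub>0 * real ((card S - 1) choose i) \<and>
      \<A> \<inter> nsets S k \<noteq> {}"
  proof (cases i)
    \<comment> \<open>In uniformity 1 every family is complete on its union.\<close>
    case 0
    let ?S = "\<Union>\<A>"
    have eq: "\<A> = nsets ?S k" using stability_singletons[of \<A> "{1..n}"] assms(6) k 0 by simp
    have "\<A> \<noteq> {}" using pos assms(8) by force
    then have "\<A> \<inter> nsets ?S k \<noteq> {}" using eq by blast
    moreover have "sym_diff \<A> (nsets ?S k) = {}" using eq by blast
    then have "real (card (sym_diff \<A> (nsets ?S k))) \<le> \<delta>\<^sub>0 * real ((card ?S - 1) choose i)"
      using assms(3) by (simp only: card.empty) simp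
    ultimately show ?thesis using V by blast
  next
    case (Suc j)
    have N: "near_extremal j c x \<A>"
      using A assms(7-9) unfolding near_extremal_def k Suc by simp
    let ?S = "core (Suc j) x \<A>"
    have "?S \<subseteq> {1..n}"
      using core_subset[of x "Suc j" \<A>] near_extremal_facts(4)[OF N] V by (auto simp: less_imp_le)
    \<comment> \<open>\<open>50 * c \<le> \<delta>\<^sub>0\<close>, as \<open>c\<close> is
      \<open>\<delta>\<^sub>0 / 10 ^ 9\<close>.\<close>
    moreover have "50 * c * real ((card ?S - 1) choose Suc j) \<le> \<delta>\<^sub>0 * real ((card ?S - 1) choose Suc j)"
      using assms(3) by (intro mult_right_mono) (simp_all add: assms(5))
    then have "real (card (sym_diff \<A> (nsets ?S k))) \<le> \<delta>\<^sub>0 * real ((card ?S - 1) choose i)"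
      using stability(1)[OF c N] unfolding k Suc by linarith
    moreover have "\<A> \<inter> nsets ?S k \<noteq> {}" using stability(2)[OF c N] unfolding k Suc .
    ultimately show ?thesis by blast
  qed
  then obtain S where S: "S \<subseteq> {1..n}"
    "real (card (sym_diff \<A> (nsets S k))) \<le> \<delta>\<^sub>0 * real ((card S - 1) choose i)" "\<A> \<inter> nsets S k \<noteq> {}"
    by blast
  have "card (shadow k \<A>) \<ge> card (shadow k (J_family k (card S) E1 E2))"
    if "card (\<A> \<inter> nsets S k) = ((card S - 1) choose k) + E1" "card (\<A> - nsets S k) = E2"
      "E1 \<le> (card S - 1) choose i" "E2 \<le> (card S - 1) choose i" for E1 E2
    using card_shadow_ge_J_family[of i \<A> S E1 E2] A S(3) finite_subset[OF S(1)] that unfolding k by blast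
  then show ?thesis using S(1,2) unfolding k diff_Suc_1 by blast
qed

end
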